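(* Let $\mathring\psi_1$ satisfy $\theta^2|\mathring\psi_1(\theta)|\le C$ and $\theta^3|\mathring\psi_1'(\theta)|\le C$ as $\theta\to\infty$, and let $a_n,R_n>0$ satisfy $a_n\to0$, $R_n\to0$, $a_nR_n^{-4}\to0$. Let $\psi_n$ be the wave-corpuscle solutions of the NLS equation with size parameter $a=a_n$, associated with a trajectory $\mathbf r:[T_-,T_+]\to\mathbb R^3$ satisfying Newton's equation and with admissible potentials $\varphi,\mathbf A$ (both as described in the context). Then the sequence $\psi_n$ of solutions of the NLS equation (with potentials $\varphi_n,\mathbf A_n$ equal to the restrictions of $\varphi,\mathbf A$) concentrates at the trajectory $\hat{\mathbf r}(t)=\mathbf r(t)$.
   Context: **NLS equation and densities.** $m,q,\chi,\mathrm c>0$ are fixed constants. Given real $\varphi(t,\mathbf x)$ and $\mathbf A(t,\mathbf x)\in\mathbb R^3$ put $\tilde\partial_t=\partial_t+\frac{iq}{\chi}\varphi$, $\tilde\nabla=\nabla-\frac{iq}{\chi\mathrm c}\mathbf A$ (components $\tilde\partial_j$), $\tilde\partial_t^*=\partial_t-\frac{iq}{\chi}\varphi$, $\tilde\nabla^*=\nabla+\frac{iq}{\chi\mathrm c}\mathbf A$, $\mathbf E=-\nabla\varphi-\frac1{\mathrm c}\partial_t\mathbf A$, $\mathbf B=\nabla\times\mathbf A$. The NLS equation with size parameter $a>0$ is $i\tilde\partial_t\psi=\frac{\chi}{2m}\left[-\tilde\nabla^2\psi+G_a'(\psi^*\psi)\psi\right]$, where $\psi$ is complex valued, $G_a'(s)=a^{-2}G_1'(a^3s)$,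 $G_a(s)=\int_0^sG_a'(s')\,ds'$. Standing condition on the nonlinearity: $G_1'$ is real valued and continuous for $s>0$, it is the derivative of $G_1$, which is differentiable for $s>0$ and continuous for $s\ge0$; $\psi\mapsto G_1(\psi^*\psi)$ is differentiable on $\mathbb C$ with differential $g(\psi)\,d\psi^*+g^*(\psi)\,d\psi$, where $g(\psi)=G_1'(\psi^*\psi)\psi$ for $\psi\ne0$, $g(0)=0$, and $g$ is continuous on $\mathbb C$. Define $\rho=q\psi\psi^*$, $\mathbf J=-\frac{iq\chi}{2m}(\psi^*\tilde\nabla\psi-\psi\tilde\nabla^*\psi^* )$, $\mathbf P=\frac{i\chi}{2}(\psi\tilde\nabla^*\psi^*-\psi^*\tilde\nabla\psi)$, $u=\frac{\chi^2}{2m}\left[|\tilde\nabla\psi|^2+G_a(|\psi|^2)\right]$, and for $i,j\in\{1,2,3\}$: $T^{ij}=\frac{\chi^2}{2m}(\tilde\partial_i\psi\,\tilde\partial_j^*\psi^*+\tilde\partial_j\psi\,\tilde\partial_i^*\psi^* )$ if $i\ne j$; $T^{ii}=-u+\frac{\chi^2}{m}\tilde\partial_i\psi\,\tilde\partial_i^*\psi^*+\frac{i\chi}{2}(\psi^*\tilde\partial_t\psi-\psi\tilde\partial_t^*\psi^* )$ (no sum). **Form factor.** $\mathring\psi_1=\mathring\psi_1(|\mathbf x|)>0$ is a radial, twice continuously differentiable, square integrable solution of $-\nabla^2\mathring\psi_1+G_1'(\mathring\psi_1^2)\mathring\psi_1=0$ on $\mathbb R^3$, and $\mathring\psi_a(r)=a^{-3/2}\mathring\psi_1(a^{-1}r)$.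 **Admissible potentials and wave-corpuscles.** $\mathbf r\in C^2([T_-,T_+];\mathbb R^3)$, $\mathbf v=\partial_t\mathbf r$, $\mathbf y=\mathbf x-\mathbf r(t)$. The potentials have the form $\varphi=\varphi_0(t)+\mathbf y\cdot\mathbf g(t)+\varphi_2(t,\mathbf y)$, $\mathbf A=\mathbf A_0(t)+\mathbf A_1(t)\mathbf y+\nabla P_3(t,\mathbf y)$, where $\varphi_0,\mathbf g,\mathbf A_0$ and the $3\times3$ matrix $\mathbf A_1$ are continuously differentiable in $t$, $\nabla P_3$ is continuously differentiable in $(t,\mathbf y)$, $P_3$ has a zero of at least third degree at $\mathbf y=0$, and $$\varphi_2(t,\mathbf y)=-\frac{q}{2m\mathrm c^2}|\breve{\mathbf A}|^2-\frac1{\mathrm c}\partial_t(P_2+P_3)+\frac1{\mathrm c}\mathbf v\cdot\nabla P_3,\quad P_2=\tfrac12\mathbf y\cdot\mathbf A_1(t)\mathbf y,\quad \breve{\mathbf A}=\tfrac12(\mathbf A_1(t)-\mathbf A_1^{\mathrm T}(t))\mathbf y$$ ($\partial_t$ at fixed $\mathbf y$). As functions of $(t,\mathbf x)$, $\varphi$ and $\mathbf A$ are assumed twice continuously differentiable. The trajectory satisfies Newton's equation $m\partial_t^2\mathbf r=q\mathbf E(t,\mathbf r)+\frac q{\mathrm c}\mathbf v\times\mathbf B(t,\mathbf r)$. The wave-corpuscle with size parameter $a$ is $\psi(t,\mathbf x)=e^{iS(t,\mathbf y)}\mathring\psi_a(|\mathbf y|)$, $\mathbf y=\mathbf x-\mathbf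 r(t)$, with $$S=\frac m\chi\mathbf v\cdot\mathbf y+\frac q{\chi\mathrm c}\mathbf y\cdot\mathbf A_0(t)+s_{\mathrm p}(t)+s_{\mathrm p2}(t,\mathbf y),\quad s_{\mathrm p}=\frac1\chi\int_{t_*}^t\left(\tfrac12m\mathbf v^2+\frac q{\mathrm c}\mathbf v\cdot\mathbf A_0-q\varphi_0\right)dt',$$ $s_{\mathrm p2}=\frac q{\chi\mathrm c}\int_0^1\mathbf y\cdot\left(\mathbf A_1(t)s\mathbf y+\nabla P_3(t,s\mathbf y)\right)ds$, where $t_*$ is a fixed base time. It is an exact solution of the NLS equation with potentials $\varphi,\mathbf A$ and size parameter $a$. **Trajectories and neighborhoods.** A trajectory is a $C^2$ function $\hat{\mathbf r}:[T_-,T_+]\to\mathbb R^3$ with bounded first and second derivatives; $\hat{\mathbf v}=\partial_t\hat{\mathbf r}$. $\Omega_n=\Omega_n(t)=\{\mathbf x:|\mathbf x-\hat{\mathbf r}(t)|\le R_n\}$, $\hat\Omega_n=\{(t,\mathbf x):T_-\le t\le T_+,\ \mathbf x\in\Omega_n(t)\}$; $\bar{\mathbf n}$ is the outer unit normal to $\partial\Omega_n$, $d\sigma$ surface measure; $C$ denotes constants independent of $n$. **Concentrating solutions (fixed potentials).** Put $\mathbf E_\infty(t)=\mathbf E(t,\hat{\mathbf r}(t))$, $\mathbf B_\infty(t)=\mathbf B(t,\hat{\mathbf r}(t))$. For fixed twice continuously differentiable potentials $\varphi,\mathbf A$ restricted to $\hat\Omega_n$, the sequence $\psi_n$ concentrates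 at $\hat{\mathbf r}$ if the condition on the nonlinearity holds, $a_n\to0$, $R_n\to0$, $R_n/a_n\to\infty$, $\psi_n\in C^2(\hat\Omega_n)$, and the following hold, where densities are computed from $\psi_n,\varphi,\mathbf A,a_n$, $\bar\rho_n(t)=\int_{\Omega_n}\rho_n\,d\mathbf x$, and $\mathbf r_n(t)=\frac1{\bar\rho_n}\int_{\Omega_n}\mathbf x\rho_n\,d\mathbf x$: (i) $\psi_n$ solves the NLS equation with $a=a_n$ in $\hat\Omega_n$. (ii) $\left|\int_{\Omega_n}\mathbf P_n(t)\,d\mathbf x\right|\le C$ for $T_-\le t\le T_+$. (iii) $C\ge\bar\rho_n(t)\ge c_0>0$ for $n\ge n_0$, $T_-\le t\le T_+$. (iv) There is $t_0\in[T_-,T_+]$ such that $\bar\rho_n(t_0)$ converges to a limit $\bar\rho_\infty$. (v) Uniformly on $[T_-,T_+]$ the following tend to $0$: $\int_{t_0}^t\int_{\partial\Omega_n}\bar{\mathbf n}_iT^{ij}d\sigma dt'$ (sum over $i$); $\int_{t_0}^t\int_{\partial\Omega_n}\mathbf P\,\hat{\mathbf v}\cdot\bar{\mathbf n}\,d\sigma dt'$; $\int_{\partial\Omega_n}(\mathbf x-\mathbf r_n)\hat{\mathbf v}\cdot\bar{\mathbf n}\,\rho\,d\sigma$; $\int_{\partial\Omega_n}(\mathbf x-\mathbf r_n)\bar{\mathbf n}\cdot\mathbf J\,d\sigma$; $\int_{t_0}^t\int_{\partial\Omega_n}\hat{\mathbf v}\cdot\bar{\mathbf n}\,\rho\,d\sigma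 dt'-\int_{t_0}^t\int_{\partial\Omega_n}\bar{\mathbf n}\cdot\mathbf J\,d\sigma dt'$. (vi) $\int_{t_0}^t\left(\int_{\Omega_n}(\mathbf E-\mathbf E_\infty)\rho\,d\mathbf x+\int_{\Omega_n}\frac1{\mathrm c}\mathbf J\times(\mathbf B-\mathbf B_\infty)\,d\mathbf x\right)dt'\to0$ uniformly on $[T_-,T_+]$. *)

theory Defs
  imports "HOL-Analysis.Analysis"
begin

unbundle no cross3_syntax
unbundle set_product_syntax

section \<open>Calculus on subsets of a normed space\<close>

text \<open>
  Derivatives on a set \<open>S\<close> are taken within \<open>S\<close>, hence one-sided at boundary points. They are
  uniquely determined on all sets used below (time intervals of positive length, space-time strips
  over them, tubes of positive radius, and whole spaces).
\<close>

definition C1_on :: "'a::real_normed_vector set \<Rightarrow> ('a \<Rightarrow> 'b::real_normed_vector) \<Rightarrow> bool" where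
  "C1_on S f \<longleftrightarrow> (\<exists>f'. (\<forall>p\<in>S. (f has_derivative blinfun_apply (f' p)) (at p within S)) \<and>
     continuous_on S f')"

definition C2_on :: "'a::real_normed_vector set \<Rightarrow> ('a \<Rightarrow> 'b::real_normed_vector) \<Rightarrow> bool" where
  "C2_on S f \<longleftrightarrow> (\<exists>f'. (\<forall>p\<in>S. (f has_derivative blinfun_apply (f' p)) (at p within S)) \<and>
     C1_on S f')"

definition dir_deriv ::
  "'a::real_normed_vector set \<Rightarrow> 'a \<Rightarrow> ('a \<Rightarrow> 'b::real_normed_vector) \<Rightarrow> 'a \<Rightarrow> 'b" where
  "dir_deriv S b f p = frechet_derivative f (at p within S) b"

definition grad :: "(real^3 \<Rightarrow> real) \<Rightarrow> real^3 \<Rightarrow> real^3" where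
  "grad f x = (\<chi> j. dir_deriv UNIV (axis j 1) f x)"

definition laplacian :: "(real^3 \<Rightarrow> real) \<Rightarrow> real^3 \<Rightarrow> real" where
  "laplacian f x = (\<Sum>j\<in>UNIV. dir_deriv UNIV (axis j 1) (dir_deriv UNIV (axis j 1) f) x)"

type_synonym spacetime = "real \<times> (real^3)"

definition dt :: "spacetime set \<Rightarrow> (spacetime \<Rightarrow> 'b::real_normed_vector) \<Rightarrow> spacetime \<Rightarrow> 'b" where
  "dt D = dir_deriv D (1, 0)"

definition dx :: "spacetime set \<Rightarrow> 3 \<Rightarrow> (spacetime \<Rightarrow> 'b::real_normed_vector) \<Rightarrow> spacetime \<Rightarrow> 'b" where
  "dx D j = dir_deriv D (0, axis j 1)"

section \<open>Surface integrals over spheres\<close>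

definition sphere_point :: "real \<times> real \<Rightarrow> real^3" where
  "sphere_point w = vector [sin (fst w) * cos (snd w), sin (fst w) * sin (snd w), cos (fst w)]"

text \<open>
  The surface element of the sphere of radius \<open>R\<close> in spherical coordinates, with polar angle
  \<open>fst w\<close> and azimuth \<open>snd w\<close>, is \<open>R\<^sup>2 sin (fst w)\<close>. Only the values of \<open>F\<close> on the sphere
  \<open>|x - z| = R\<close> enter.
\<close>

definition sphere_integral ::
  "real^3 \<Rightarrow> real \<Rightarrow> (real^3 \<Rightarrow> 'b::{banach, second_countable_topology}) \<Rightarrow> 'b" where
  "sphere_integral z R F =
     (LINT w:{0..pi} \<times> {0..2*pi}|lborel. (R\<^sup>2 * sin (fst w)) *\<^sub>R F (z + R *\<^sub>R sphere_point w))"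

section \<open>The nonlinearity and the form factor\<close>

definition nonlin_g :: "(real \<Rightarrow> real) \<Rightarrow> complex \<Rightarrow> complex" where
  "nonlin_g G1' z = (if z = 0 then 0 else of_real (G1' ((cmod z)\<^sup>2)) * z)"

definition nonlinearity_condition :: "(real \<Rightarrow> real) \<Rightarrow> (real \<Rightarrow> real) \<Rightarrow> bool" where
  "nonlinearity_condition G1 G1' \<longleftrightarrow>
     continuous_on {0<..} G1' \<and>
     (\<forall>s>0. (G1 has_real_derivative G1' s) (at s)) \<and>
     continuous_on {0..} G1 \<and>
     (\<forall>z::complex. ((\<lambda>z. complex_of_real (G1 ((cmod z)\<^sup>2))) has_derivative
        (\<lambda>h. nonlin_g G1' z * cnj h + cnj (nonlin_g G1' z) * h)) (at z)) \<and>
     continuous_on UNIV (nonlin_g G1')"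

definition form_factor :: "(real \<Rightarrow> real) \<Rightarrow> (real \<Rightarrow> real) \<Rightarrow> bool" where
  "form_factor G1' \<psi>1 \<longleftrightarrow>
     (\<forall>r\<ge>0. \<psi>1 r > 0) \<and>
     C2_on UNIV (\<lambda>x::real^3. \<psi>1 (norm x)) \<and>
     integrable lborel (\<lambda>x::real^3. (\<psi>1 (norm x))\<^sup>2) \<and>
     (\<forall>x::real^3. - laplacian (\<lambda>z. \<psi>1 (norm z)) x
        + G1' ((\<psi>1 (norm x))\<^sup>2) * \<psi>1 (norm x) = 0)"

definition scaled_form_factor :: "(real \<Rightarrow> real) \<Rightarrow> real \<Rightarrow> real \<Rightarrow> real" where
  "scaled_form_factor \<psi>1 a r = a powr (-3/2) * \<psi>1 (r / a)"

section \<open>The NLS equation, its densities, and concentration\<close>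

text \<open>The constant playing the role of the reduced Planck constant is called \<open>chi\<close>, since
  \<open>\<chi>\<close> is the binder for vectors.\<close>

locale nls =
  fixes m q chi c :: real
    and G1 G1' :: "real \<Rightarrow> real"
    and Tm Tp :: real
begin

definition strip :: "spacetime set" where
  "strip = {Tm..Tp} \<times> UNIV"

definition tube :: "(real \<Rightarrow> real^3) \<Rightarrow> real \<Rightarrow> spacetime set" where
  "tube r R = {(t, x). t \<in> {Tm..Tp} \<and> norm (x - r t) \<le> R}"

definition velocity :: "(real \<Rightarrow> real^3) \<Rightarrow> real \<Rightarrow> real^3" where
  "velocity r t = vector_derivative r (at t within {Tm..Tp})"

definition acceleration :: "(real \<Rightarrow> real^3) \<Rightarrow> real \<Rightarrow> real^3" where
  "acceleration r t = vector_derivative (velocity r) (at t within {Tm..Tp})"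

definition trajectory :: "(real \<Rightarrow> real^3) \<Rightarrow> bool" where
  "trajectory r \<longleftrightarrow> C2_on {Tm..Tp} r \<and> bounded (velocity r ` {Tm..Tp}) \<and>
     bounded (acceleration r ` {Tm..Tp})"

definition E_field :: "(spacetime \<Rightarrow> real) \<Rightarrow> (spacetime \<Rightarrow> real^3) \<Rightarrow> spacetime \<Rightarrow> real^3" where
  "E_field \<phi> A p = - (\<chi> j. dx strip j \<phi> p) - (1 / c) *\<^sub>R dt strip A p"

definition B_field :: "(spacetime \<Rightarrow> real^3) \<Rightarrow> spacetime \<Rightarrow> real^3" where
  "B_field A p = vector
     [dx strip 2 A p $ 3 - dx strip 3 A p $ 2,
      dx strip 3 A p $ 1 - dx strip 1 A p $ 3,
      dx strip 1 A p $ 2 - dx strip 2 A p $ 1]"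

definition newton :: "(spacetime \<Rightarrow> real) \<Rightarrow> (spacetime \<Rightarrow> real^3) \<Rightarrow> (real \<Rightarrow> real^3) \<Rightarrow> bool" where
  "newton \<phi> A r \<longleftrightarrow> (\<forall>t\<in>{Tm..Tp}.
     m *\<^sub>R acceleration r t =
       q *\<^sub>R E_field \<phi> A (t, r t) + (q / c) *\<^sub>R cross3 (velocity r t) (B_field A (t, r t)))"

subsection \<open>Covariant derivatives and the equation\<close>

text \<open>The argument \<open>D\<close> is the space-time domain of the wave function. The conjugated operators
  (suffix \<open>conj\<close>) are to be applied to the conjugated wave function \<open>\<lambda>p. cnj (\<psi> p)\<close>.\<close>

definition cov_t where
  "cov_t D \<phi> \<psi> p = dt D \<psi> p + \<i> * of_real (q / chi * \<phi> p) * (\<psi> p :: complex)"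

definition cov_t_conj where
  "cov_t_conj D \<phi> \<psi> p = dt D \<psi> p - \<i> * of_real (q / chi * \<phi> p) * (\<psi> p :: complex)"

definition cov_x where
  "cov_x D A j \<psi> p = dx D j \<psi> p - \<i> * of_real (q / (chi * c) * (A p :: real^3) $ j) * (\<psi> p :: complex)"

definition cov_x_conj where
  "cov_x_conj D A j \<psi> p =
     dx D j \<psi> p + \<i> * of_real (q / (chi * c) * (A p :: real^3) $ j) * (\<psi> p :: complex)"

definition Ga' :: "real \<Rightarrow> real \<Rightarrow> real" where
  "Ga' a s = G1' (a^3 * s) / a\<^sup>2"

definition Ga :: "real \<Rightarrow> real \<Rightarrow> real" where
  "Ga a s = (LBINT s'=0..s. Ga' a s')"

definition solves_NLS ::
  "spacetime set \<Rightarrow> (spacetime \<Rightarrow> real) \<Rightarrow> (spacetime \<Rightarrow> real^3) \<Rightarrow> real \<Rightarrow>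
     (spacetime \<Rightarrow> complex) \<Rightarrow> bool" where
  "solves_NLS D \<phi> A a \<psi> \<longleftrightarrow> (\<forall>p\<in>D.
     \<i> * cov_t D \<phi> \<psi> p =
       of_real (chi / (2 * m)) *
         (- (\<Sum>j\<in>UNIV. cov_x D A j (cov_x D A j \<psi>) p) + of_real (Ga' a ((cmod (\<psi> p))\<^sup>2)) * \<psi> p))"

subsection \<open>Densities\<close>

text \<open>In \<open>cur\<close>, \<open>mom\<close> and \<open>stress\<close> the argument of \<open>Re\<close> is a real number, written as a complex
  expression; \<open>Re\<close> only adjusts the type.\<close>

definition rho :: "(spacetime \<Rightarrow> complex) \<Rightarrow> spacetime \<Rightarrow> real" where
  "rho \<psi> p = q * (cmod (\<psi> p))\<^sup>2"

definition cur ::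
  "spacetime set \<Rightarrow> (spacetime \<Rightarrow> real^3) \<Rightarrow> (spacetime \<Rightarrow> complex) \<Rightarrow> spacetime \<Rightarrow> real^3" where
  "cur D A \<psi> p = (\<chi> j. Re (- (\<i> * of_real (q * chi / (2 * m))) *
     (cnj (\<psi> p) * cov_x D A j \<psi> p - \<psi> p * cov_x_conj D A j (\<lambda>z. cnj (\<psi> z)) p)))"

definition mom ::
  "spacetime set \<Rightarrow> (spacetime \<Rightarrow> real^3) \<Rightarrow> (spacetime \<Rightarrow> complex) \<Rightarrow> spacetime \<Rightarrow> real^3" where
  "mom D A \<psi> p = (\<chi> j. Re (\<i> * of_real (chi / 2) *
     (\<psi> p * cov_x_conj D A j (\<lambda>z. cnj (\<psi> z)) p - cnj (\<psi> p) * cov_x D A j \<psi> p)))"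

definition energy ::
  "spacetime set \<Rightarrow> (spacetime \<Rightarrow> real^3) \<Rightarrow> real \<Rightarrow> (spacetime \<Rightarrow> complex) \<Rightarrow> spacetime \<Rightarrow> real" where
  "energy D A a \<psi> p = chi\<^sup>2 / (2 * m) *
     ((\<Sum>j\<in>UNIV. (cmod (cov_x D A j \<psi> p))\<^sup>2) + Ga a ((cmod (\<psi> p))\<^sup>2))"

definition stress ::
  "spacetime set \<Rightarrow> (spacetime \<Rightarrow> real) \<Rightarrow> (spacetime \<Rightarrow> real^3) \<Rightarrow> real \<Rightarrow>
     (spacetime \<Rightarrow> complex) \<Rightarrow> 3 \<Rightarrow> 3 \<Rightarrow> spacetime \<Rightarrow> real" where
  "stress D \<phi> A a \<psi> i j p = (let \<psi>' = (\<lambda>z. cnj (\<psi> z)) in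
     if i \<noteq> j then
       Re (of_real (chi\<^sup>2 / (2 * m)) *
         (cov_x D A i \<psi> p * cov_x_conj D A j \<psi>' p + cov_x D A j \<psi> p * cov_x_conj D A i \<psi>' p))
     else
       - energy D A a \<psi> p
       + Re (of_real (chi\<^sup>2 / m) * (cov_x D A i \<psi> p * cov_x_conj D A i \<psi>' p)
         + \<i> * of_real (chi / 2) * (cnj (\<psi> p) * cov_t D \<phi> \<psi> p - \<psi> p * cov_t_conj D \<phi> \<psi>' p)))"

subsection \<open>Concentrating sequences\<close>

definition total_charge ::
  "(real \<Rightarrow> real^3) \<Rightarrow> real \<Rightarrow> (spacetime \<Rightarrow> complex) \<Rightarrow> real \<Rightarrow> real" where
  "total_charge r R \<psi> t = (LINT x:cball (r t) R|lborel. rho \<psi> (t, x))"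

definition charge_center ::
  "(real \<Rightarrow> real^3) \<Rightarrow> real \<Rightarrow> (spacetime \<Rightarrow> complex) \<Rightarrow> real \<Rightarrow> real^3" where
  "charge_center r R \<psi> t =
     (1 / total_charge r R \<psi> t) *\<^sub>R (LINT x:cball (r t) R|lborel. rho \<psi> (t, x) *\<^sub>R x)"

text \<open>Below, \<open>r\<close> is the trajectory of concentration, \<open>\<nu> n t\<close> is the outer unit normal field on
  the sphere bounding the ball of radius \<open>R n\<close> about \<open>r t\<close>, and \<open>D n\<close> is the domain on which
  the n-th wave function is considered. The integrals over time are oriented.\<close>

definition concentrates ::
  "(real \<Rightarrow> real^3) \<Rightarrow> (spacetime \<Rightarrow> real) \<Rightarrow> (spacetime \<Rightarrow> real^3) \<Rightarrow>
     (nat \<Rightarrow> real) \<Rightarrow> (nat \<Rightarrow> real) \<Rightarrow> (nat \<Rightarrow> spacetime \<Rightarrow> complex) \<Rightarrow> bool" where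
  "concentrates r \<phi> A a R \<psi> \<longleftrightarrow>
    (let D = (\<lambda>n. tube r (R n));
         I = {Tm..Tp};
         v = velocity r;
         \<nu> = (\<lambda>n t x. (1 / R n) *\<^sub>R (x - r t));
         \<rho> = (\<lambda>n. rho (\<psi> n));
         J = (\<lambda>n. cur (D n) A (\<psi> n));
         P = (\<lambda>n. mom (D n) A (\<psi> n));
         T = (\<lambda>n. stress (D n) \<phi> A (a n) (\<psi> n));
         rc = (\<lambda>n. charge_center r (R n) (\<psi> n));
         E = E_field \<phi> A;
         B = B_field A
     in
       trajectory r \<and> C2_on strip \<phi> \<and> C2_on strip A \<and>
       nonlinearity_condition G1 G1' \<and>
       (\<forall>n. a n > 0) \<and> (\<forall>n. R n > 0) \<and>
       a \<longlonglongrightarrow> 0 \<and> R \<longlonglongrightarrow> 0 \<and> filterlim (\<lambda>n. R n / a n) at_top sequentially \<and>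
       (\<forall>n. C2_on (D n) (\<psi> n)) \<and>
       (\<forall>n. solves_NLS (D n) \<phi> A (a n) (\<psi> n)) \<and>
       (\<exists>C. \<forall>n. \<forall>t\<in>I. norm (LINT x:cball (r t) (R n)|lborel. P n (t, x)) \<le> C) \<and>
       (\<exists>C c0 n0. c0 > 0 \<and>
          (\<forall>n\<ge>n0. \<forall>t\<in>I. c0 \<le> total_charge r (R n) (\<psi> n) t \<and> total_charge r (R n) (\<psi> n) t \<le> C)) \<and>
       (\<exists>t0\<in>I.
          convergent (\<lambda>n. total_charge r (R n) (\<psi> n) t0) \<and>
          uniform_limit I
            (\<lambda>n t. LBINT s=t0..t. sphere_integral (r s) (R n)
               (\<lambda>x. \<chi> j. \<Sum>i\<in>UNIV. \<nu> n s x $ i * T n i j (s, x)))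
            (\<lambda>t. 0) sequentially \<and>
          uniform_limit I
            (\<lambda>n t. LBINT s=t0..t. sphere_integral (r s) (R n)
               (\<lambda>x. (v s \<bullet> \<nu> n s x) *\<^sub>R P n (s, x)))
            (\<lambda>t. 0) sequentially \<and>
          uniform_limit I
            (\<lambda>n t. sphere_integral (r t) (R n)
               (\<lambda>x. ((v t \<bullet> \<nu> n t x) * \<rho> n (t, x)) *\<^sub>R (x - rc n t)))
            (\<lambda>t. 0) sequentially \<and>
          uniform_limit I
            (\<lambda>n t. sphere_integral (r t) (R n)
               (\<lambda>x. (\<nu> n t x \<bullet> J n (t, x)) *\<^sub>R (x - rc n t)))
            (\<lambda>t. 0) sequentially \<and>
          uniform_limit I
            (\<lambda>n t. (LBINT s=t0..t. sphere_integral (r s) (R n)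
                      (\<lambda>x. (v s \<bullet> \<nu> n s x) * \<rho> n (s, x)))
                 - (LBINT s=t0..t. sphere_integral (r s) (R n)
                      (\<lambda>x. \<nu> n s x \<bullet> J n (s, x))))
            (\<lambda>t. 0) sequentially \<and>
          uniform_limit I
            (\<lambda>n t. LBINT s=t0..t.
                 (LINT x:cball (r s) (R n)|lborel. \<rho> n (s, x) *\<^sub>R (E (s, x) - E (s, r s)))
               + (LINT x:cball (r s) (R n)|lborel.
                    (1 / c) *\<^sub>R cross3 (J n (s, x)) (B (s, x) - B (s, r s))))
            (\<lambda>t. 0) sequentially))"

subsection \<open>Admissible potentials and wave-corpuscles\<close>

definition P2 :: "(real \<Rightarrow> real^3^3) \<Rightarrow> spacetime \<Rightarrow> real" where
  "P2 A1 = (\<lambda>(t, y). 1/2 * (y \<bullet> (A1 t *v y)))"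

definition A_breve :: "(real \<Rightarrow> real^3^3) \<Rightarrow> spacetime \<Rightarrow> real^3" where
  "A_breve A1 = (\<lambda>(t, y). (1/2) *\<^sub>R ((A1 t - transpose (A1 t)) *v y))"

definition grad_y :: "(spacetime \<Rightarrow> real) \<Rightarrow> spacetime \<Rightarrow> real^3" where
  "grad_y f = (\<lambda>(t, y). grad (\<lambda>z. f (t, z)) y)"

definition phi2 ::
  "(real \<Rightarrow> real^3) \<Rightarrow> (real \<Rightarrow> real^3^3) \<Rightarrow> (spacetime \<Rightarrow> real) \<Rightarrow> spacetime \<Rightarrow> real" where
  "phi2 r A1 P3 = (\<lambda>(t, y).
     - (q / (2 * m * c\<^sup>2)) * (norm (A_breve A1 (t, y)))\<^sup>2
     - (1 / c) * vector_derivative (\<lambda>s. P2 A1 (s, y) + P3 (s, y)) (at t within {Tm..Tp})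
     + (1 / c) * (velocity r t \<bullet> grad_y P3 (t, y)))"

text \<open>Since \<open>P3\<close> is only assumed to be twice continuously differentiable in the space variable,
  a zero of at least third degree means that its derivatives of order at most two vanish.\<close>

definition third_degree_zero :: "(spacetime \<Rightarrow> real) \<Rightarrow> bool" where
  "third_degree_zero P3 \<longleftrightarrow> (\<forall>t\<in>{Tm..Tp}. P3 (t, 0) = 0 \<and> grad_y P3 (t, 0) = 0 \<and>
     (\<forall>j. dir_deriv UNIV (axis j 1) (\<lambda>z. grad_y P3 (t, z)) 0 = 0))"

definition admissible_potentials ::
  "(real \<Rightarrow> real^3) \<Rightarrow> (spacetime \<Rightarrow> real) \<Rightarrow> (spacetime \<Rightarrow> real^3) \<Rightarrow>
     (real \<Rightarrow> real) \<Rightarrow> (real \<Rightarrow> real^3) \<Rightarrow> (real \<Rightarrow> real^3) \<Rightarrow> (real \<Rightarrow> real^3^3) \<Rightarrow>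
     (spacetime \<Rightarrow> real) \<Rightarrow> bool" where
  "admissible_potentials r \<phi> A \<phi>0 g A0 A1 P3 \<longleftrightarrow>
     C1_on {Tm..Tp} \<phi>0 \<and> C1_on {Tm..Tp} g \<and> C1_on {Tm..Tp} A0 \<and> C1_on {Tm..Tp} A1 \<and>
     (\<forall>t\<in>{Tm..Tp}. \<forall>y. (\<lambda>z. P3 (t, z)) differentiable (at y)) \<and>
     C1_on strip (grad_y P3) \<and> third_degree_zero P3 \<and>
     (\<forall>t\<in>{Tm..Tp}. \<forall>x.
        \<phi> (t, x) = \<phi>0 t + (x - r t) \<bullet> g t + phi2 r A1 P3 (t, x - r t)) \<and>
     (\<forall>t\<in>{Tm..Tp}. \<forall>x.
        A (t, x) = A0 t + A1 t *v (x - r t) + grad_y P3 (t, x - r t)) \<and>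
     C2_on strip \<phi> \<and> C2_on strip A"

definition s_p ::
  "real \<Rightarrow> (real \<Rightarrow> real^3) \<Rightarrow> (real \<Rightarrow> real) \<Rightarrow> (real \<Rightarrow> real^3) \<Rightarrow> real \<Rightarrow> real" where
  "s_p tstar r \<phi>0 A0 t = 1 / chi * (LBINT s=tstar..t.
     1/2 * m * (norm (velocity r s))\<^sup>2 + q / c * (velocity r s \<bullet> A0 s) - q * \<phi>0 s)"

definition s_p2 :: "(real \<Rightarrow> real^3^3) \<Rightarrow> (spacetime \<Rightarrow> real) \<Rightarrow> spacetime \<Rightarrow> real" where
  "s_p2 A1 P3 = (\<lambda>(t, y). q / (chi * c) *
     (LBINT s=0..1. y \<bullet> (A1 t *v (s *\<^sub>R y) + grad_y P3 (t, s *\<^sub>R y))))"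

definition phase ::
  "real \<Rightarrow> (real \<Rightarrow> real^3) \<Rightarrow> (real \<Rightarrow> real) \<Rightarrow> (real \<Rightarrow> real^3) \<Rightarrow> (real \<Rightarrow> real^3^3) \<Rightarrow>
     (spacetime \<Rightarrow> real) \<Rightarrow> spacetime \<Rightarrow> real" where
  "phase tstar r \<phi>0 A0 A1 P3 = (\<lambda>(t, y).
     m / chi * (velocity r t \<bullet> y) + q / (chi * c) * (y \<bullet> A0 t)
     + s_p tstar r \<phi>0 A0 t + s_p2 A1 P3 (t, y))"

definition wave_corpuscle ::
  "(real \<Rightarrow> real) \<Rightarrow> real \<Rightarrow> (real \<Rightarrow> real^3) \<Rightarrow> (real \<Rightarrow> real) \<Rightarrow> (real \<Rightarrow> real^3) \<Rightarrow>
     (real \<Rightarrow> real^3^3) \<Rightarrow> (spacetime \<Rightarrow> real) \<Rightarrow> real \<Rightarrow> spacetime \<Rightarrow> complex" where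
  "wave_corpuscle \<psi>1 tstar r \<phi>0 A0 A1 P3 a = (\<lambda>(t, x).
     exp (\<i> * of_real (phase tstar r \<phi>0 A0 A1 P3 (t, x - r t))) *
     of_real (scaled_form_factor \<psi>1 a (norm (x - r t))))"

end

end

theory Submission
  imports Defs
begin

text \<open>
  A wave-corpuscle has the form \<open>e\<^sup>i\<^sup>\<Theta> u\<close> with a real phase \<open>\<Theta>\<close> and the real radial amplitude
  \<open>u(t,x) = \<psi>\<^sub>a(|x - r(t)|)\<close>. Everything rests on two identities for the phase. The first is that
  the local wave vector \<open>W = \<nabla>\<Theta> - q/(\<chi>c) A\<close> equals \<open>(m/\<chi>) v - q/(\<chi>c) A_breve\<close>, where \<open>A_breve\<close> is the
  antisymmetric part of the linear part of \<open>A\<close> (lemma \<open>phase_y_shear\<close>); the symmetric part and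
  \<open>\<nabla>P\<^sub>3\<close> are gradients and are absorbed by the phase. The second is the Hamilton-Jacobi equation
  \<open>\<partial>\<^sub>t\<Theta> + (q/\<chi>) \<phi> = - (\<chi>/2m) |W|\<^sup>2\<close> (lemma \<open>hamilton_jacobi\<close>): the choices of
  \<open>s_p\<close> and \<open>\<phi>\<^sub>2\<close> cancel all terms but those linear in \<open>y = x - r(t)\<close>, and the linear ones
  cancel exactly when Newton's equation holds (lemma
  \<open>newton_coefficients\<close> writes it in terms of the coefficients of the potentials).

  These identities express both first derivatives of \<open>\<Theta>\<close> through \<open>\<phi>\<close>, \<open>A\<close>, \<open>v\<close> and \<open>A\<^sub>1\<close>, all
  of them continuously differentiable, so \<open>\<Theta>\<close> is twice continuously differentiable although
  \<open>A\<^sub>1\<close> and \<open>\<nabla>P\<^sub>3\<close> are only once so. As \<open>A_breve\<close> is divergence free and orthogonal to \<open>y\<close>, and the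
  gradient of \<open>u\<close> is radial, the NLS equation reduces to the equation of the form factor
  (\<open>wave_solves_NLS\<close>). The current and momentum densities are multiples of \<open>u\<^sup>2 W\<close>, and the
  stress tensor is bounded by \<open>|\<nabla>u|\<^sup>2 + u\<^sup>2|W|\<^sup>2 + |G\<^sub>a(u\<^sup>2)|\<close> (\<open>abs_stress_wave_le\<close>).

  Scaling turns the decay of \<open>\<psi>\<^sub>1\<close> into \<open>u\<^sup>2 = O(a R\<^sup>-\<^sup>4)\<close> and \<open>|\<nabla>u|\<^sup>2 = O(a R\<^sup>-\<^sup>6)\<close> on the
  sphere of radius \<open>R\<close>. The bound \<open>G\<^sub>a(u\<^sup>2) = O(a R\<^sup>-\<^sup>6)\<close> needs an argument: by the radial equation
  \<open>G\<^sub>1(\<psi>\<^sub>1\<^sup>2) - \<psi>\<^sub>1'\<^sup>2\<close> has derivative \<open>4 \<psi>\<^sub>1'\<^sup>2/\<theta> = O(\<theta>\<^sup>-\<^sup>7)\<close>, and it tends to \<open>G\<^sub>1(0)\<close> at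
  infinity (\<open>form_factor_first_integral\<close>, \<open>form_factor_decay\<close>). The area of the sphere contributes
  \<open>R\<^sup>2\<close>, so all surface integrals are \<open>O(a R\<^sup>-\<^sup>4)\<close>. The total charge converges to
  \<open>q \<integral>\<psi>\<^sub>1\<^sup>2\<close> because \<open>R/a\<close> tends to infinity, and the force term vanishes in the limit by uniform
  continuity of the fields on a compact tube.
\<close>

section \<open>Calculus on subsets\<close>

text \<open>For a Euclidean domain, continuity of the derivative can be checked on each direction separately.\<close>

lemma C1_onI:
  fixes f :: "'a::euclidean_space \<Rightarrow> 'b::real_normed_vector"
  assumes "\<And>p. p \<in> S \<Longrightarrow> (f has_derivative F p) (at p within S)"
    and "\<And>h. continuous_on S (\<lambda>p. F p h)"
  shows "C1_on S f"
proof -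
  have ap: "blinfun_apply (Blinfun (F p)) = F p" if "p \<in> S" for p
    using assms(1)[OF that] by (intro bounded_linear_Blinfun_apply) (rule has_derivative_bounded_linear)
  have "continuous_on S (\<lambda>p. Blinfun (F p))"
  proof (rule continuous_on_blinfun_componentwise)
    fix i :: 'a
    show "continuous_on S (\<lambda>p. blinfun_apply (Blinfun (F p)) i)"
      using assms(2)[of i] ap by (simp cong: continuous_on_cong)
  qed
  then show ?thesis
    unfolding C1_on_def using assms(1) ap by (intro exI[of _ "\<lambda>p. Blinfun (F p)"]) auto
qed

lemma C1_onE:
  assumes "C1_on S f"
  obtains F where "\<And>p. p \<in> S \<Longrightarrow> (f has_derivative F p) (at p within S)"
    and "\<And>h. continuous_on S (\<lambda>p. F p h)"
proof -
  obtain f' where f': "\<forall>p\<in>S. (f has_derivative blinfun_apply (f' p)) (at p within S)"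
      "continuous_on S f'"
    using assms unfolding C1_on_def by auto
  show ?thesis
    by (rule that[of "\<lambda>p. blinfun_apply (f' p)"]) (use f' in \<open>auto intro!: continuous_intros\<close>)
qed

lemma C1_on_continuous_on: "C1_on S f \<Longrightarrow> continuous_on S f"
  by (meson C1_on_def has_derivative_continuous_on)

lemma C1_on_subset: "C1_on S f \<Longrightarrow> T \<subseteq> S \<Longrightarrow> C1_on T f"
  unfolding C1_on_def
  by (meson continuous_on_subset has_derivative_subset subsetD)

lemma C2_on_subset: "C2_on S f \<Longrightarrow> T \<subseteq> S \<Longrightarrow> C2_on T f"
  unfolding C2_on_def
  by (meson C1_on_subset has_derivative_subset subsetD)

lemma C1_on_cong:
  assumes "C1_on S f" "\<And>p. p \<in> S \<Longrightarrow> g p = f p"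
  shows "C1_on S g"
proof -
  have "(g has_derivative D) (at p within S)"
    if "p \<in> S" "(f has_derivative D) (at p within S)" for p D
    using that assms(2) by (auto intro: has_derivative_transform)
  then show ?thesis using assms(1) unfolding C1_on_def by blast
qed

lemma C1_on_const: "C1_on S (\<lambda>p::'a::euclidean_space. k)"
  by (rule C1_onI[where F="\<lambda>_ _. 0"]) auto

lemma C1_on_bounded_linear:
  fixes f :: "'a::euclidean_space \<Rightarrow> 'b::real_normed_vector"
  assumes L: "bounded_linear L" and f: "C1_on S f"
  shows "C1_on S (\<lambda>p. L (f p))"
proof -
  obtain F where F: "\<And>p. p \<in> S \<Longrightarrow> (f has_derivative F p) (at p within S)"
      "\<And>h. continuous_on S (\<lambda>p. F p h)"
    using C1_onE[OF f] by metis
  show ?thesis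
    by (rule C1_onI[where F="\<lambda>p h. L (F p h)"])
      (use F L in \<open>auto intro: bounded_linear.has_derivative bounded_linear.continuous_on\<close>)
qed

lemma C1_on_linear_id: "bounded_linear L \<Longrightarrow> C1_on S (\<lambda>p::'a::euclidean_space. L p)"
  by (rule C1_onI[where F="\<lambda>p. L"]) (auto intro: bounded_linear.has_derivative)

lemma C1_on_add:
  fixes f g :: "'a::euclidean_space \<Rightarrow> 'b::real_normed_vector"
  assumes "C1_on S f" "C1_on S g"
  shows "C1_on S (\<lambda>p. f p + g p)"
proof -
  obtain F G where F: "\<And>p. p \<in> S \<Longrightarrow> (f has_derivative F p) (at p within S)"
      "\<And>h. continuous_on S (\<lambda>p. F p h)"
    and G: "\<And>p. p \<in> S \<Longrightarrow> (g has_derivative G p) (at p within S)"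
      "\<And>h. continuous_on S (\<lambda>p. G p h)"
    using C1_onE[OF assms(1)] C1_onE[OF assms(2)] by metis
  show ?thesis
    by (rule C1_onI[where F="\<lambda>p h. F p h + G p h"])
      (use F G in \<open>auto intro!: has_derivative_add continuous_intros\<close>)
qed

lemma C1_on_bounded_bilinear:
  fixes f :: "'a::euclidean_space \<Rightarrow> 'b::real_normed_vector"
    and g :: "'a \<Rightarrow> 'c::real_normed_vector"
  assumes B: "bounded_bilinear B" and fg: "C1_on S f" "C1_on S g"
  shows "C1_on S (\<lambda>p. B (f p) (g p))"
proof -
  obtain F G where F: "\<And>p. p \<in> S \<Longrightarrow> (f has_derivative F p) (at p within S)"
      "\<And>h. continuous_on S (\<lambda>p. F p h)"
    and G: "\<And>p. p \<in> S \<Longrightarrow> (g has_derivative G p) (at p within S)"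
      "\<And>h. continuous_on S (\<lambda>p. G p h)"
    using C1_onE[OF fg(1)] C1_onE[OF fg(2)] by metis
  show ?thesis
  proof (rule C1_onI[where F="\<lambda>p h. B (f p) (G p h) + B (F p h) (g p)"])
    show "((\<lambda>p. B (f p) (g p)) has_derivative (\<lambda>h. B (f p) (G p h) + B (F p h) (g p)))
        (at p within S)" if "p \<in> S" for p
      by (rule bounded_bilinear.FDERIV[OF B F(1)[OF that] G(1)[OF that]])
    show "continuous_on S (\<lambda>p. B (f p) (G p h) + B (F p h) (g p))" for h
      by (intro continuous_on_add bounded_bilinear.continuous_on[OF B] F(2) G(2)
          fg[THEN C1_on_continuous_on])
  qed
qed

lemma C1_on_scaleR:
  fixes f :: "'a::euclidean_space \<Rightarrow> real" and g :: "'a \<Rightarrow> 'b::real_normed_vector"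
  shows "C1_on S f \<Longrightarrow> C1_on S g \<Longrightarrow> C1_on S (\<lambda>p. f p *\<^sub>R g p)"
  by (rule C1_on_bounded_bilinear[OF bounded_bilinear_scaleR])

lemma C1_on_mult:
  fixes f g :: "'a::euclidean_space \<Rightarrow> 'b::real_normed_algebra"
  shows "C1_on S f \<Longrightarrow> C1_on S g \<Longrightarrow> C1_on S (\<lambda>p. f p * g p)"
  by (rule C1_on_bounded_bilinear[OF bounded_bilinear_mult])

lemma C1_on_inner:
  fixes f g :: "'a::euclidean_space \<Rightarrow> 'b::real_inner"
  shows "C1_on S f \<Longrightarrow> C1_on S g \<Longrightarrow> C1_on S (\<lambda>p. f p \<bullet> g p)"
  by (rule C1_on_bounded_bilinear[OF bounded_bilinear_inner])

lemma C1_on_cmult: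
  fixes f :: "'a::euclidean_space \<Rightarrow> 'b::real_normed_vector"
  shows "C1_on S f \<Longrightarrow> C1_on S (\<lambda>p. k *\<^sub>R f p)"
  by (rule C1_on_bounded_linear[OF bounded_linear_scaleR_right])

lemma C1_on_minus:
  fixes f :: "'a::euclidean_space \<Rightarrow> 'b::real_normed_vector"
  shows "C1_on S f \<Longrightarrow> C1_on S (\<lambda>p. - f p)"
  by (rule C1_on_bounded_linear[OF bounded_linear_minus[OF bounded_linear_ident]])

lemma C1_on_diff:
  fixes f g :: "'a::euclidean_space \<Rightarrow> 'b::real_normed_vector"
  shows "C1_on S f \<Longrightarrow> C1_on S g \<Longrightarrow> C1_on S (\<lambda>p. f p - g p)"
  using C1_on_add[OF _ C1_on_minus, of S f g] by simp

lemma C1_on_sum: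
  fixes f :: "'i \<Rightarrow> 'a::euclidean_space \<Rightarrow> 'b::real_normed_vector"
  assumes "\<And>i. i \<in> I \<Longrightarrow> C1_on S (f i)"
  shows "C1_on S (\<lambda>p. \<Sum>i\<in>I. f i p)"
  using assms by (induction I rule: infinite_finite_induct) (auto intro: C1_on_const C1_on_add)

lemma C1_on_compose:
  fixes f :: "'a::euclidean_space \<Rightarrow> 'b::euclidean_space" and g :: "'b \<Rightarrow> 'c::real_normed_vector"
  assumes f: "C1_on S f" and g: "C1_on T g" and im: "f ` S \<subseteq> T"
  shows "C1_on S (\<lambda>p. g (f p))"
proof -
  obtain F where F: "\<And>p. p \<in> S \<Longrightarrow> (f has_derivative F p) (at p within S)"
      "\<And>h. continuous_on S (\<lambda>p. F p h)"
    using C1_onE[OF f] by metis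
  obtain g' where g': "\<forall>p\<in>T. (g has_derivative blinfun_apply (g' p)) (at p within T)"
      "continuous_on T g'"
    using g unfolding C1_on_def by auto
  show ?thesis
  proof (rule C1_onI[where F="\<lambda>p h. g' (f p) (F p h)"])
    fix p assume "p \<in> S"
    then show "((\<lambda>p. g (f p)) has_derivative (\<lambda>h. g' (f p) (F p h))) (at p within S)"
      using has_derivative_in_compose2[of T g "\<lambda>x. blinfun_apply (g' x)" f S p "F p"] g'(1) im F(1)
      by blast
  next
    fix h
    have "continuous_on S (\<lambda>p. g' (f p))"
      by (rule continuous_on_compose2[OF g'(2) C1_on_continuous_on[OF f] im])
    then show "continuous_on S (\<lambda>p. blinfun_apply (g' (f p)) (F p h))"
      using F(2) by (intro continuous_intros)
  qed
qed

lemma has_derivative_sum_Basis: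
  assumes "(f has_derivative F) (at p within S)"
  shows "F h = (\<Sum>b\<in>Basis. (h \<bullet> b) *\<^sub>R F (b::'a::euclidean_space))"
proof -
  have "linear F" using assms has_derivative_linear by blast
  then show ?thesis by (metis (no_types, lifting) euclidean_representation linear_scale linear_sum sum.cong)
qed

lemma C2_onI:
  fixes f :: "'a::euclidean_space \<Rightarrow> 'b::real_normed_vector"
  assumes F: "\<And>p. p \<in> S \<Longrightarrow> (f has_derivative F p) (at p within S)"
    and C: "\<And>h. C1_on S (\<lambda>p. F p h)"
  shows "C2_on S f"
proof -
  define L where "L b v = (blinfun_scaleR_left v) o\<^sub>L (blinfun_inner_left b)" for b :: 'a and v :: 'b
  have L: "bounded_linear (L b)" for b
    unfolding L_def
    by (rule bounded_linear_compose[OF bounded_bilinear.bounded_linear_left[OF bounded_bilinear_blinfun_compose]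
          bounded_linear_blinfun_scaleR_left])
  have Lap: "blinfun_apply (L b v) h = (h \<bullet> b) *\<^sub>R v" for b v h
    unfolding L_def by (simp add: inner_commute)
  have "F p = blinfun_apply (\<Sum>b\<in>Basis. L b (F p b))" if "p \<in> S" for p
    by (rule ext) (simp add: blinfun.sum_left Lap has_derivative_sum_Basis[OF F[OF that], symmetric])
  then have "(f has_derivative blinfun_apply (\<Sum>b\<in>Basis. L b (F p b))) (at p within S)" if "p \<in> S" for p
    using F[OF that] that by metis
  moreover have "C1_on S (\<lambda>p. \<Sum>b\<in>Basis. L b (F p b))"
    by (intro C1_on_sum C1_on_bounded_linear[OF L] C)
  ultimately show ?thesis
    unfolding C2_on_def by (intro exI[of _ "\<lambda>p. \<Sum>b\<in>Basis. L b (F p b)"]) simp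
qed

lemma C2_onE:
  fixes f :: "'a::euclidean_space \<Rightarrow> 'b::real_normed_vector"
  assumes "C2_on S f"
  obtains F where "\<And>p. p \<in> S \<Longrightarrow> (f has_derivative F p) (at p within S)"
    and "\<And>h. C1_on S (\<lambda>p. F p h)"
proof -
  obtain f' where f': "\<forall>p\<in>S. (f has_derivative blinfun_apply (f' p)) (at p within S)"
      "C1_on S f'"
    using assms unfolding C2_on_def by auto
  show ?thesis
    by (rule that[of "\<lambda>p. blinfun_apply (f' p)"])
      (use f' in \<open>auto intro: C1_on_bounded_linear blinfun.bounded_linear_left\<close>)
qed

lemma C2_on_imp_C1_on: "C2_on S f \<Longrightarrow> C1_on S f"
  unfolding C2_on_def C1_on_def[of S f] using C1_on_continuous_on by blast

text \<open>Derivatives within a convex set with interior points are unique at all of its points: the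
  derivative of zero vanishes on the differences \<open>h - p\<close> with \<open>h\<close> in the set, and these span.\<close>

lemma has_derivative_zero_within_convex:
  fixes D :: "'a::euclidean_space \<Rightarrow> 'b::real_normed_vector"
  assumes "convex S" "interior S \<noteq> {}" "p \<in> S"
    and D: "((\<lambda>_. 0) has_derivative D) (at p within S)"
  shows "D = (\<lambda>_. 0)"
proof -
  interpret D: linear D using D has_derivative_linear by blast
  have zero: "D (h - p) = 0" if "h \<in> S" for h
  proof -
    have "((\<lambda>s::real. p + s *\<^sub>R (h - p)) has_derivative (\<lambda>s. s *\<^sub>R (h - p))) (at 0 within {0..1})"
      by (auto intro!: derivative_eq_intros)
    moreover have "(\<lambda>s::real. p + s *\<^sub>R (h - p)) ` {0..1} \<subseteq> S"
    proof clarsimp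
      fix s :: real assume s: "0 \<le> s" "s \<le> 1"
      have "(1 - s) *\<^sub>R p + s *\<^sub>R h \<in> S"
        using assms(1,3) that s by (simp add: convexD_alt)
      then show "p + s *\<^sub>R (h - p) \<in> S" by (simp add: algebra_simps)
    qed
    ultimately have "((\<lambda>s::real. 0) has_derivative (\<lambda>s. D (s *\<^sub>R (h - p)))) (at 0 within {0..1})"
      using has_derivative_in_compose[of "\<lambda>s::real. p + s *\<^sub>R (h - p)" "\<lambda>s. s *\<^sub>R (h - p)" 0 "{0..1}"
          "\<lambda>_. 0" D] has_derivative_subset[OF D] by simp
    then have "((\<lambda>s::real. 0) has_vector_derivative D (h - p)) (at 0 within {0..1})"
      by (simp add: has_vector_derivative_def D.scale)
    moreover have "((\<lambda>s::real. 0) has_vector_derivative (0::'b)) (at 0 within {0..1})"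
      by simp
    ultimately show ?thesis
      using vector_derivative_unique_within_closed_interval[of 0 1 0 "\<lambda>s::real. 0::'b"] by auto
  qed
  \<comment> \<open>By the above, the linear map is constant on \<open>S\<close>, which contains a ball.\<close>
  obtain z e where z: "e > 0" "ball z e \<subseteq> S" using assms(2) by (meson ex_in_conv mem_interior)
  have "D w = 0" for w
  proof (cases "w = 0")
    case True then show ?thesis by (simp add: D.zero)
  next
    case False
    define k where "k = e / (2 * norm w)"
    have k: "k > 0" using False z by (simp add: k_def)
    have "z + k *\<^sub>R w \<in> S" "z \<in> S"
      using z False by (auto intro!: subsetD[OF z(2)] simp: dist_norm k_def)
    then have "D (z + k *\<^sub>R w - p) - D (z - p) = 0" by (simp add: zero)
    then have "D (k *\<^sub>R w) = 0" by (simp add: D.diff D.add)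
    then show ?thesis using k by (simp add: D.scale)
  qed
  then show ?thesis by auto
qed

lemma dir_derivI_convex:
  fixes f :: "'a::euclidean_space \<Rightarrow> 'b::real_normed_vector"
  assumes "convex S" "interior S \<noteq> {}" "p \<in> S" and F: "(f has_derivative F) (at p within S)"
  shows "dir_deriv S b f p = F b"
proof -
  have "(f has_derivative frechet_derivative f (at p within S)) (at p within S)"
    using F frechet_derivative_works differentiableI by blast
  from has_derivative_diff[OF this F]
  have "(\<lambda>h. frechet_derivative f (at p within S) h - F h) = (\<lambda>_. 0)"
    by (intro has_derivative_zero_within_convex[OF assms(1-3)]) simp
  then show ?thesis unfolding dir_deriv_def by (metis eq_iff_diff_eq_0)
qed

lemma vector_derivative_at_withinI:
  assumes "Tm < Tp" "t \<in> {Tm..Tp::real}" "(f has_vector_derivative D) (at t within {Tm..Tp})"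
  shows "vector_derivative f (at t within {Tm..Tp}) = D"
  using assms vector_derivative_within_cbox[of Tm Tp t f D] by auto

text \<open>The tube about a differentiable trajectory is not convex, but shearing it along the trajectory
  turns it into the product of an interval and a ball. Derivatives within the tube are therefore
  unique, also at its edges.\<close>

lemma dir_derivI_tube:
  fixes f :: "spacetime \<Rightarrow> 'b::real_normed_vector"
  assumes "Tm < Tp" "R > 0" "p \<in> nls.tube Tm Tp r R"
    and r: "(r has_vector_derivative v) (at (fst p) within {Tm..Tp})"
    and F: "(f has_derivative F) (at p within nls.tube Tm Tp r R)"
  shows "dir_deriv (nls.tube Tm Tp r R) b f p = F b"
proof -
  let ?T = "nls.tube Tm Tp r R" and ?B = "{Tm..Tp} \<times> cball (0::real^3) R"
  define \<Psi> where "\<Psi> w = (fst w, snd w + r (fst w))" for w :: spacetime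
  define p' where "p' = (fst p, snd p - r (fst p))"
  have T: "w \<in> ?T \<longleftrightarrow> fst w \<in> {Tm..Tp} \<and> norm (snd w - r (fst w)) \<le> R" for w
    by (cases w) (simp add: nls.tube_def)
  have p': "p' \<in> ?B" "\<Psi> p' = p" using assms(3) unfolding T p'_def \<Psi>_def by auto
  have r': "((\<lambda>w. r (fst w)) has_derivative (\<lambda>k. fst k *\<^sub>R v)) (at w within ?B)"
    if "fst w = fst p" for w
    using r that unfolding has_vector_derivative_def
    by (intro has_derivative_in_compose[where f=fst and g=r])
      (auto intro!: derivative_eq_intros elim: has_derivative_subset)
  have \<Psi>': "(\<Psi> has_derivative (\<lambda>k. (fst k, snd k + fst k *\<^sub>R v))) (at p' within ?B)"
    unfolding \<Psi>_def by (auto intro!: derivative_eq_intros r' simp: p'_def)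
  have im: "\<Psi> ` ?B \<subseteq> ?T" unfolding \<Psi>_def by (auto simp: T)
  have "(f has_derivative frechet_derivative f (at p within ?T)) (at p within ?T)"
    using F frechet_derivative_works differentiableI by blast
  from has_derivative_diff[OF this F]
  have "((\<lambda>_. 0) has_derivative (\<lambda>h. frechet_derivative f (at p within ?T) h - F h)) (at p within ?T)"
    by simp
  then have "((\<lambda>_. 0) has_derivative (\<lambda>h. frechet_derivative f (at p within ?T) h - F h))
      (at (\<Psi> p') within \<Psi> ` ?B)"
    using p' im by (auto intro: has_derivative_subset)
  from has_derivative_in_compose[OF \<Psi>' this]
  have "(\<lambda>k. frechet_derivative f (at p within ?T) (fst k, snd k + fst k *\<^sub>R v)
      - F (fst k, snd k + fst k *\<^sub>R v)) = (\<lambda>_. 0)"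
    using assms(1,2) p'(1)
    by (intro has_derivative_zero_within_convex[of ?B p'])
      (auto simp: interior_Times intro!: convex_Times)
  from fun_cong[OF this, of "(fst b, snd b - fst b *\<^sub>R v)"]
  show ?thesis by (simp add: dir_deriv_def)
qed

section \<open>Directional derivatives on convex sets\<close>

lemma C1_on_dir_deriv:
  fixes f :: "'a::euclidean_space \<Rightarrow> 'b::real_normed_vector"
  assumes f: "C1_on S f" and S: "convex S" "interior S \<noteq> {}"
  shows "p \<in> S \<Longrightarrow> (f has_derivative (\<lambda>b. dir_deriv S b f p)) (at p within S)"
    and "continuous_on S (dir_deriv S b f)"
proof -
  obtain F where F: "\<And>p. p \<in> S \<Longrightarrow> (f has_derivative F p) (at p within S)"
      "\<And>h. continuous_on S (\<lambda>p. F p h)"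
    using C1_onE[OF f] by metis
  have eq: "dir_deriv S b f p = F p b" if "p \<in> S" for p b
    by (rule dir_derivI_convex[OF S that F(1)[OF that]])
  show "(f has_derivative (\<lambda>b. dir_deriv S b f p)) (at p within S)" if "p \<in> S"
    using F(1)[OF that] by (simp add: eq[OF that])
  show "continuous_on S (dir_deriv S b f)"
    by (rule continuous_on_eq[OF F(2)[of b]]) (simp add: eq)
qed

lemma C2_on_dir_deriv:
  fixes f :: "'a::euclidean_space \<Rightarrow> 'b::real_normed_vector"
  assumes f: "C2_on S f" and S: "convex S" "interior S \<noteq> {}"
  shows "C1_on S (dir_deriv S b f)"
proof -
  obtain F where F: "\<And>p. p \<in> S \<Longrightarrow> (f has_derivative F p) (at p within S)"
      "\<And>h. C1_on S (\<lambda>p. F p h)"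
    using C2_onE[OF f] by metis
  show ?thesis
    by (rule C1_on_cong[OF F(2)]) (rule dir_derivI_convex[OF S _ F(1)])
qed

text \<open>On an interval, the directional derivative in direction \<open>1\<close> is the vector derivative.\<close>

lemma dir_deriv_Icc:
  assumes "a < b" "t \<in> {a..b::real}" "C1_on {a..b} f"
  shows "(f has_vector_derivative dir_deriv {a..b} 1 f t) (at t within {a..b})"
    and "dir_deriv {a..b} 1 f t = vector_derivative f (at t within {a..b})"
proof -
  have D: "(f has_derivative (\<lambda>b'. dir_deriv {a..b} b' f t)) (at t within {a..b})"
    using assms by (intro C1_on_dir_deriv) auto
  interpret linear "\<lambda>b'. dir_deriv {a..b} b' f t" using D has_derivative_linear by blast
  have "dir_deriv {a..b} h f t = h *\<^sub>R dir_deriv {a..b} 1 f t" for h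
    using scale[of h 1] by simp
  then show "(f has_vector_derivative dir_deriv {a..b} 1 f t) (at t within {a..b})"
    unfolding has_vector_derivative_def by (intro has_derivative_eq_rhs[OF D] ext)
  from vector_derivative_at_withinI[OF assms(1,2) this]
  show "dir_deriv {a..b} 1 f t = vector_derivative f (at t within {a..b})" by simp
qed

lemma C1_on_Icc:
  assumes "a < (b::real)" "C1_on {a..b} f"
  shows "t \<in> {a..b} \<Longrightarrow>
      (f has_vector_derivative vector_derivative f (at t within {a..b})) (at t within {a..b})"
    and "continuous_on {a..b} (\<lambda>t. vector_derivative f (at t within {a..b}))"
proof -
  show "t \<in> {a..b} \<Longrightarrow>
      (f has_vector_derivative vector_derivative f (at t within {a..b})) (at t within {a..b})"
    using dir_deriv_Icc[OF assms(1) _ assms(2)] by metis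
  have "continuous_on {a..b} (dir_deriv {a..b} 1 f)"
    using assms by (intro C1_on_dir_deriv) auto
  then show "continuous_on {a..b} (\<lambda>t. vector_derivative f (at t within {a..b}))"
    by (rule continuous_on_eq) (rule dir_deriv_Icc(2)[OF assms(1) _ assms(2)])
qed

lemma C2_on_Icc:
  assumes "a < (b::real)" "C2_on {a..b} f"
  shows "C1_on {a..b} (\<lambda>t. vector_derivative f (at t within {a..b}))"
proof -
  have "C1_on {a..b} (dir_deriv {a..b} 1 f)"
    using assms by (intro C2_on_dir_deriv) auto
  then show ?thesis
    by (rule C1_on_cong) (rule dir_deriv_Icc(2)[OF assms(1) _ C2_on_imp_C1_on[OF assms(2)], symmetric])
qed

lemma bounded_bilinear_matrix_vector:
  "bounded_bilinear (\<lambda>(M::real^3^3) (y::real^3). M *v y)"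
  unfolding bilinear_conv_bounded_bilinear[symmetric] bilinear_def linear_iff
  by (simp add: matrix_vector_mult_add_rdistrib matrix_vector_right_distrib
      scaleR_matrix_vector_assoc matrix_vector_mult_scaleR)

lemma bounded_linear_transpose: "bounded_linear (\<lambda>M::real^3^3. transpose M)"
  unfolding linear_conv_bounded_linear[symmetric] linear_iff
  by (simp add: transpose_def vec_eq_iff)

lemma inner_transpose: "x \<bullet> (transpose M *v y) = (M *v x) \<bullet> (y::real^3)" for M :: "real^3^3"
  by (simp add: dot_lmul_matrix transpose_matrix_vector inner_commute[of x] inner_commute[of y])

text \<open>The product rule at the origin for \<open>y \<bullet> K(y)\<close>, where \<open>K\<close> is only continuous.\<close>

lemma has_derivative_inner_at_zero:
  fixes K :: "'a::real_inner \<Rightarrow> 'a"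
  assumes "isCont K 0"
  shows "((\<lambda>y. y \<bullet> K y) has_derivative (\<lambda>h. h \<bullet> K 0)) (at 0)"
  unfolding has_derivative_at
proof (intro conjI)
  show "bounded_linear (\<lambda>h. h \<bullet> K 0)" by (rule bounded_linear_inner_left)
  have "(\<lambda>h. K (0 + h) - K 0) \<midarrow>0\<rightarrow> 0"
    using assms unfolding isCont_def by (simp add: LIM_zero)
  then have "(\<lambda>h. norm (K (0 + h) - K 0)) \<midarrow>0\<rightarrow> 0" by (rule tendsto_norm_zero)
  then show "(\<lambda>h. norm ((0 + h) \<bullet> K (0 + h) - 0 \<bullet> K 0 - h \<bullet> K 0) / norm h) \<midarrow>0\<rightarrow> 0"
  proof (rule Lim_null_comparison[rotated])
    show "\<forall>\<^sub>F h in at 0. norm (norm ((0 + h) \<bullet> K (0 + h) - 0 \<bullet> K 0 - h \<bullet> K 0) / norm h)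
        \<le> norm (K (0 + h) - K 0)"
    proof (rule always_eventually, rule allI)
      fix h :: 'a
      have "\<bar>h \<bullet> (K h - K 0)\<bar> \<le> norm h * norm (K h - K 0)" by (rule Cauchy_Schwarz_ineq2)
      then show "norm (norm ((0 + h) \<bullet> K (0 + h) - 0 \<bullet> K 0 - h \<bullet> K 0) / norm h)
          \<le> norm (K (0 + h) - K 0)"
        by (cases "h = 0") (auto simp: inner_diff_right divide_le_eq mult.commute)
    qed
  qed
qed

section \<open>Bounds for integrals\<close>

text \<open>The next bounds need no integrability: the Bochner integral of a function that is not
  integrable is zero.\<close>

lemma integral_norm_le_measure:
  fixes f :: "'a::euclidean_space \<Rightarrow> 'b::{banach, second_countable_topology}"
  assumes "X \<in> sets M" "emeasure M X < \<infinity>" "B \<ge> 0" "\<And>x. x \<in> X \<Longrightarrow> norm (f x) \<le> B"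
  shows "norm (LINT x:X|M. f x) \<le> B * measure M X"
proof (cases "set_integrable M X f")
  case True
  have "norm (LINT x:X|M. f x) \<le> (LINT x|M. indicator X x *\<^sub>R B)"
    unfolding set_lebesgue_integral_def
    using True assms integrable_real_indicator[of X M] unfolding set_integrable_def
    by (intro Bochner_Integration.integral_norm_bound_integral) (auto simp: indicator_scaleR_eq_if)
  then show ?thesis using assms by (simp add: mult.commute)
next
  case False
  then show ?thesis using assms
    by (simp add: set_lebesgue_integral_def set_integrable_def not_integrable_integral_eq)
qed

lemma norm_sphere_integral_le:
  fixes F :: "real^3 \<Rightarrow> 'b::{banach, second_countable_topology}"
  assumes "R > 0" "\<And>x. norm (x - z) = R \<Longrightarrow> norm (F x) \<le> B"
  shows "norm (sphere_integral z R F) \<le> 2 * pi\<^sup>2 * R\<^sup>2 * B"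
proof -
  have n: "norm (sphere_point w) = 1" for w
  proof -
    have "sphere_point w \<bullet> sphere_point w = (sin (fst w) * cos (snd w))\<^sup>2
        + (sin (fst w) * sin (snd w))\<^sup>2 + (cos (fst w))\<^sup>2"
      by (simp add: inner_vec_def sum_3 sphere_point_def power2_eq_square)
    also have "\<dots> = 1"
      using sin_cos_squared_add[of "fst w"] sin_cos_squared_add[of "snd w"] by algebra
    finally have "(norm (sphere_point w))\<^sup>2 = 1" by (simp only: power2_norm_eq_inner)
    then show ?thesis using abs_square_eq_1[of "norm (sphere_point w)"] by simp
  qed
  have B: "B \<ge> 0"
    using assms(2)[of "z + R *\<^sub>R sphere_point 0"] assms(1) n by (simp add: order_trans[OF norm_ge_zero])
  have m: "measure lborel ({0..pi} \<times> {0..2*pi}) = 2 * pi\<^sup>2"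
    using content_Pair[of 0 0 pi "2 * pi"] by (simp add: cbox_Pair_eq power2_eq_square)
  have "norm (sphere_integral z R F) \<le> (R\<^sup>2 * B) * measure lborel ({0..pi} \<times> {0..2*pi})"
    unfolding sphere_integral_def
  proof (rule integral_norm_le_measure)
    show "{0..pi} \<times> {0..2*pi} \<in> sets lborel"
      by (simp add: borel_closed closed_Times)
    show "emeasure lborel ({0..pi} \<times> {0..2*pi}) < \<infinity>"
      by (intro emeasure_bounded_finite bounded_Times) auto
    fix w :: "real \<times> real" assume "w \<in> {0..pi} \<times> {0..2*pi}"
    have "norm (F (z + R *\<^sub>R sphere_point w)) \<le> B"
      using assms n by simp
    moreover have "\<bar>R\<^sup>2 * sin (fst w)\<bar> \<le> R\<^sup>2" by (simp add: abs_mult mult_left_le)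
    ultimately show "norm ((R\<^sup>2 * sin (fst w)) *\<^sub>R F (z + R *\<^sub>R sphere_point w)) \<le> R\<^sup>2 * B"
      by (simp only: norm_scaleR real_norm_def) (intro mult_mono, auto)
  qed (use B in auto)
  then show ?thesis unfolding m by (simp add: mult_ac)
qed

lemma norm_interval_integral_le:
  fixes f :: "real \<Rightarrow> 'b::{banach, second_countable_topology}"
  assumes s: "s \<in> {Tm..Tp}" "t \<in> {Tm..Tp}" and f: "\<And>u. u \<in> {Tm..Tp} \<Longrightarrow> norm (f u) \<le> B"
  shows "norm (LBINT u=s..t. f u) \<le> B * (Tp - Tm)"
proof -
  have B: "B \<ge> 0" using f[OF s(1)] norm_ge_zero order_trans by blast
  have "norm (LBINT u=s..t. f u) \<le> B * (Tp - Tm)" if "s \<le> t" "s \<in> {Tm..Tp}" "t \<in> {Tm..Tp}" for s t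
  proof -
    have "norm (LINT u:{s..t}|lborel. f u) \<le> B * measure lborel {s..t}"
      using that f B by (intro integral_norm_le_measure) auto
    also have "\<dots> \<le> B * (Tp - Tm)"
      using that B by (intro mult_left_mono) auto
    finally show ?thesis using that by (simp add: interval_integral_Icc)
  qed
  then show ?thesis
    using s interval_integral_endpoints_reverse[of s t f]
    by (cases "s \<le> t") (metis, metis linear norm_minus_cancel)
qed

lemma uniform_limit_zeroI:
  fixes f :: "nat \<Rightarrow> 'a \<Rightarrow> 'b::real_normed_vector"
  assumes "\<forall>\<^sub>F n in sequentially. \<forall>t\<in>S. norm (f n t) \<le> b n" "b \<longlonglongrightarrow> 0"
  shows "uniform_limit S f (\<lambda>_. 0) sequentially"
proof (rule uniform_limitI)
  fix e :: real assume "e > 0"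
  then have "\<forall>\<^sub>F n in sequentially. b n < e"
    using order_tendstoD(2)[OF assms(2)] by blast
  with assms(1) show "\<forall>\<^sub>F n in sequentially. \<forall>x\<in>S. dist (f n x) 0 < e"
    by eventually_elim (auto intro: le_less_trans)
qed

lemma norm_set_integral_le_weight:
  fixes F :: "'a::euclidean_space \<Rightarrow> 'b::{banach, second_countable_topology}" and w :: "'a \<Rightarrow> real"
  assumes w: "set_integrable M X w" and F: "\<And>x. x \<in> X \<Longrightarrow> norm (F x) \<le> B * w x"
    and nonneg: "B \<ge> 0" "\<And>x. x \<in> X \<Longrightarrow> w x \<ge> 0"
  shows "norm (LINT x:X|M. F x) \<le> B * (LINT x:X|M. w x)"
proof (cases "set_integrable M X F")
  case True
  have "norm (LINT x:X|M. F x) \<le> (LINT x|M. B * (indicator X x *\<^sub>R w x))"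
    unfolding set_lebesgue_integral_def
    using True w F unfolding set_integrable_def
    by (intro Bochner_Integration.integral_norm_bound_integral integrable_mult_right)
      (auto simp: indicator_scaleR_eq_if)
  then show ?thesis by (simp add: set_lebesgue_integral_def)
next
  case False
  then have "(LINT x:X|M. F x) = 0"
    by (simp add: set_lebesgue_integral_def set_integrable_def not_integrable_integral_eq)
  moreover have "(LINT x:X|M. w x) \<ge> 0"
    unfolding set_lebesgue_integral_def
    by (rule integral_nonneg_AE) (use nonneg(2) in \<open>auto simp: indicator_def\<close>)
  ultimately show ?thesis using nonneg(1) by simp
qed

lemma set_integrable_continuous_cball:
  fixes f :: "'a::euclidean_space \<Rightarrow> 'b::{banach, second_countable_topology}"
  shows "continuous_on (cball z R) f \<Longrightarrow> set_integrable lborel (cball z R) f"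
  unfolding set_integrable_def by (rule borel_integrable_compact) auto

lemma norm_cross3_le: "norm (cross3 x y) \<le> norm x * norm y"
proof -
  have "(norm (cross3 x y))\<^sup>2 \<le> (norm x * norm y)\<^sup>2"
    using norm_cross_dot[of x y] zero_le_power2[of "x \<bullet> y"] by linarith
  then show ?thesis by (rule power2_le_imp_le) simp
qed


section \<open>Gradients of radial functions\<close>

lemma has_derivative_along_line:
  assumes F: "(f has_derivative F) (at (x + s *\<^sub>R h))"
  shows "((\<lambda>s. f (x + s *\<^sub>R h)) has_derivative (\<lambda>s. s *\<^sub>R F h)) (at s)"
proof -
  interpret linear F using F has_derivative_linear by blast
  have "((\<lambda>s. x + s *\<^sub>R h) has_derivative (\<lambda>s. s *\<^sub>R h)) (at s)"
    by (auto intro!: derivative_eq_intros)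
  from has_derivative_compose[OF this F] show ?thesis by (simp add: scale)
qed

lemma has_derivative_along_ray:
  assumes F: "(f has_derivative F) (at (s *\<^sub>R h))"
  shows "((\<lambda>s. f (s *\<^sub>R h)) has_derivative (\<lambda>s. s *\<^sub>R F h)) (at s)"
  using has_derivative_along_line[of f F 0 s h] F by simp

lemma has_derivative_grad:
  assumes "f differentiable (at x)"
  shows "(f has_derivative (\<lambda>h. grad f x \<bullet> h)) (at x)"
proof -
  let ?F = "frechet_derivative f (at x)"
  have F: "(f has_derivative ?F) (at x)"
    using assms frechet_derivative_works by blast
  interpret linear ?F using F has_derivative_linear by blast
  have "?F h = grad f x \<bullet> h" for h
  proof -
    have "?F h = ?F (\<Sum>j\<in>UNIV. h $ j *\<^sub>R axis j 1)"
      by (simp add: basis_expansion flip: scalar_mult_eq_scaleR)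
    then show ?thesis
      by (simp add: sum scale grad_def dir_deriv_def inner_vec_def mult.commute)
  qed
  with F show ?thesis by (metis (no_types, lifting) ext)
qed

lemma grad_eqI:
  assumes "(f has_derivative (\<lambda>h. g \<bullet> h)) (at x)"
  shows "grad f x = g"
  using frechet_derivative_at[OF assms]
  by (simp add: grad_def dir_deriv_def vec_eq_iff inner_axis fun_eq_iff)
     (metis inner_axis inner_real_def mult.right_neutral)

lemma C1_on_grad:
  assumes "C2_on UNIV f"
  shows "C1_on UNIV (grad f)"
proof -
  obtain F where F: "\<And>x. (f has_derivative F x) (at x)" "\<And>h. C1_on UNIV (\<lambda>x. F x h)"
    using C2_onE[OF assms] by auto
  have "grad f = (\<lambda>x. \<Sum>j\<in>UNIV. F x (axis j 1) *\<^sub>R axis j 1)"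
  proof
    fix x
    have "grad f x = (\<chi> j. F x (axis j 1))"
      using frechet_derivative_at[OF F(1)[of x]] by (simp add: grad_def dir_deriv_def)
    also have "\<dots> = (\<Sum>j\<in>UNIV. F x (axis j 1) *\<^sub>R axis j 1)"
      using basis_expansion[of "\<chi> j. F x (axis j 1)"] by (simp add: scalar_mult_eq_scaleR)
    finally show "grad f x = (\<Sum>j\<in>UNIV. F x (axis j 1) *\<^sub>R axis j 1)" .
  qed
  moreover have "C1_on UNIV (\<lambda>x. \<Sum>j\<in>UNIV. F x (axis j 1) *\<^sub>R (axis j 1 :: real^3))"
    by (intro C1_on_sum C1_on_scaleR F(2) C1_on_const)
  ultimately show ?thesis by simp
qed

text \<open>The Laplacian is the trace of the derivative of the gradient.\<close>

lemma laplacian_eq: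
  assumes "\<And>x. f differentiable (at x)" "(grad f has_derivative H) (at x)"
  shows "laplacian f x = (\<Sum>j\<in>UNIV. H (axis j 1) $ j)"
proof -
  have "dir_deriv UNIV (axis j 1) f = (\<lambda>x. grad f x $ j)" for j
    by (simp add: grad_def fun_eq_iff)
  moreover have "((\<lambda>x. grad f x $ j) has_derivative (\<lambda>h. H h $ j)) (at x)" for j
    by (rule bounded_linear.has_derivative[OF bounded_linear_vec_nth assms(2)])
  then have "frechet_derivative (\<lambda>x. grad f x $ j) (at x) = (\<lambda>h. H h $ j)" for j
    using frechet_derivative_at by metis
  ultimately show ?thesis
    by (simp add: laplacian_def dir_deriv_def)
qed

text \<open>The derivative of a radial function vanishes in directions tangent to the sphere through the
  point, because the function is even along the tangent line. This covers the origin as well.\<close>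

lemma grad_radial_orthogonal:
  assumes f: "(\<lambda>x. k (norm x)) differentiable (at x)" and w: "x \<bullet> w = 0"
  shows "grad (\<lambda>x. k (norm x)) x \<bullet> w = 0"
proof -
  let ?f = "\<lambda>x. k (norm x)" let ?g = "\<lambda>s. ?f (x + s *\<^sub>R w)"
  let ?D = "grad ?f x \<bullet> w"
  have D: "(?g has_real_derivative ?D) (at 0)"
  proof -
    have "(?f has_derivative (\<lambda>h. grad ?f x \<bullet> h)) (at (x + 0 *\<^sub>R w))"
      using has_derivative_grad[OF f] by simp
    from has_derivative_along_line[OF this]
    have "(?g has_derivative (\<lambda>s. s *\<^sub>R (grad ?f x \<bullet> w))) (at 0)" .
    then show ?thesis by (simp add: has_real_derivative_iff_has_vector_derivative has_vector_derivative_def)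
  qed
  \<comment> \<open>As \<open>w\<close> is orthogonal to \<open>x\<close>, \<open>|x - s w| = |x + s w|\<close>.\<close>
  have even: "?g (- s) = ?g s" for s
  proof -
    have "(norm (x + (- s) *\<^sub>R w))\<^sup>2 = (norm (x + s *\<^sub>R w))\<^sup>2"
      using w unfolding power2_norm_eq_inner
      by (simp add: inner_add_left inner_add_right inner_diff_left inner_diff_right inner_commute)
    then show ?thesis using power2_eq_imp_eq norm_ge_zero by metis
  qed
  have "((\<lambda>s. ?g (- s)) has_real_derivative - ?D) (at 0)"
    using DERIV_mirror[of ?g ?D 0] D by simp
  then have "- ?D = ?D" using D even DERIV_unique by (metis (no_types, lifting) ext)
  then show ?thesis by simp
qed

lemma radial_has_real_derivative:
  fixes e :: "real^3"
  assumes f: "(\<lambda>x. k (norm x)) differentiable (at (\<theta> *\<^sub>R e))" and e: "norm e = 1" and "\<theta> > 0"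
  shows "(k has_real_derivative grad (\<lambda>x. k (norm x)) (\<theta> *\<^sub>R e) \<bullet> e) (at \<theta>)"
proof -
  let ?f = "\<lambda>x. k (norm x)" let ?D = "grad ?f (\<theta> *\<^sub>R e)"
  from has_derivative_along_ray[OF has_derivative_grad[OF f]]
  have "((\<lambda>s. ?f (s *\<^sub>R e)) has_derivative (\<lambda>s. s *\<^sub>R (?D \<bullet> e))) (at \<theta>)" .
  then have "((\<lambda>s. ?f (s *\<^sub>R e)) has_real_derivative ?D \<bullet> e) (at \<theta>)"
    by (simp add: has_real_derivative_iff_has_vector_derivative has_vector_derivative_def)
  then show ?thesis
    by (rule has_field_derivative_transform_within_open[where S="{0<..}"]) (use assms in auto)
qed

lemma grad_radial:
  fixes x :: "real^3"
  assumes f: "(\<lambda>x. k (norm x)) differentiable (at x)" and x: "x \<noteq> 0"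
  shows "grad (\<lambda>x. k (norm x)) x = (deriv k (norm x) / norm x) *\<^sub>R x"
proof -
  define e where "e = (1 / norm x) *\<^sub>R x"
  define D where "D = grad (\<lambda>x. k (norm x)) x"
  have e: "norm e = 1" "norm x *\<^sub>R e = x" using x by (auto simp: e_def)
  have ee: "e \<bullet> e = 1" using e by (simp add: dot_square_norm)
  have De: "D \<bullet> e = deriv k (norm x)"
    using radial_has_real_derivative[of k "norm x" e] f e x DERIV_imp_deriv by (fastforce simp: D_def)
  define w where "w = D - (D \<bullet> e) *\<^sub>R e"
  have we: "e \<bullet> w = 0" unfolding w_def by (simp add: inner_diff_right inner_commute ee)
  then have "x \<bullet> w = 0" using e(2) by (metis inner_scaleR_left mult_zero_right)
  then have "D \<bullet> w = 0" unfolding D_def by (rule grad_radial_orthogonal[OF f])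
  then have "w \<bullet> w = 0" using we by (simp add: w_def inner_diff_left inner_diff_right inner_commute)
  then have "D = (D \<bullet> e) *\<^sub>R e" by (simp add: w_def)
  then show ?thesis unfolding De by (simp add: D_def e_def)
qed

text \<open>The Laplacian of a radial function in polar form. The tangential second derivatives are
  obtained by differentiating the orthogonality relation \<open>grad f (\<theta> e + s e') \<bullet> (s e - \<theta> e') = 0\<close>
  at \<open>s = 0\<close>.\<close>

lemma radial_second_derivatives:
  fixes k :: "real \<Rightarrow> real"
  assumes f: "C2_on UNIV (\<lambda>x::real^3. k (norm x))" and "\<theta> > 0"
  shows "(deriv k has_real_derivative
      laplacian (\<lambda>x. k (norm x)) (\<theta> *\<^sub>R axis 1 1) - 2 * deriv k \<theta> / \<theta>) (at \<theta>)"
proof -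
  let ?f = "\<lambda>x::real^3. k (norm x)"
  let ?e = "\<lambda>j. axis j 1 :: real^3"
  let ?x = "\<theta> *\<^sub>R ?e 1"
  have df: "?f differentiable (at x)" for x
    using f unfolding C2_on_def differentiable_def by auto
  obtain H where H: "(grad ?f has_derivative H) (at ?x)"
    using C1_onE[OF C1_on_grad[OF f]] by (metis UNIV_I)
  interpret H: linear H using H has_derivative_linear by blast
  have line: "((\<lambda>s. grad ?f (?x + s *\<^sub>R h)) has_derivative (\<lambda>s. s *\<^sub>R H h)) (at 0)" for h
    by (rule has_derivative_along_line) (simp add: H)
  have dk: "deriv k s = grad ?f (s *\<^sub>R ?e 1) \<bullet> ?e 1" if "s > 0" for s
    using radial_has_real_derivative[of k s "?e 1"] df that by (auto intro: DERIV_imp_deriv)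
  have tang: "H (?e j) $ j = deriv k \<theta> / \<theta>" if j: "j \<noteq> 1" for j
  proof -
    have orth: "s * (grad ?f (?x + s *\<^sub>R ?e j) \<bullet> ?e 1) = \<theta> * (grad ?f (?x + s *\<^sub>R ?e j) \<bullet> ?e j)" for s
    proof -
      have "(?x + s *\<^sub>R ?e j) \<bullet> (s *\<^sub>R ?e 1 - \<theta> *\<^sub>R ?e j) = 0"
        using j by (simp add: inner_add_left inner_diff_right inner_axis_axis)
      from grad_radial_orthogonal[OF df this]
      show ?thesis by (simp add: inner_diff_right)
    qed
    have "((\<lambda>s. s * (grad ?f (?x + s *\<^sub>R ?e j) \<bullet> ?e 1)) has_derivative
        (\<lambda>s. s * (grad ?f ?x \<bullet> ?e 1))) (at 0)"
      by (auto intro!: derivative_eq_intros line)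
    moreover have "((\<lambda>s. \<theta> * (grad ?f (?x + s *\<^sub>R ?e j) \<bullet> ?e j)) has_derivative
        (\<lambda>s. \<theta> * (s *\<^sub>R H (?e j) \<bullet> ?e j))) (at 0)"
      by (intro has_derivative_mult_right has_derivative_inner_left line)
    ultimately have "(\<lambda>s. s * (grad ?f ?x \<bullet> ?e 1)) = (\<lambda>s. \<theta> * (s *\<^sub>R H (?e j) \<bullet> ?e j))"
      unfolding orth by (rule has_derivative_unique)
    from fun_cong[OF this, of 1] show ?thesis
      using assms(2) dk[OF assms(2)] by (simp add: inner_axis field_simps)
  qed
  have "laplacian ?f ?x = H (?e 1) $ 1 + 2 * deriv k \<theta> / \<theta>"
    unfolding laplacian_eq[OF df H] by (simp add: sum_3 tang)
  moreover have "(deriv k has_real_derivative H (?e 1) $ 1) (at \<theta>)"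
  proof (rule has_field_derivative_transform_within_open[where S="{0<..}"])
    have "((\<lambda>s. grad ?f (s *\<^sub>R ?e 1)) has_derivative (\<lambda>s. s *\<^sub>R H (?e 1))) (at \<theta>)"
      by (rule has_derivative_along_ray[OF H])
    from has_derivative_inner_left[OF this, of "?e 1"]
    show "((\<lambda>s. grad ?f (s *\<^sub>R ?e 1) \<bullet> ?e 1) has_real_derivative H (?e 1) $ 1) (at \<theta>)"
      by (simp add: has_real_derivative_iff_has_vector_derivative has_vector_derivative_def inner_axis)
  qed (use assms(2) dk in auto)
  ultimately show ?thesis by simp
qed

section \<open>Decay of the form factor\<close>

lemma form_factor_C2: "form_factor G1' \<psi>1 \<Longrightarrow> C2_on UNIV (\<lambda>x::real^3. \<psi>1 (norm x))"
  by (simp add: form_factor_def)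

lemma form_factor_equation:
  "form_factor G1' \<psi>1 \<Longrightarrow>
    laplacian (\<lambda>z. \<psi>1 (norm z)) x = G1' ((\<psi>1 (norm x))\<^sup>2) * \<psi>1 (norm x)"
  by (simp add: form_factor_def)

lemma C2_on_UNIV_differentiable: "C2_on UNIV f \<Longrightarrow> f differentiable (at x)"
  unfolding C2_on_def differentiable_def by auto

text \<open>The function \<open>G\<^sub>1(\<psi>\<^sub>1\<^sup>2) - \<psi>\<^sub>1'\<^sup>2\<close> has derivative \<open>4 \<psi>\<^sub>1'\<^sup>2 / \<theta>\<close> by the
  radial equation, and tends to \<open>G\<^sub>1(0)\<close> at infinity.\<close>

lemma form_factor_first_integral:
  assumes nl: "nonlinearity_condition G1 G1'" and ff: "form_factor G1' \<psi>1" and "\<theta> > 0"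
  shows "((\<lambda>\<theta>. G1 ((\<psi>1 \<theta>)\<^sup>2) - (deriv \<psi>1 \<theta>)\<^sup>2) has_real_derivative 4 * (deriv \<psi>1 \<theta>)\<^sup>2 / \<theta>) (at \<theta>)"
proof -
  note C2 = form_factor_C2[OF ff]
  let ?x = "\<theta> *\<^sub>R (axis 1 1 :: real^3)"
  have nx: "norm ?x = \<theta>" using assms(3) by simp
  have pos: "\<psi>1 \<theta> > 0" using ff assms(3) by (simp add: form_factor_def)
  have "laplacian (\<lambda>z. \<psi>1 (norm z)) ?x = G1' ((\<psi>1 \<theta>)\<^sup>2) * \<psi>1 \<theta>"
    unfolding form_factor_equation[OF ff] nx ..
  then have d2: "(deriv \<psi>1 has_real_derivative G1' ((\<psi>1 \<theta>)\<^sup>2) * \<psi>1 \<theta> - 2 * deriv \<psi>1 \<theta> / \<theta>) (at \<theta>)"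
    using radial_second_derivatives[OF C2 assms(3)] by simp
  have d1: "(\<psi>1 has_real_derivative deriv \<psi>1 \<theta>) (at \<theta>)"
    using radial_has_real_derivative[OF C2_on_UNIV_differentiable[OF C2], of "axis 1 1" \<theta>] assms(3)
    by (simp add: DERIV_deriv_iff_real_differentiable real_differentiable_def) blast
  have "(G1 has_real_derivative G1' ((\<psi>1 \<theta>)\<^sup>2)) (at ((\<psi>1 \<theta>)\<^sup>2))"
    using nl pos by (simp add: nonlinearity_condition_def)
  moreover have "((\<lambda>\<theta>. (\<psi>1 \<theta>)\<^sup>2) has_real_derivative 2 * \<psi>1 \<theta> * deriv \<psi>1 \<theta>) (at \<theta>)"
    using d1 by (auto intro!: derivative_eq_intros)
  ultimately have "((\<lambda>\<theta>. G1 ((\<psi>1 \<theta>)\<^sup>2)) has_real_derivative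
      G1' ((\<psi>1 \<theta>)\<^sup>2) * (2 * \<psi>1 \<theta> * deriv \<psi>1 \<theta>)) (at \<theta>)"
    by (rule DERIV_chain2)
  from DERIV_diff[OF this DERIV_power[OF d2, of 2]]
  show ?thesis
    by (rule DERIV_cong) (use assms(3) in \<open>simp add: field_simps power2_eq_square\<close>)
qed

lemma form_factor_decay:
  assumes nl: "nonlinearity_condition G1 G1'" and ff: "form_factor G1' \<psi>1"
    and d0: "\<exists>C. \<forall>\<^sub>F \<theta> in at_top. \<theta>\<^sup>2 * \<bar>\<psi>1 \<theta>\<bar> \<le> C"
    and d1: "\<exists>C. \<forall>\<^sub>F \<theta> in at_top. \<theta>^3 * \<bar>deriv \<psi>1 \<theta>\<bar> \<le> C"
  obtains K \<theta>0 where "K \<ge> 0" "\<theta>0 > 0" and "\<And>\<theta>. \<theta> \<ge> \<theta>0 \<Longrightarrow>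
    (\<psi>1 \<theta>)\<^sup>2 \<le> K / \<theta>^4 \<and> (deriv \<psi>1 \<theta>)\<^sup>2 \<le> K / \<theta>^6 \<and> \<bar>G1 ((\<psi>1 \<theta>)\<^sup>2) - G1 0\<bar> \<le> K / \<theta>^6"
proof -
  let ?p = "deriv \<psi>1" and ?\<Gamma> = "\<lambda>\<theta>. G1 ((\<psi>1 \<theta>)\<^sup>2) - (deriv \<psi>1 \<theta>)\<^sup>2"
  obtain C0 N0 C1 N1 where C: "\<And>\<theta>. \<theta> \<ge> N0 \<Longrightarrow> \<theta>\<^sup>2 * \<bar>\<psi>1 \<theta>\<bar> \<le> C0" "\<And>\<theta>. \<theta> \<ge> N1 \<Longrightarrow> \<theta>^3 * \<bar>?p \<theta>\<bar> \<le> C1"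
    using d0 d1 unfolding eventually_at_top_linorder by metis
  define \<theta>0 where "\<theta>0 = Max {N0, N1, 1}"
  have \<theta>0: "\<theta>0 \<ge> N0" "\<theta>0 \<ge> N1" "\<theta>0 \<ge> 1" unfolding \<theta>0_def by simp_all
  have b0: "(\<psi>1 \<theta>)\<^sup>2 \<le> C0\<^sup>2 / \<theta>^4" if "\<theta> \<ge> \<theta>0" for \<theta>
  proof -
    have "(\<theta>\<^sup>2 * \<bar>\<psi>1 \<theta>\<bar>)\<^sup>2 \<le> C0\<^sup>2" using C(1) that \<theta>0 by (intro power_mono) auto
    then show ?thesis using that \<theta>0 by (simp add: field_simps flip: power_mult)
  qed
  have b1: "(?p \<theta>)\<^sup>2 \<le> C1\<^sup>2 / \<theta>^6" if "\<theta> \<ge> \<theta>0" for \<theta>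
  proof -
    have "(\<theta>^3 * \<bar>?p \<theta>\<bar>)\<^sup>2 \<le> C1\<^sup>2" using C(2) that \<theta>0 by (intro power_mono) auto
    then show ?thesis using that \<theta>0 by (simp add: field_simps flip: power_mult)
  qed
  have lim0: "((\<lambda>\<theta>. k / \<theta>^Suc n) \<longlongrightarrow> 0) at_top" for k :: real and n
    by (intro real_tendsto_divide_at_top[OF tendsto_const] filterlim_pow_at_top filterlim_ident) auto
  have ev: "\<forall>\<^sub>F \<theta> in at_top. \<theta> \<ge> \<theta>0" by (rule eventually_ge_at_top)
  have l0: "((\<lambda>\<theta>. (\<psi>1 \<theta>)\<^sup>2) \<longlongrightarrow> 0) at_top"
    by (rule tendsto_sandwich[OF _ eventually_mono[OF ev b0] tendsto_const])
      (use lim0[of "C0\<^sup>2" 3] in \<open>simp_all add: numeral_eq_Suc\<close>)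
  have l1: "((\<lambda>\<theta>. (?p \<theta>)\<^sup>2) \<longlongrightarrow> 0) at_top"
    by (rule tendsto_sandwich[OF _ eventually_mono[OF ev b1] tendsto_const])
      (use lim0[of "C1\<^sup>2" 5] in \<open>simp_all add: numeral_eq_Suc\<close>)
  have "((\<lambda>\<theta>. G1 ((\<psi>1 \<theta>)\<^sup>2)) \<longlongrightarrow> G1 0) at_top"
    using nl by (intro continuous_on_tendsto_compose[OF _ l0, of "{0..}"])
      (auto simp: nonlinearity_condition_def)
  from tendsto_diff[OF this l1] have l\<Gamma>: "(?\<Gamma> \<longlongrightarrow> G1 0) at_top" by simp
  note D\<Gamma> = form_factor_first_integral[OF nl ff]
  \<comment> \<open>\<open>?\<Gamma>\<close> increases and \<open>?\<Gamma> + C\<^sub>1\<^sup>2 \<theta>\<^sup>-\<^sup>6\<close> decreases to the limit \<open>G1 0\<close>.\<close>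
  have up: "?\<Gamma> \<theta> \<le> G1 0" if "\<theta> \<ge> \<theta>0" for \<theta>
  proof (rule tendsto_lowerbound[OF l\<Gamma>])
    have "?\<Gamma> \<theta> \<le> ?\<Gamma> s" if "s \<ge> \<theta>" for s
    proof (rule DERIV_nonneg_imp_nondecreasing[OF that])
      fix x assume "\<theta> \<le> x"
      then have x: "x > 0" using \<open>\<theta> \<ge> \<theta>0\<close> \<theta>0 by auto
      show "\<exists>y. (?\<Gamma> has_real_derivative y) (at x) \<and> y \<ge> 0"
        by (intro exI conjI, rule D\<Gamma>[OF x]) (use x in simp)
    qed
    then show "\<forall>\<^sub>F s in at_top. ?\<Gamma> \<theta> \<le> ?\<Gamma> s"
      by (rule eventually_mono[OF eventually_ge_at_top[of \<theta>]])
  qed simp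
  have lo: "?\<Gamma> \<theta> + C1\<^sup>2 / \<theta>^6 \<ge> G1 0" if "\<theta> \<ge> \<theta>0" for \<theta>
  proof (rule tendsto_upperbound)
    show "((\<lambda>\<theta>. ?\<Gamma> \<theta> + C1\<^sup>2 / \<theta>^6) \<longlongrightarrow> G1 0) at_top"
      using tendsto_add[OF l\<Gamma> lim0[of "C1\<^sup>2" 5]] by (simp add: numeral_eq_Suc)
    have "?\<Gamma> s + C1\<^sup>2 / s^6 \<le> ?\<Gamma> \<theta> + C1\<^sup>2 / \<theta>^6" if "s \<ge> \<theta>" for s
    proof (rule DERIV_nonpos_imp_nonincreasing[OF that])
      fix x assume x: "\<theta> \<le> x"
      then have x0: "x > 0" "x \<ge> \<theta>0" using \<open>\<theta> \<ge> \<theta>0\<close> \<theta>0 by auto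
      have "((\<lambda>\<theta>. C1\<^sup>2 / \<theta>^6) has_real_derivative - 6 * C1\<^sup>2 / x^7) (at x)"
        using x0 by (auto intro!: derivative_eq_intros simp: field_simps eval_nat_numeral)
      from DERIV_add[OF D\<Gamma>[OF x0(1)] this]
      have "((\<lambda>\<theta>. ?\<Gamma> \<theta> + C1\<^sup>2 / \<theta>^6) has_real_derivative 4 * (?p x)\<^sup>2 / x + - 6 * C1\<^sup>2 / x^7) (at x)" .
      moreover have "4 * (?p x)\<^sup>2 / x + - 6 * C1\<^sup>2 / x^7 \<le> 0"
      proof -
        have "4 * (?p x)\<^sup>2 / x \<le> 4 * (C1\<^sup>2 / x^6) / x"
          using b1[OF x0(2)] x0 by (intro divide_right_mono mult_left_mono) auto
        also have "\<dots> \<le> 6 * C1\<^sup>2 / x^7"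
          using x0 by (simp add: divide_simps eval_nat_numeral)
        finally show ?thesis by simp
      qed
      ultimately show "\<exists>y. ((\<lambda>\<theta>. ?\<Gamma> \<theta> + C1\<^sup>2 / \<theta>^6) has_real_derivative y) (at x) \<and> y \<le> 0" by blast
    qed
    then show "\<forall>\<^sub>F s in at_top. ?\<Gamma> s + C1\<^sup>2 / s^6 \<le> ?\<Gamma> \<theta> + C1\<^sup>2 / \<theta>^6"
      by (rule eventually_mono[OF eventually_ge_at_top[of \<theta>]])
  qed simp
  have b2: "\<bar>G1 ((\<psi>1 \<theta>)\<^sup>2) - G1 0\<bar> \<le> C1\<^sup>2 / \<theta>^6" if "\<theta> \<ge> \<theta>0" for \<theta>
    using up[OF that] lo[OF that] b1[OF that] zero_le_power2[of "?p \<theta>"] by linarith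
  define K where "K = C0\<^sup>2 + C1\<^sup>2"
  show ?thesis
  proof (rule that[of K \<theta>0])
    fix \<theta> assume \<theta>: "\<theta> \<ge> \<theta>0"
    have "C0\<^sup>2 / \<theta>^4 \<le> K / \<theta>^4" "C1\<^sup>2 / \<theta>^6 \<le> K / \<theta>^6"
      using \<theta> \<theta>0 unfolding K_def by (auto intro!: divide_right_mono)
    then show "(\<psi>1 \<theta>)\<^sup>2 \<le> K / \<theta>^4 \<and> (?p \<theta>)\<^sup>2 \<le> K / \<theta>^6 \<and> \<bar>G1 ((\<psi>1 \<theta>)\<^sup>2) - G1 0\<bar> \<le> K / \<theta>^6"
      using b0[OF \<theta>] b1[OF \<theta>] b2[OF \<theta>] by linarith
  qed (use \<theta>0 in \<open>auto simp: K_def\<close>)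
qed

text \<open>After the substitution \<open>s \<rightarrow> a\<^sup>3 s\<close> the fundamental theorem of calculus gives
  \<open>G\<^sub>a(s) = a\<^sup>-\<^sup>5 (G\<^sub>1(a\<^sup>3 s) - G\<^sub>1(0))\<close>.\<close>

lemma abs_Ga_le:
  assumes nl: "nonlinearity_condition G1 G1'" and "a > 0" "s > 0"
  shows "\<bar>nls.Ga G1' a s\<bar> \<le> \<bar>G1 (a^3 * s) - G1 0\<bar> / a^5"
proof (cases "set_integrable lborel (einterval 0 (ereal s)) (nls.Ga' G1' a)")
  case True
  let ?F = "\<lambda>u. G1 (a^3 * u) / a^5"
  have a3: "a^3 * u > 0" if "u > 0" for u using that assms(2) by simp
  have G1: "(G1 has_real_derivative G1' u) (at u)" if "u > 0" for u
    using nl that unfolding nonlinearity_condition_def by blast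
  have "continuous_on {0<..} G1'" using nl unfolding nonlinearity_condition_def by blast
  then have G1': "isCont G1' u" if "u > 0" for u
    using that by (simp add: continuous_on_eq_continuous_at)
  have cont: "continuous_on {0..} ?F"
  proof -
    have "continuous_on {0..} G1" using nl unfolding nonlinearity_condition_def by blast
    then have "continuous_on {0..} (\<lambda>u. G1 (a^3 * u))"
      by (rule continuous_on_compose2) (use assms(2) in \<open>auto intro!: continuous_intros\<close>)
    then show ?thesis using assms(2) by (intro continuous_intros) auto
  qed
  have "(LBINT u=0..ereal s. nls.Ga' G1' a u) = ?F s - ?F 0"
  proof (rule interval_integral_FTC_integrable)
    show "0 < ereal s" using assms(3) by simp
    fix u assume "0 < ereal u" then have u: "u > 0" by simp
    have "(?F has_real_derivative G1' (a^3 * u) * a^3 / a^5) (at u)"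
    proof -
      have "((\<lambda>u. a^3 * u) has_real_derivative a^3) (at u)" by (auto intro!: derivative_eq_intros)
      from DERIV_cdivide[OF DERIV_chain2[where f=G1 and g="\<lambda>u. a^3 * u", OF G1[OF a3[OF u]] this]]
      show ?thesis by simp
    qed
    also have "G1' (a^3 * u) * a^3 / a^5 = nls.Ga' G1' a u"
      using assms(2) by (simp add: nls.Ga'_def divide_simps eval_nat_numeral)
    finally show "(?F has_vector_derivative nls.Ga' G1' a u) (at u)"
      by (simp add: has_real_derivative_iff_has_vector_derivative)
    show "isCont (nls.Ga' G1' a) u"
      unfolding nls.Ga'_def using assms(2) G1'[OF a3[OF u]]
      by (intro continuous_intros isCont_o2[where f="\<lambda>u. a^3 * u" and g=G1']) auto
  next
    have "(?F \<longlongrightarrow> ?F 0) (at_right 0)" "(?F \<longlongrightarrow> ?F s) (at_left s)"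
    proof -
      show "(?F \<longlongrightarrow> ?F 0) (at_right 0)"
      proof -
        have "(?F \<longlongrightarrow> ?F 0) (at 0 within {0..})"
          using cont unfolding continuous_on_def by (rule bspec) simp
        then show ?thesis by (rule tendsto_within_subset) auto
      qed
      have "isCont ?F s" using continuous_on_interior[OF cont, of s] assms(3) by simp
      then show "(?F \<longlongrightarrow> ?F s) (at_left s)"
        unfolding continuous_at by (rule filterlim_mono) (auto simp: at_le)
    qed
    then show "((?F \<circ> real_of_ereal) \<longlongrightarrow> ?F 0) (at_right 0)"
      "((?F \<circ> real_of_ereal) \<longlongrightarrow> ?F s) (at_left (ereal s))"
      by (simp_all add: ereal_tendsto_simps zero_ereal_def)
  qed (rule True)
  then have "nls.Ga G1' a s = (G1 (a^3 * s) - G1 0) / a^5"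
    unfolding nls.Ga_def by (simp add: diff_divide_distrib)
  then show ?thesis using assms(2) by simp
next
  \<comment> \<open>In this case, which the condition on the nonlinearity in fact excludes, the integral has the
    default value \<open>0\<close>.\<close>
  case False
  then have "nls.Ga G1' a s = 0"
    using assms(3) unfolding nls.Ga_def
    by (simp add: interval_lebesgue_integral_def set_lebesgue_integral_def set_integrable_def
        not_integrable_integral_eq)
  then show ?thesis using assms(2) by simp
qed

section \<open>The scaled form factor\<close>

text \<open>The scaled form factor as a function of the space variable.\<close>

definition profile :: "(real \<Rightarrow> real) \<Rightarrow> real \<Rightarrow> real^3 \<Rightarrow> real" where
  "profile \<psi>1 a y = scaled_form_factor \<psi>1 a (norm y)"

lemma profile_eq:
  assumes "a > 0"
  shows "profile \<psi>1 a y = a powr (-3/2) * \<psi>1 (norm ((1 / a) *\<^sub>R y))"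
  using assms by (simp add: profile_def scaled_form_factor_def)

lemma powr_three_halves:
  assumes "a > (0::real)"
  shows "(a powr (-3/2))\<^sup>2 = 1 / a^3"
proof -
  have "(a powr (-3/2))\<^sup>2 = a powr (-3/2 + -3/2)" unfolding powr_add power2_eq_square ..
  also have "\<dots> = 1 / a powr 3" by (simp add: powr_minus_divide)
  also have "a powr 3 = a ^ 3" using assms powr_realpow[of a 3] by simp
  finally show ?thesis .
qed

lemma profile_square:
  assumes "a > 0"
  shows "(profile \<psi>1 a y)\<^sup>2 = (\<psi>1 (norm y / a))\<^sup>2 / a^3"
proof -
  have "(a powr (-3/2))\<^sup>2 = 1 / a^3" by (rule powr_three_halves[OF assms])
  then show ?thesis by (simp add: profile_def scaled_form_factor_def power_mult_distrib)
qed

lemma profile_pos: "form_factor G1' \<psi>1 \<Longrightarrow> a > 0 \<Longrightarrow> profile \<psi>1 a y > 0"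
  by (simp add: form_factor_def profile_def scaled_form_factor_def)

lemma profile_has_derivative:
  assumes ff: "form_factor G1' \<psi>1" and "a > 0"
  shows "(profile \<psi>1 a has_derivative
    (\<lambda>h. (a powr (-3/2) / a) *\<^sub>R grad (\<lambda>x. \<psi>1 (norm x)) ((1 / a) *\<^sub>R y) \<bullet> h)) (at y)"
proof -
  let ?f = "\<lambda>x::real^3. \<psi>1 (norm x)"
  have "((\<lambda>y. (1 / a) *\<^sub>R y) has_derivative (\<lambda>h. (1 / a) *\<^sub>R h)) (at y)"
    by (auto intro!: derivative_eq_intros)
  from has_derivative_compose[OF this
      has_derivative_grad[OF C2_on_UNIV_differentiable[OF form_factor_C2[OF ff]]]]
  have "((\<lambda>y. ?f ((1 / a) *\<^sub>R y)) has_derivative (\<lambda>h. grad ?f ((1 / a) *\<^sub>R y) \<bullet> ((1 / a) *\<^sub>R h))) (at y)" .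
  from has_derivative_mult_right[OF this, of "a powr (-3/2)"]
  show ?thesis unfolding profile_eq[OF assms(2), abs_def] by simp
qed

lemma grad_profile:
  assumes "form_factor G1' \<psi>1" "a > 0"
  shows "grad (profile \<psi>1 a) y = (a powr (-3/2) / a) *\<^sub>R grad (\<lambda>x. \<psi>1 (norm x)) ((1 / a) *\<^sub>R y)"
  by (rule grad_eqI[OF profile_has_derivative[OF assms]])

lemma profile_differentiable:
  assumes "form_factor G1' \<psi>1" "a > 0"
  shows "profile \<psi>1 a differentiable (at y)"
  using profile_has_derivative[OF assms] differentiableI by blast

lemma C1_on_grad_profile:
  assumes ff: "form_factor G1' \<psi>1" and a: "a > 0"
  shows "C1_on UNIV (grad (profile \<psi>1 a))"
  unfolding grad_profile[OF assms, abs_def]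
  by (intro C1_on_cmult C1_on_compose[OF _ C1_on_grad[OF form_factor_C2[OF ff]]]
      C1_on_linear_id bounded_linear_scaleR_right) auto

text \<open>The scaled form factor solves the stationary equation with the scaled nonlinearity.\<close>

lemma profile_equation:
  assumes ff: "form_factor G1' \<psi>1" and a: "a > 0"
    and H: "(grad (profile \<psi>1 a) has_derivative H) (at y)"
  shows "(\<Sum>j\<in>UNIV. H (axis j 1) $ j) = nls.Ga' G1' a ((profile \<psi>1 a y)\<^sup>2) * profile \<psi>1 a y"
proof -
  let ?f = "\<lambda>x::real^3. \<psi>1 (norm x)" and ?k = "a powr (-3/2) / a" and ?z = "(1 / a) *\<^sub>R y"
  note df = C2_on_UNIV_differentiable[OF form_factor_C2[OF ff]]
  obtain K where K: "(grad ?f has_derivative K) (at ?z)"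
    using C1_onE[OF C1_on_grad[OF form_factor_C2[OF ff]]] by (metis UNIV_I)
  interpret K: linear K using K has_derivative_linear by blast
  have "((\<lambda>y. (1 / a) *\<^sub>R y) has_derivative (\<lambda>h. (1 / a) *\<^sub>R h)) (at y)"
    by (auto intro!: derivative_eq_intros)
  from has_derivative_scaleR_right[OF has_derivative_compose[OF this K], of ?k]
  have "(grad (profile \<psi>1 a) has_derivative (\<lambda>h. ?k *\<^sub>R K ((1 / a) *\<^sub>R h))) (at y)"
    unfolding grad_profile[OF assms(1,2), abs_def] .
  with H have "H = (\<lambda>h. ?k *\<^sub>R K ((1 / a) *\<^sub>R h))" by (rule has_derivative_unique)
  then have "(\<Sum>j\<in>UNIV. H (axis j 1) $ j) = ?k / a * laplacian ?f ?z"
    by (simp add: laplacian_eq[OF df K] K.scale sum_distrib_left)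
  also have "laplacian ?f ?z = G1' ((?f ?z)\<^sup>2) * ?f ?z"
    by (rule form_factor_equation[OF ff])
  also have "(?f ?z)\<^sup>2 = a^3 * (profile \<psi>1 a y)\<^sup>2"
    using a by (simp add: profile_square)
  finally show ?thesis
    using a by (simp add: profile_eq nls.Ga'_def divide_simps power2_eq_square)
qed

lemma grad_profile_orthogonal:
  assumes "form_factor G1' \<psi>1" "a > 0" "y \<bullet> w = 0"
  shows "grad (profile \<psi>1 a) y \<bullet> w = 0"
  using grad_radial_orthogonal[of "scaled_form_factor \<psi>1 a" y w] profile_differentiable[OF assms(1,2)]
    assms(3) by (simp add: profile_def[abs_def])

text \<open>The gradient of the scaled form factor is radial, with the size of the scaled derivative.\<close>

lemma norm_grad_profile:
  assumes ff: "form_factor G1' \<psi>1" and a: "a > 0" and y: "y \<noteq> 0"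
  shows "(norm (grad (profile \<psi>1 a) y))\<^sup>2 = (deriv \<psi>1 (norm y / a))\<^sup>2 / a^5"
proof -
  have "(a powr (-3/2))\<^sup>2 = 1 / a^3" by (rule powr_three_halves[OF a])
  moreover have "grad (\<lambda>x. \<psi>1 (norm x)) ((1 / a) *\<^sub>R y) = (deriv \<psi>1 (norm y / a) / norm y) *\<^sub>R y"
    using grad_radial[OF C2_on_UNIV_differentiable[OF form_factor_C2[OF ff]], of "(1 / a) *\<^sub>R y"] a y
    by simp
  ultimately show ?thesis
    using a y unfolding grad_profile[OF ff a]
    by (simp add: power_mult_distrib power_divide divide_simps eval_nat_numeral)
qed

text \<open>The decay of the form factor in terms of the unscaled distance to the centre.\<close>

lemma profile_boundary_bounds:
  assumes nl: "nonlinearity_condition G1 G1'" and ff: "form_factor G1' \<psi>1"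
    and d0: "\<exists>C. \<forall>\<^sub>F \<theta> in at_top. \<theta>\<^sup>2 * \<bar>\<psi>1 \<theta>\<bar> \<le> C"
    and d1: "\<exists>C. \<forall>\<^sub>F \<theta> in at_top. \<theta>^3 * \<bar>deriv \<psi>1 \<theta>\<bar> \<le> C"
  obtains K \<theta>0 where "K \<ge> 0" "\<theta>0 > 0"
    and "\<And>a y. a > 0 \<Longrightarrow> norm y / a \<ge> \<theta>0 \<Longrightarrow> (profile \<psi>1 a y)\<^sup>2 \<le> K * a / norm y ^ 4"
    and "\<And>a y. a > 0 \<Longrightarrow> norm y / a \<ge> \<theta>0 \<Longrightarrow> (norm (grad (profile \<psi>1 a) y))\<^sup>2 \<le> K * a / norm y ^ 6"
    and "\<And>a y. a > 0 \<Longrightarrow> norm y / a \<ge> \<theta>0 \<Longrightarrow> \<bar>nls.Ga G1' a ((profile \<psi>1 a y)\<^sup>2)\<bar> \<le> K * a / norm y ^ 6"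
proof -
  obtain K \<theta>0 where K: "K \<ge> 0" "\<theta>0 > 0" and b: "\<And>\<theta>. \<theta> \<ge> \<theta>0 \<Longrightarrow>
    (\<psi>1 \<theta>)\<^sup>2 \<le> K / \<theta>^4 \<and> (deriv \<psi>1 \<theta>)\<^sup>2 \<le> K / \<theta>^6 \<and> \<bar>G1 ((\<psi>1 \<theta>)\<^sup>2) - G1 0\<bar> \<le> K / \<theta>^6"
    using form_factor_decay[OF assms] by metis
  show ?thesis
  proof (rule that[OF K])
    fix a :: real and y :: "real^3"
    assume a: "a > 0" and y: "norm y / a \<ge> \<theta>0"
    let ?\<theta> = "norm y / a"
    have ny: "norm y > 0" using y K(2) by (cases "y = 0") auto
    then have y0: "y \<noteq> 0" by simp
    note b = b[OF y]
    show "(profile \<psi>1 a y)\<^sup>2 \<le> K * a / norm y ^ 4"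
    proof -
      have "(profile \<psi>1 a y)\<^sup>2 \<le> (K / ?\<theta>^4) / a^3"
        unfolding profile_square[OF a] using a b by (intro divide_right_mono) auto
      also have "\<dots> = K * a / norm y ^ 4"
        using a ny by (simp add: field_simps eval_nat_numeral)
      finally show ?thesis .
    qed
    show "(norm (grad (profile \<psi>1 a) y))\<^sup>2 \<le> K * a / norm y ^ 6"
    proof -
      have "(norm (grad (profile \<psi>1 a) y))\<^sup>2 \<le> (K / ?\<theta>^6) / a^5"
        unfolding norm_grad_profile[OF ff a y0] using a b by (intro divide_right_mono) auto
      also have "\<dots> = K * a / norm y ^ 6"
        using a ny by (simp add: field_simps eval_nat_numeral)
      finally show ?thesis .
    qed
    show "\<bar>nls.Ga G1' a ((profile \<psi>1 a y)\<^sup>2)\<bar> \<le> K * a / norm y ^ 6"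
    proof -
      have "\<bar>nls.Ga G1' a ((profile \<psi>1 a y)\<^sup>2)\<bar> \<le> \<bar>G1 (a^3 * (profile \<psi>1 a y)\<^sup>2) - G1 0\<bar> / a^5"
        using profile_pos[OF ff a] by (intro abs_Ga_le[OF nl a]) (simp add: less_imp_neq[symmetric])
      also have "a^3 * (profile \<psi>1 a y)\<^sup>2 = (\<psi>1 ?\<theta>)\<^sup>2" using a by (simp add: profile_square)
      also have "\<bar>G1 ((\<psi>1 ?\<theta>)\<^sup>2) - G1 0\<bar> / a^5 \<le> (K / ?\<theta>^6) / a^5"
        using a b by (intro divide_right_mono) auto
      also have "\<dots> = K * a / norm y ^ 6"
        using a ny by (simp add: field_simps eval_nat_numeral)
      finally show ?thesis .
    qed
  qed
qed

section \<open>The charge of the form factor\<close>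

lemma lborel_integral_affine:
  fixes f :: "'a::euclidean_space \<Rightarrow> 'b::{banach, second_countable_topology}"
  assumes [measurable]: "f \<in> borel_measurable borel" and c: "c \<noteq> 0"
  shows "(\<integral>x. f x \<partial>lborel) = \<bar>c\<bar>^DIM('a) *\<^sub>R (\<integral>x. f (t + c *\<^sub>R x) \<partial>lborel)"
  by (subst lborel_affine[OF c, of t])
    (simp add: integral_density integral_distr)

lemma profile_continuous: "form_factor G1' \<psi>1 \<Longrightarrow> a > 0 \<Longrightarrow> continuous_on S (profile \<psi>1 a)"
  by (meson continuous_at_imp_continuous_on differentiable_imp_continuous_within profile_differentiable)

lemma profile_charge:
  assumes ff: "form_factor G1' \<psi>1" and a: "a > 0"
  shows "(LINT x:cball z R|lborel. (profile \<psi>1 a (x - z))\<^sup>2)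
    = (LINT x:cball (0::real^3) (R / a)|lborel. (\<psi>1 (norm x))\<^sup>2)"
proof -
  have "continuous_on UNIV (\<lambda>x. (profile \<psi>1 a (x - z))\<^sup>2)"
    by (intro continuous_intros continuous_on_compose2[OF profile_continuous[OF ff a, of UNIV]]) auto
  then have "(\<lambda>x. (profile \<psi>1 a (x - z))\<^sup>2) \<in> borel_measurable borel"
    by (rule borel_measurable_continuous_onI)
  then have m: "(\<lambda>x. indicator (cball z R) x *\<^sub>R (profile \<psi>1 a (x - z))\<^sup>2) \<in> borel_measurable borel"
    by (intro borel_measurable_scaleR borel_measurable_indicator) auto
  have eq: "indicator (cball z R) (z + a *\<^sub>R x) *\<^sub>R (profile \<psi>1 a (a *\<^sub>R x))\<^sup>2
      = (indicator (cball 0 (R / a)) x *\<^sub>R (\<psi>1 (norm x))\<^sup>2) / a^3" for x :: "real^3"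
  proof -
    have "z + a *\<^sub>R x \<in> cball z R \<longleftrightarrow> x \<in> cball 0 (R / a)"
      using a by (simp add: dist_norm field_simps)
    then show ?thesis using a by (simp add: profile_square indicator_def)
  qed
  show ?thesis
    unfolding set_lebesgue_integral_def lborel_integral_affine[OF m, of a z] less_imp_neq[OF a, symmetric]
    using a by (simp add: eq lborel_integral_affine[OF m, of a z] del: real_scaleR_def) simp
qed

lemma form_factor_charge_pos:
  assumes ff: "form_factor G1' \<psi>1"
  shows "(LINT x|lborel. (\<psi>1 (norm (x::real^3)))\<^sup>2) > 0"
proof -
  have int: "integrable lborel (\<lambda>x::real^3. (\<psi>1 (norm x))\<^sup>2)" using ff by (simp add: form_factor_def)
  have pos: "(\<psi>1 (norm (x::real^3)))\<^sup>2 \<noteq> 0" for x using ff by (simp add: form_factor_def less_imp_neq[symmetric])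
  have "(LINT x|lborel. (\<psi>1 (norm (x::real^3)))\<^sup>2) \<noteq> 0"
  proof
    assume "(LINT x|lborel. (\<psi>1 (norm (x::real^3)))\<^sup>2) = 0"
    then have "AE x::real^3 in lborel. (\<psi>1 (norm x))\<^sup>2 = 0"
      using integral_nonneg_eq_0_iff_AE[OF int] by simp
    then have "AE x::real^3 in lborel. False" using pos by simp
    then have "emeasure lborel (UNIV :: (real^3) set) = 0" by (simp add: AE_iff_measurable[OF _ refl])
    then show False by simp
  qed
  moreover have "(LINT x|lborel. (\<psi>1 (norm (x::real^3)))\<^sup>2) \<ge> 0"
    by (rule integral_nonneg_AE) simp
  ultimately show ?thesis by linarith
qed

lemma form_factor_charge_le:
  assumes ff: "form_factor G1' \<psi>1"
  shows "(LINT x:cball (0::real^3) s|lborel. (\<psi>1 (norm x))\<^sup>2) \<le> (LINT x|lborel. (\<psi>1 (norm (x::real^3)))\<^sup>2)"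
proof -
  have int: "integrable lborel (\<lambda>x::real^3. (\<psi>1 (norm x))\<^sup>2)" using ff by (simp add: form_factor_def)
  then have "set_integrable lborel (cball 0 s) (\<lambda>x::real^3. (\<psi>1 (norm x))\<^sup>2)"
    using integrable_mult_indicator[OF _ int, of "cball 0 s"] by (simp add: set_integrable_def)
  then show ?thesis
    unfolding set_lebesgue_integral_def set_integrable_def
    by (rule integral_mono[OF _ int]) (simp add: indicator_def)
qed

lemma form_factor_charge_tendsto:
  assumes ff: "form_factor G1' \<psi>1" and \<theta>: "filterlim \<theta> at_top sequentially"
  shows "(\<lambda>n. LINT x:cball (0::real^3) (\<theta> n)|lborel. (\<psi>1 (norm x))\<^sup>2)
    \<longlonglongrightarrow> (LINT x|lborel. (\<psi>1 (norm (x::real^3)))\<^sup>2)"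
proof -
  have int: "integrable lborel (\<lambda>x::real^3. (\<psi>1 (norm x))\<^sup>2)" using ff by (simp add: form_factor_def)
  note [measurable] = borel_measurable_integrable[OF int]
  show ?thesis
    unfolding set_lebesgue_integral_def
  proof (rule integral_dominated_convergence[OF _ _ int])
    show "AE x::real^3 in lborel. (\<lambda>n. indicator (cball 0 (\<theta> n)) x *\<^sub>R (\<psi>1 (norm x))\<^sup>2) \<longlonglongrightarrow> (\<psi>1 (norm x))\<^sup>2"
    proof (rule AE_I2)
      fix x :: "real^3"
      have "\<forall>\<^sub>F n in sequentially. \<theta> n \<ge> norm x" using \<theta> by (simp add: filterlim_at_top)
      then have "\<forall>\<^sub>F n in sequentially. indicator (cball 0 (\<theta> n)) x *\<^sub>R (\<psi>1 (norm x))\<^sup>2 = (\<psi>1 (norm x))\<^sup>2"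
        by eventually_elim simp
      then show "(\<lambda>n. indicator (cball 0 (\<theta> n)) x *\<^sub>R (\<psi>1 (norm x))\<^sup>2) \<longlonglongrightarrow> (\<psi>1 (norm x))\<^sup>2"
        by (rule tendsto_eventually)
    qed
  qed (auto simp: indicator_def)
qed

section \<open>The phase of a wave-corpuscle\<close>

text \<open>A trajectory that satisfies Newton's equation, admissible potentials and a form factor; the size
  parameter and the radius of the tube are not yet fixed.\<close>

locale corpuscle = nls m q chi c G1 G1' Tm Tp
  for m q chi c :: real and G1 G1' :: "real \<Rightarrow> real" and Tm Tp :: real +
  fixes \<psi>1 :: "real \<Rightarrow> real" and tstar :: real
    and r :: "real \<Rightarrow> real^3"
    and \<phi> :: "spacetime \<Rightarrow> real" and A :: "spacetime \<Rightarrow> real^3"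
    and \<phi>0 :: "real \<Rightarrow> real" and g A0 :: "real \<Rightarrow> real^3" and A1 :: "real \<Rightarrow> real^3^3"
    and P3 :: "spacetime \<Rightarrow> real"
  assumes pos: "m > 0" "q > 0" "chi > 0" "c > 0"
    and time: "Tm < Tp" "tstar \<in> {Tm..Tp}"
    and nonlinearity: "nonlinearity_condition G1 G1'"
    and form_factor: "form_factor G1' \<psi>1"
    and C2_r: "C2_on {Tm..Tp} r"
    and admissible: "admissible_potentials r \<phi> A \<phi>0 g A0 A1 P3"
    and newton: "newton \<phi> A r"
begin

abbreviation "vel \<equiv> velocity r"
abbreviation "acc \<equiv> acceleration r"
abbreviation "Q \<equiv> grad_y P3"
abbreviation "time_deriv f t \<equiv> vector_derivative f (at t within {Tm..Tp})"

lemma strip_iff: "p \<in> strip \<longleftrightarrow> fst p \<in> {Tm..Tp}"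
  by (cases p) (simp add: strip_def)

lemma convex_strip: "convex strip" and interior_strip: "interior strip \<noteq> {}"
  using time by (auto simp: strip_def interior_Times intro!: convex_Times)

lemmas strip_derivative = C1_on_dir_deriv(1)[OF _ convex_strip interior_strip]
lemmas strip_continuous = C1_on_dir_deriv(2)[OF _ convex_strip interior_strip]

lemma
  shows C1_phi0: "C1_on {Tm..Tp} \<phi>0" and C1_g: "C1_on {Tm..Tp} g" and C1_A0: "C1_on {Tm..Tp} A0"
    and C1_A1: "C1_on {Tm..Tp} A1" and C1_Q: "C1_on strip Q"
    and C2_phi: "C2_on strip \<phi>" and C2_A: "C2_on strip A"
    and P3_differentiable: "\<And>t y. t \<in> {Tm..Tp} \<Longrightarrow> (\<lambda>z. P3 (t, z)) differentiable (at y)"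
    and phi_eq: "\<And>t x. t \<in> {Tm..Tp} \<Longrightarrow>
        \<phi> (t, x) = \<phi>0 t + (x - r t) \<bullet> g t + phi2 r A1 P3 (t, x - r t)"
    and A_eq: "\<And>t x. t \<in> {Tm..Tp} \<Longrightarrow> A (t, x) = A0 t + A1 t *v (x - r t) + Q (t, x - r t)"
    and P3_zero: "\<And>t. t \<in> {Tm..Tp} \<Longrightarrow> P3 (t, 0) = 0"
    and Q_zero: "\<And>t. t \<in> {Tm..Tp} \<Longrightarrow> Q (t, 0) = 0"
    and Q_deriv_zero: "\<And>t j. t \<in> {Tm..Tp} \<Longrightarrow> dir_deriv UNIV (axis j 1) (\<lambda>z. Q (t, z)) 0 = 0"
  using admissible unfolding admissible_potentials_def third_degree_zero_def by blast+

lemma r_deriv: "t \<in> {Tm..Tp} \<Longrightarrow> (r has_vector_derivative vel t) (at t within {Tm..Tp})"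
  unfolding velocity_def by (rule C1_on_Icc(1)[OF time(1) C2_on_imp_C1_on[OF C2_r]])

lemma C1_vel: "C1_on {Tm..Tp} vel"
  unfolding velocity_def by (rule C2_on_Icc[OF time(1) C2_r])

lemma vel_deriv: "t \<in> {Tm..Tp} \<Longrightarrow> (vel has_vector_derivative acc t) (at t within {Tm..Tp})"
  unfolding acceleration_def by (rule C1_on_Icc(1)[OF time(1) C1_vel])

lemma trajectory_r: "trajectory r"
proof -
  have "compact (vel ` {Tm..Tp})" "compact (acc ` {Tm..Tp})"
    using C1_on_continuous_on[OF C1_vel] C1_on_Icc(2)[OF time(1) C1_vel]
    by (auto intro!: compact_continuous_image simp: acceleration_def[abs_def])
  then show ?thesis
    unfolding trajectory_def using C2_r compact_imp_bounded by blast
qed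

text \<open>Restriction of a derivative in space-time to a curve that is a graph over the time axis, and to
  a time slice.\<close>

lemma strip_slice_t:
  assumes t: "t \<in> {Tm..Tp}" and F: "(f has_derivative F) (at (t, y) within strip)"
    and h: "(h has_vector_derivative h') (at t within {Tm..Tp})" "h t = y"
  shows "((\<lambda>s. f (s, h s)) has_vector_derivative F (1, h')) (at t within {Tm..Tp})"
proof -
  interpret linear F using F has_derivative_linear by blast
  have "((\<lambda>s. (s, h s)) has_derivative (\<lambda>s. (s, s *\<^sub>R h'))) (at t within {Tm..Tp})"
    using h(1) unfolding has_vector_derivative_def by (intro has_derivative_Pair has_derivative_ident)
  moreover have "(f has_derivative F) (at (t, h t) within (\<lambda>s. (s, h s)) ` {Tm..Tp})"
    using F unfolding h(2) by (rule has_derivative_subset) (auto simp: strip_def)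
  ultimately have "((\<lambda>s. f (s, h s)) has_derivative (\<lambda>s. F (s, s *\<^sub>R h'))) (at t within {Tm..Tp})"
    by (rule has_derivative_in_compose)
  moreover have "F (s, s *\<^sub>R h') = s *\<^sub>R F (1, h')" for s
    using scale[of s "(1, h')"] by simp
  ultimately show ?thesis unfolding has_vector_derivative_def by simp
qed

lemma strip_slice_x:
  assumes t: "t \<in> {Tm..Tp}" and F: "(f has_derivative F) (at (t, y) within strip)"
  shows "((\<lambda>z. f (t, z)) has_derivative (\<lambda>h. F (0, h))) (at y)"
proof -
  have "((\<lambda>z. (t, z)) has_derivative (\<lambda>h. (0, h))) (at y)"
    by (intro has_derivative_Pair has_derivative_ident has_derivative_const)
  moreover have "(f has_derivative F) (at (t, y) within range (\<lambda>z. (t, z)))"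
    using t by (auto intro!: has_derivative_subset[OF F] simp: strip_def)
  ultimately show ?thesis by (rule has_derivative_in_compose)
qed

lemma P3_grad: "t \<in> {Tm..Tp} \<Longrightarrow> ((\<lambda>z. P3 (t, z)) has_derivative (\<lambda>h. Q (t, y) \<bullet> h)) (at y)"
  using has_derivative_grad[OF P3_differentiable, of t y] by (simp add: grad_y_def)

lemma Q_line_continuous: "t \<in> {Tm..Tp} \<Longrightarrow> continuous_on S (\<lambda>s. Q (t, s *\<^sub>R y))"
  by (intro continuous_on_compose2[OF C1_on_continuous_on[OF C1_Q]] continuous_intros)
    (auto simp: strip_iff)

lemma P3_integral:
  assumes t: "t \<in> {Tm..Tp}"
  shows "P3 (t, y) = integral {0..1} (\<lambda>s. y \<bullet> Q (t, s *\<^sub>R y))"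
proof -
  have "((\<lambda>s. P3 (t, s *\<^sub>R y)) has_vector_derivative y \<bullet> Q (t, s *\<^sub>R y)) (at s within {0..1})" for s
    using has_derivative_along_ray[OF P3_grad[OF t, of "s *\<^sub>R y"]]
    unfolding has_vector_derivative_def inner_commute[of y] by (rule has_derivative_at_withinI)
  from fundamental_theorem_of_calculus[where a=0 and b=1, OF _ this]
  show ?thesis using P3_zero[OF t] by (simp add: integral_unique)
qed

text \<open>The time derivative of \<open>P3\<close> at fixed \<open>y\<close>.\<close>

definition P3t :: "spacetime \<Rightarrow> real" where
  "P3t p = integral {0..1} (\<lambda>s. snd p \<bullet> dir_deriv strip (1, 0) Q (fst p, s *\<^sub>R snd p))"

lemma P3_time_deriv:
  assumes t: "t \<in> {Tm..Tp}"
  shows "((\<lambda>s. P3 (s, y)) has_vector_derivative P3t (t, y)) (at t within {Tm..Tp})"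
proof -
  have "((\<lambda>u. integral (cbox 0 1) (\<lambda>s. y \<bullet> Q (u, s *\<^sub>R y))) has_vector_derivative
      integral (cbox 0 1) (\<lambda>s. y \<bullet> dir_deriv strip (1, 0) Q (t, s *\<^sub>R y))) (at t within {Tm..Tp})"
  proof (rule leibniz_rule_vector_derivative[OF _ _ _ t])
    fix u s :: real assume u: "u \<in> {Tm..Tp}"
    have "((\<lambda>u. Q (u, s *\<^sub>R y)) has_vector_derivative dir_deriv strip (1, 0) Q (u, s *\<^sub>R y))
        (at u within {Tm..Tp})"
      using u by (intro strip_slice_t[OF u strip_derivative[OF C1_Q]]) (auto simp: strip_iff)
    then show "((\<lambda>u. y \<bullet> Q (u, s *\<^sub>R y)) has_vector_derivative
        y \<bullet> dir_deriv strip (1, 0) Q (u, s *\<^sub>R y)) (at u within {Tm..Tp})"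
      by (rule bounded_linear.has_vector_derivative[OF bounded_linear_inner_right])
  next
    fix u assume u: "u \<in> {Tm..Tp}"
    show "(\<lambda>s. y \<bullet> Q (u, s *\<^sub>R y)) integrable_on cbox 0 1"
      by (intro integrable_continuous continuous_intros Q_line_continuous[OF u])
  next
    show "continuous_on ({Tm..Tp} \<times> cbox 0 1) (\<lambda>(u, s). y \<bullet> dir_deriv strip (1, 0) Q (u, s *\<^sub>R y))"
      unfolding split_beta
      by (intro continuous_intros continuous_on_compose2[OF strip_continuous[OF C1_Q]])
        (auto simp: strip_iff)
  qed (rule convex_real_interval)
  then have "((\<lambda>u. integral {0..1} (\<lambda>s. y \<bullet> Q (u, s *\<^sub>R y))) has_vector_derivative P3t (t, y))
      (at t within {Tm..Tp})"
    by (simp add: P3t_def)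
  then show ?thesis
    by (rule has_vector_derivative_transform[OF t, rotated]) (rule P3_integral)
qed

text \<open>The function \<open>P3\<close> is jointly differentiable in time and space: its time derivative exists by
  differentiation under the integral sign, and its space derivative \<open>\<nabla>P3\<close> is continuous.\<close>

lemma P3_derivative:
  assumes "p \<in> strip"
  shows "(P3 has_derivative (\<lambda>k. fst k * P3t p + Q p \<bullet> snd k)) (at p within strip)"
proof (cases p)
  case (Pair t y)
  then have t: "t \<in> {Tm..Tp}" using assms by (simp add: strip_iff)
  have "((\<lambda>(t, y). P3 (t, y)) has_derivative
      (\<lambda>(tx, ty). (tx *\<^sub>R P3t (t, y)) + blinfun_apply (blinfun_inner_right (Q (t, y))) ty))
      (at (t, y) within {Tm..Tp} \<times> UNIV)"
  proof (rule has_derivative_partialsI)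
    show "((\<lambda>s. P3 (s, y)) has_derivative (\<lambda>s. s *\<^sub>R P3t (t, y))) (at t within {Tm..Tp})"
      using P3_time_deriv[OF t, of y] unfolding has_vector_derivative_def .
    show "((\<lambda>y. P3 (u, y)) has_derivative blinfun_apply (blinfun_inner_right (Q (u, z)))) (at z within UNIV)"
      if "u \<in> {Tm..Tp}" for u z
      using P3_grad[OF that, of z] by simp
    have c: "continuous_on strip (\<lambda>p. blinfun_inner_right (Q p))"
      by (rule bounded_linear.continuous_on[OF bounded_linear_blinfun_inner_right
            C1_on_continuous_on[OF C1_Q]])
    show "continuous (at (t, y) within {Tm..Tp} \<times> UNIV) (\<lambda>(u, z). blinfun_inner_right (Q (u, z)))"
    proof -
      have "(\<lambda>(u, z). blinfun_inner_right (Q (u, z))) = (\<lambda>p. blinfun_inner_right (Q p))" by auto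
      then show ?thesis
        using c assms unfolding continuous_on_eq_continuous_within strip_def Pair by simp
    qed
  qed auto
  then show ?thesis unfolding strip_def Pair by (simp add: case_prod_unfold)
qed

subsection \<open>Newton's equation in terms of the coefficients of the potentials\<close>

lemma phi2_eq:
  assumes t: "t \<in> {Tm..Tp}"
  shows "phi2 r A1 P3 (t, y) = - (q / (2 * m * c\<^sup>2)) * (norm (A_breve A1 (t, y)))\<^sup>2
     - (1 / c) * (1/2 * (y \<bullet> (time_deriv A1 t *v y)) + P3t (t, y)) + (1 / c) * (vel t \<bullet> Q (t, y))"
proof -
  have "bounded_linear (\<lambda>M::real^3^3. 1/2 * (y \<bullet> (M *v y)))"
    by (intro bounded_linear_compose[OF bounded_linear_mult_right]
        bounded_linear_compose[OF bounded_linear_inner_right]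
        bounded_bilinear.bounded_linear_left[OF bounded_bilinear_matrix_vector])
  from bounded_linear.has_vector_derivative[OF this C1_on_Icc(1)[OF time(1) C1_A1 t]]
  have "((\<lambda>s. P2 A1 (s, y) + P3 (s, y)) has_vector_derivative
      1/2 * (y \<bullet> (time_deriv A1 t *v y)) + P3t (t, y)) (at t within {Tm..Tp})"
    unfolding P2_def by (auto intro!: has_vector_derivative_add P3_time_deriv[OF t])
  from vector_derivative_at_withinI[OF time(1) t this]
  show ?thesis unfolding phi2_def by simp
qed

text \<open>At \<open>y = 0\<close> all first derivatives of \<open>\<nabla>P3\<close> vanish: in space because of the third degree zero,
  in time because \<open>\<nabla>P3(t, 0) = 0\<close> for all \<open>t\<close>.\<close>

lemma Q_derivative_at_center:
  assumes t: "t \<in> {Tm..Tp}"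
  shows "dir_deriv strip h Q (t, 0) = 0"
proof -
  let ?F = "\<lambda>h. dir_deriv strip h Q (t, 0)"
  have F: "(Q has_derivative ?F) (at (t, 0) within strip)"
    using t by (intro strip_derivative[OF C1_Q]) (simp add: strip_iff)
  interpret linear ?F using F has_derivative_linear by blast
  have "((\<lambda>s. Q (s, 0)) has_vector_derivative ?F (1, 0)) (at t within {Tm..Tp})"
    by (rule strip_slice_t[OF t F]) auto
  moreover have "((\<lambda>s. Q (s, 0)) has_vector_derivative 0) (at t within {Tm..Tp})"
    by (rule has_vector_derivative_transform[OF t Q_zero]) auto
  ultimately have 1: "?F (1, 0) = 0"
    using vector_derivative_at_withinI[OF time(1) t] by metis
  have x: "((\<lambda>z. Q (t, z)) has_derivative (\<lambda>h. ?F (0, h))) (at 0)"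
    by (rule strip_slice_x[OF t F])
  have 2: "?F (0, axis j 1) = 0" for j
    using Q_deriv_zero[OF t, of j] frechet_derivative_at[OF x] by (simp add: dir_deriv_def) metis
  have "?F (0, y) = 0" for y
    unfolding has_derivative_sum_Basis[OF x, of y] using 2 by (auto simp: Basis_vec_def intro!: sum.neutral)
  then have "?F (0, snd h) = 0" .
  moreover have "?F (fst h, 0) = 0" using scale[of "fst h" "(1, 0)"] 1 by simp
  moreover have "h = (fst h, 0) + (0, snd h)" by simp
  ultimately show ?thesis using add[of "(fst h, 0)" "(0, snd h)"] by simp
qed

text \<open>The time derivative of \<open>P3\<close> has vanishing gradient at the origin. Since
  \<open>\<partial>\<^sub>t\<nabla>P3\<close> is only continuous, this is read off from \<open>\<partial>\<^sub>tP3(t, y) = y \<bullet> K(y)\<close>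
  with \<open>K\<close> continuous and \<open>K(0) = 0\<close>.\<close>

lemma P3t_derivative_at_center:
  assumes t: "t \<in> {Tm..Tp}"
  shows "((\<lambda>y. P3t (t, y)) has_derivative (\<lambda>_. 0)) (at 0)"
proof -
  let ?K = "\<lambda>y. integral (cbox 0 1) (\<lambda>s. dir_deriv strip (1, 0) Q (t, s *\<^sub>R y))"
  have c: "continuous_on (UNIV \<times> cbox 0 1) (\<lambda>(y, s). dir_deriv strip (1, 0) Q (t, s *\<^sub>R y))"
    unfolding split_beta
    by (intro continuous_on_compose2[OF strip_continuous[OF C1_Q]] continuous_intros)
      (use t in \<open>auto simp: strip_iff\<close>)
  have "continuous_on UNIV ?K" by (rule integral_continuous_on_param[OF c])
  then have "isCont ?K 0" by (simp add: continuous_on_eq_continuous_at)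
  from has_derivative_inner_at_zero[OF this]
  have "((\<lambda>y. y \<bullet> ?K y) has_derivative (\<lambda>_. 0)) (at 0)"
    by (simp add: Q_derivative_at_center[OF t])
  moreover have "P3t (t, y) = y \<bullet> ?K y" for y
  proof -
    have "(\<lambda>s. dir_deriv strip (1, 0) Q (t, s *\<^sub>R y)) integrable_on cbox 0 1"
      by (intro integrable_continuous continuous_on_compose2[OF strip_continuous[OF C1_Q]] continuous_intros)
        (use t in \<open>auto simp: strip_iff\<close>)
    from integral_linear[OF this bounded_linear_inner_right, of y]
    show ?thesis by (simp add: P3t_def o_def)
  qed
  ultimately show ?thesis by simp
qed

lemma has_derivative_A_breve: "((\<lambda>y. A_breve A1 (t, y)) has_derivative (\<lambda>h. A_breve A1 (t, h))) (at y)"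
proof -
  have "bounded_linear (\<lambda>y. A_breve A1 (t, y))"
    unfolding A_breve_def prod.case
    by (intro bounded_linear_compose[OF bounded_linear_scaleR_right]
        bounded_bilinear.bounded_linear_right[OF bounded_bilinear_matrix_vector])
  then show ?thesis by (rule bounded_linear_imp_has_derivative)
qed

text \<open>The part \<open>\<phi>\<^sub>2\<close> of the scalar potential vanishes to first order at the centre and does not
  contribute to the field there.\<close>

lemma phi_gradient_at_center:
  assumes t: "t \<in> {Tm..Tp}"
  shows "((\<lambda>x. \<phi> (t, x)) has_derivative (\<lambda>h. h \<bullet> g t)) (at (r t))"
proof -
  have Q: "((\<lambda>y. Q (t, y)) has_derivative (\<lambda>_. 0)) (at 0)"
    using strip_slice_x[OF t strip_derivative[OF C1_Q], of 0] t
    by (simp add: Q_derivative_at_center strip_iff)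
  have b0: "A_breve A1 (t, 0) = 0" by (simp add: A_breve_def)
  have M: "((\<lambda>y. M *v y) has_derivative (\<lambda>h. M *v h)) F" for M :: "real^3^3" and F
    by (rule bounded_linear_imp_has_derivative[OF
          bounded_bilinear.bounded_linear_right[OF bounded_bilinear_matrix_vector]])
  have q: "((\<lambda>y. (norm (A_breve A1 (t, y)))\<^sup>2) has_derivative (\<lambda>_. 0)) (at 0)"
    unfolding power2_norm_eq_inner
    by (rule has_derivative_eq_rhs, rule has_derivative_inner[OF has_derivative_A_breve has_derivative_A_breve])
       (simp add: b0)
  have q2: "((\<lambda>y. y \<bullet> (M *v y)) has_derivative (\<lambda>_. 0)) (at 0)" for M :: "real^3^3"
    by (rule has_derivative_eq_rhs, rule has_derivative_inner[OF has_derivative_ident M]) simp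
  have "((\<lambda>y. phi2 r A1 P3 (t, y)) has_derivative (\<lambda>_. 0)) (at 0)"
    unfolding phi2_eq[OF t]
    using has_derivative_add[OF has_derivative_diff[OF
          has_derivative_mult_right[OF q, of "- (q / (2 * m * c\<^sup>2))"]
          has_derivative_mult_right[OF has_derivative_add[OF
              has_derivative_mult_right[OF q2[of "time_deriv A1 t"], of "1/2"]
              P3t_derivative_at_center[OF t]], of "1 / c"]]
        has_derivative_mult_right[OF has_derivative_inner_right[OF Q, of "vel t"], of "1 / c"]]
    by simp
  then have "((\<lambda>y. phi2 r A1 P3 (t, y)) has_derivative (\<lambda>_. 0)) (at (r t - r t))" by simp
  moreover have "((\<lambda>x. x - r t) has_derivative (\<lambda>h. h)) (at (r t))"
    by (auto intro!: derivative_eq_intros)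
  ultimately have "((\<lambda>x. phi2 r A1 P3 (t, x - r t)) has_derivative (\<lambda>_. 0)) (at (r t))"
    using has_derivative_compose[where f="\<lambda>x. x - r t" and g="\<lambda>y. phi2 r A1 P3 (t, y)"] by blast
  then show ?thesis
    unfolding phi_eq[OF t] by (auto intro!: derivative_eq_intros)
qed

lemma A_derivatives_at_center:
  assumes t: "t \<in> {Tm..Tp}"
  shows "dx strip j A (t, r t) = A1 t *v axis j 1"
    and "dt strip A (t, r t) = time_deriv A0 t - A1 t *v vel t"
proof -
  let ?F = "\<lambda>h. dir_deriv strip h A (t, r t)"
  have F: "(A has_derivative ?F) (at (t, r t) within strip)"
    using t by (intro strip_derivative[OF C2_on_imp_C1_on[OF C2_A]]) (simp add: strip_iff)
  have FQ: "(Q has_derivative (\<lambda>_. 0)) (at (t, 0) within strip)"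
    using strip_derivative[OF C1_Q, of "(t, 0)"] t by (simp add: strip_iff Q_derivative_at_center)
  have Q: "((\<lambda>x. Q (t, x - r t)) has_derivative (\<lambda>_. 0)) (at (r t))"
  proof -
    have "((\<lambda>y. Q (t, y)) has_derivative (\<lambda>_. 0)) (at (r t - r t))"
      using strip_slice_x[OF t FQ] by simp
    moreover have "((\<lambda>x. x - r t) has_derivative (\<lambda>h. h)) (at (r t))"
      by (auto intro!: derivative_eq_intros)
    ultimately show ?thesis
      using has_derivative_compose[where f="\<lambda>x. x - r t" and g="\<lambda>y. Q (t, y)"] by blast
  qed
  have M: "((\<lambda>x. A1 t *v (x - r t)) has_derivative (\<lambda>h. A1 t *v h)) (at (r t))"
    by (rule bounded_linear.has_derivative[OF
          bounded_bilinear.bounded_linear_right[OF bounded_bilinear_matrix_vector]])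
      (auto intro!: derivative_eq_intros)
  have "((\<lambda>x. A (t, x)) has_derivative (\<lambda>h. A1 t *v h)) (at (r t))"
    unfolding A_eq[OF t] by (auto intro!: derivative_eq_intros Q M)
  from has_derivative_unique[OF strip_slice_x[OF t F] this]
  show "dx strip j A (t, r t) = A1 t *v axis j 1" by (simp add: dx_def fun_eq_iff)
  have y: "((\<lambda>s. r t - r s) has_vector_derivative - vel t) (at t within {Tm..Tp})"
    using has_vector_derivative_diff[OF has_vector_derivative_const r_deriv[OF t]] by simp
  have "((\<lambda>s. A0 s + A1 s *v (r t - r s) + Q (s, r t - r s)) has_vector_derivative
      time_deriv A0 t + (A1 t *v (- vel t) + time_deriv A1 t *v (r t - r t)) + 0) (at t within {Tm..Tp})"
    by (intro has_vector_derivative_add C1_on_Icc(1)[OF time(1) C1_A0 t]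
      bounded_bilinear.has_vector_derivative[OF bounded_bilinear_matrix_vector C1_on_Icc(1)[OF time(1) C1_A1 t] y]
      strip_slice_t[OF t FQ y]) simp
  then have "((\<lambda>s. A (s, r t)) has_vector_derivative
      time_deriv A0 t + (A1 t *v (- vel t) + time_deriv A1 t *v (r t - r t)) + 0) (at t within {Tm..Tp})"
    by (rule has_vector_derivative_transform[OF t, rotated]) (rule A_eq)
  from vector_derivative_at_withinI[OF time(1) t this]
    vector_derivative_at_withinI[OF time(1) t strip_slice_t[OF t F has_vector_derivative_const]]
  show "dt strip A (t, r t) = time_deriv A0 t - A1 t *v vel t"
    by (simp add: dt_def bounded_bilinear.minus_right[OF bounded_bilinear_matrix_vector])
qed

text \<open>Newton's equation as a relation between the coefficients of the potentials. The terms with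
  \<open>A\<^sub>1 v\<close> of the electric and the magnetic force cancel, and \<open>A\<^sub>1\<^sup>T v\<close> remains.\<close>

lemma newton_coefficients:
  assumes t: "t \<in> {Tm..Tp}"
  shows "m *\<^sub>R acc t = - q *\<^sub>R g t - (q / c) *\<^sub>R time_deriv A0 t + (q / c) *\<^sub>R (transpose (A1 t) *v vel t)"
proof -
  let ?F = "\<lambda>h. dir_deriv strip h \<phi> (t, r t)"
  have "(\<phi> has_derivative ?F) (at (t, r t) within strip)"
    using t by (intro strip_derivative[OF C2_on_imp_C1_on[OF C2_phi]]) (simp add: strip_iff)
  from has_derivative_unique[OF strip_slice_x[OF t this] phi_gradient_at_center[OF t]]
  have "dx strip j \<phi> (t, r t) = g t $ j" for j
    by (simp add: dx_def fun_eq_iff inner_axis inner_commute[of "axis j 1"])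
  then have E: "E_field \<phi> A (t, r t) = - g t - (1 / c) *\<^sub>R (time_deriv A0 t - A1 t *v vel t)"
    by (simp add: E_field_def A_derivatives_at_center(2)[OF t] vec_eq_iff)
  have ax: "(A1 t *v axis j 1) $ i = A1 t $ i $ j" for i j
    by (simp add: matrix_vector_mult_basis column_def)
  have B: "cross3 (vel t) (B_field A (t, r t)) = transpose (A1 t) *v vel t - A1 t *v vel t"
    unfolding B_field_def A_derivatives_at_center(1)[OF t] ax
    by (simp add: cross3_def vec_eq_iff forall_3 matrix_vector_mult_def sum_3 transpose_def algebra_simps)
  have "m *\<^sub>R acc t = q *\<^sub>R E_field \<phi> A (t, r t) + (q / c) *\<^sub>R cross3 (vel t) (B_field A (t, r t))"
    using newton t unfolding newton_def by blast
  then show ?thesis unfolding E B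
    by (simp add: algebra_simps)
qed

subsection \<open>Derivatives of the phase and the Hamilton-Jacobi equation\<close>

text \<open>The partial derivatives of the phase \<open>S(t, y)\<close> in the time and the space variable, as
  functions of \<open>(t, y)\<close>, where \<open>y\<close> is the position relative to the trajectory.\<close>

definition phase_t :: "spacetime \<Rightarrow> real" where
  "phase_t = (\<lambda>(t, y). m / chi * (acc t \<bullet> y) + q / (chi * c) * (y \<bullet> time_deriv A0 t)
     + 1 / chi * (1/2 * m * (norm (vel t))\<^sup>2 + q / c * (vel t \<bullet> A0 t) - q * \<phi>0 t)
     + q / (chi * c) * (1/2 * (y \<bullet> (time_deriv A1 t *v y)) + P3t (t, y)))"

definition phase_y :: "spacetime \<Rightarrow> real^3" where
  "phase_y = (\<lambda>(t, y). (m / chi) *\<^sub>R vel t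
     + (q / (chi * c)) *\<^sub>R (A0 t + (1/2) *\<^sub>R (A1 t *v y + transpose (A1 t) *v y) + Q (t, y)))"

lemma time_lift:
  assumes "p \<in> strip" "(h has_vector_derivative h') (at (fst p) within {Tm..Tp})"
  shows "((\<lambda>p. h (fst p)) has_derivative (\<lambda>k. fst k *\<^sub>R h')) (at p within strip)"
proof (rule has_derivative_in_compose[where f=fst and g=h and g'="\<lambda>s. s *\<^sub>R h'"])
  show "(fst has_derivative fst) (at p within strip)"
    by (rule bounded_linear_imp_has_derivative[OF bounded_linear_fst])
  show "(h has_derivative (\<lambda>s. s *\<^sub>R h')) (at (fst p) within fst ` strip)"
    using assms(2) unfolding has_vector_derivative_def
    by (rule has_derivative_subset) (auto simp: strip_def)
qed

lemma snd_has_derivative: "(snd has_derivative snd) F"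
  by (rule bounded_linear_imp_has_derivative[OF bounded_linear_snd])

text \<open>The part \<open>s_p2\<close> of the phase is a potential of \<open>\<nabla>P3\<close> and of the symmetric part of \<open>A\<^sub>1 y\<close>.\<close>

lemma s_p2_eq:
  assumes t: "t \<in> {Tm..Tp}"
  shows "s_p2 A1 P3 (t, y) = q / (chi * c) * (P2 A1 (t, y) + P3 (t, y))"
proof -
  let ?f = "\<lambda>s. y \<bullet> (A1 t *v (s *\<^sub>R y) + Q (t, s *\<^sub>R y))"
  have c: "continuous_on {0..1} ?f"
    by (intro continuous_intros Q_line_continuous[OF t] bounded_bilinear.continuous_on[OF bounded_bilinear_matrix_vector])
  have "(LBINT s=ereal 0..ereal 1. ?f s) = integral {0..1} ?f"
    by (rule interval_integral_eq_integral) (auto intro!: borel_integrable_atLeastAtMost' c)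
  also have "\<dots> = integral {0..1} (\<lambda>s. s * (y \<bullet> (A1 t *v y)) + y \<bullet> Q (t, s *\<^sub>R y))"
    by (simp add: inner_add_right matrix_vector_mult_scaleR)
  also have "\<dots> = integral {0..1} (\<lambda>s. s * (y \<bullet> (A1 t *v y))) + integral {0..1} (\<lambda>s. y \<bullet> Q (t, s *\<^sub>R y))"
    by (intro integral_add integrable_continuous_real continuous_intros Q_line_continuous[OF t])
  also have "integral {0..1} (\<lambda>s. s * (y \<bullet> (A1 t *v y))) = P2 A1 (t, y)"
    using ident_has_integral[of 0 "1::real", THEN integral_unique] by (simp add: P2_def)
  also have "integral {0..1} (\<lambda>s. y \<bullet> Q (t, s *\<^sub>R y)) = P3 (t, y)"
    by (rule P3_integral[OF t, symmetric])
  finally show ?thesis by (simp add: s_p2_def zero_ereal_def one_ereal_def)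
qed

lemma s_p_deriv:
  assumes t: "t \<in> {Tm..Tp}"
  shows "(s_p tstar r \<phi>0 A0 has_vector_derivative
    1 / chi * (1/2 * m * (norm (vel t))\<^sup>2 + q / c * (vel t \<bullet> A0 t) - q * \<phi>0 t)) (at t within {Tm..Tp})"
proof -
  let ?f = "\<lambda>s. 1/2 * m * (norm (vel s))\<^sup>2 + q / c * (vel s \<bullet> A0 s) - q * \<phi>0 s"
  have "continuous_on {Tm..Tp} ?f"
    by (intro continuous_intros C1_on_continuous_on[OF C1_vel] C1_on_continuous_on[OF C1_A0]
        C1_on_continuous_on[OF C1_phi0])
  then have "((\<lambda>u. LBINT y=tstar..u. ?f y) has_vector_derivative ?f t) (at t within {Tm..Tp})"
    using time t by (intro interval_integral_FTC2) auto
  from bounded_linear.has_vector_derivative[OF bounded_linear_mult_right this, of "1 / chi"]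
  show ?thesis by (simp add: s_p_def[abs_def])
qed

lemma phase_derivative:
  assumes p: "p \<in> strip"
  shows "(phase tstar r \<phi>0 A0 A1 P3 has_derivative (\<lambda>k. fst k * phase_t p + phase_y p \<bullet> snd k))
    (at p within strip)"
proof (cases p)
  case (Pair t y)
  then have t: "t \<in> {Tm..Tp}" "fst p = t" "snd p = y" using p by (auto simp: strip_iff)
  let ?f = "\<lambda>p. m / chi * (vel (fst p) \<bullet> snd p) + q / (chi * c) * (snd p \<bullet> A0 (fst p))
     + s_p tstar r \<phi>0 A0 (fst p) + q / (chi * c) * (1/2 * (snd p \<bullet> (A1 (fst p) *v snd p)) + P3 p)"
  let ?sp = "1 / chi * (1/2 * m * (norm (vel t))\<^sup>2 + q / c * (vel t \<bullet> A0 t) - q * \<phi>0 t)"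
  note lift = time_lift[OF p, unfolded t(2)]
  have "(?f has_derivative (\<lambda>k.
      m / chi * (vel (fst p) \<bullet> snd k + (fst k *\<^sub>R acc t) \<bullet> snd p)
      + q / (chi * c) * (snd p \<bullet> (fst k *\<^sub>R time_deriv A0 t) + snd k \<bullet> A0 (fst p))
      + fst k *\<^sub>R ?sp
      + q / (chi * c) * (1/2 * (snd p \<bullet> (A1 (fst p) *v snd k + (fst k *\<^sub>R time_deriv A1 t) *v snd p)
         + snd k \<bullet> (A1 (fst p) *v snd p)) + (fst k * P3t p + Q p \<bullet> snd k)))) (at p within strip)"
    by (intro has_derivative_add has_derivative_mult_right has_derivative_inner snd_has_derivative
        lift[OF vel_deriv[OF t(1)]] lift[OF C1_on_Icc(1)[OF time(1) C1_A0 t(1)]]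
        lift[OF s_p_deriv[OF t(1)]] P3_derivative[OF p]
        bounded_bilinear.FDERIV[OF bounded_bilinear_matrix_vector] lift[OF C1_on_Icc(1)[OF time(1) C1_A1 t(1)]])
  then have "(?f has_derivative (\<lambda>k. fst k * phase_t p + phase_y p \<bullet> snd k)) (at p within strip)"
  proof (rule has_derivative_eq_rhs, intro ext)
    fix k :: spacetime
    have "y \<bullet> (A1 t *v snd k) = (transpose (A1 t) *v y) \<bullet> snd k"
      using inner_transpose[of "snd k" "A1 t" y] by (simp add: inner_commute)
    then show "m / chi * (vel (fst p) \<bullet> snd k + (fst k *\<^sub>R acc t) \<bullet> snd p)
      + q / (chi * c) * (snd p \<bullet> (fst k *\<^sub>R time_deriv A0 t) + snd k \<bullet> A0 (fst p))
      + fst k *\<^sub>R ?sp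
      + q / (chi * c) * (1/2 * (snd p \<bullet> (A1 (fst p) *v snd k + (fst k *\<^sub>R time_deriv A1 t) *v snd p)
         + snd k \<bullet> (A1 (fst p) *v snd p)) + (fst k * P3t p + Q p \<bullet> snd k))
      = fst k * phase_t p + phase_y p \<bullet> snd k"
      unfolding phase_t_def phase_y_def Pair
      by (simp add: inner_add_left inner_add_right inner_commute[of "snd k"] scaleR_matrix_vector_assoc[symmetric]
          ring_distribs del: times_divide_eq_left times_divide_eq_right)
  qed
  moreover have "phase tstar r \<phi>0 A0 A1 P3 p' = ?f p'" if "p' \<in> strip" for p'
    using that by (cases p') (simp add: strip_iff phase_def s_p2_eq P2_def)
  ultimately show ?thesis by (rule has_derivative_transform[OF p, rotated])
qed

text \<open>The passage to coordinates centred at the trajectory.\<close>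

definition shear :: "spacetime \<Rightarrow> spacetime" where
  "shear p = (fst p, snd p - r (fst p))"

text \<open>The local wave vector \<open>\<nabla>S - q/(\<chi>c) A\<close>, as a function of \<open>(t, x)\<close>. It is defined by its
  simplified form \<open>(m/\<chi>) v - q/(\<chi>c) A_breve\<close>; lemma \<open>phase_y_shear\<close> shows that the two agree.\<close>

definition wavevec :: "spacetime \<Rightarrow> real^3" where
  "wavevec p = (m / chi) *\<^sub>R vel (fst p) - (q / (chi * c)) *\<^sub>R A_breve A1 (shear p)"

text \<open>The phase as a function of the position \<open>x\<close> in the laboratory frame.\<close>

definition \<Theta> :: "spacetime \<Rightarrow> real" where
  "\<Theta> p = phase tstar r \<phi>0 A0 A1 P3 (shear p)"

lemma shear_derivative:
  assumes p: "p \<in> strip"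
  shows "(shear has_derivative (\<lambda>k. (fst k, snd k - fst k *\<^sub>R vel (fst p)))) (at p within strip)"
  unfolding shear_def[abs_def]
  by (intro has_derivative_Pair has_derivative_diff snd_has_derivative time_lift[OF p] r_deriv
      bounded_linear_imp_has_derivative[OF bounded_linear_fst]) (use p in \<open>simp add: strip_iff\<close>)

lemma shear_strip: "p \<in> strip \<Longrightarrow> shear p \<in> strip"
  by (simp add: strip_iff shear_def)

lemma phase_y_shear:
  assumes p: "p \<in> strip"
  shows "phase_y (shear p) = wavevec p + (q / (chi * c)) *\<^sub>R A p"
proof (cases p)
  case (Pair t x)
  then have t: "t \<in> {Tm..Tp}" using p by (simp add: strip_iff)
  show ?thesis
    unfolding Pair phase_y_def wavevec_def shear_def A_breve_def
    by (simp add: A_eq[OF t] matrix_vector_mult_diff_rdistrib vec_eq_iff field_simps del: transpose_matrix_vector)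
qed

text \<open>The Hamilton-Jacobi equation of the phase, which is where Newton's equation enters.\<close>

lemma hamilton_jacobi:
  assumes p: "p \<in> strip"
  shows "phase_t (shear p) - phase_y (shear p) \<bullet> vel (fst p)
    = - (q / chi * \<phi> p) - chi / (2 * m) * (norm (wavevec p))\<^sup>2"
proof (cases p)
  case (Pair t x)
  then have t: "t \<in> {Tm..Tp}" using p by (simp add: strip_iff)
  define y where "y = x - r t"
  define b where "b = A_breve A1 (t, y)"
  define K where "K = 1/2 * (y \<bullet> (time_deriv A1 t *v y)) + P3t (t, y)"
  have vb: "vel t \<bullet> b = (vel t \<bullet> (A1 t *v y) - vel t \<bullet> (transpose (A1 t) *v y)) / 2"
    by (simp add: b_def A_breve_def inner_diff_right matrix_vector_mult_diff_rdistrib)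
  have w: "(norm (wavevec p))\<^sup>2 = (m / chi)\<^sup>2 * (vel t \<bullet> vel t)
      - 2 * (m / chi) * (q / (chi * c)) * (vel t \<bullet> b) + (q / (chi * c))\<^sup>2 * (b \<bullet> b)"
    unfolding power2_norm_eq_inner wavevec_def Pair shear_def fst_conv snd_conv
      y_def[symmetric] b_def[symmetric]
    using inner_commute[of b "vel t"]
    by (simp only: inner_diff_left inner_diff_right inner_scaleR_left inner_scaleR_right power2_eq_square)
      (simp only: algebra_simps)
  have "(m *\<^sub>R acc t) \<bullet> y = (- q *\<^sub>R g t - (q / c) *\<^sub>R time_deriv A0 t + (q / c) *\<^sub>R (transpose (A1 t) *v vel t)) \<bullet> y"
    by (simp only: newton_coefficients[OF t])
  moreover have "(transpose (A1 t) *v vel t) \<bullet> y = vel t \<bullet> (A1 t *v y)"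
    by (metis inner_transpose inner_commute)
  ultimately have "m * (acc t \<bullet> y)
      = - q * (y \<bullet> g t) - q / c * (y \<bullet> time_deriv A0 t) + q / c * (vel t \<bullet> (A1 t *v y))"
    by (simp only: inner_add_left inner_diff_left inner_scaleR_left inner_commute[of "g t"]
        inner_commute[of "time_deriv A0 t"])
  then have newton: "acc t \<bullet> y = (- q * (y \<bullet> g t) - q / c * (y \<bullet> time_deriv A0 t) + q / c * (vel t \<bullet> (A1 t *v y))) / m"
    using pos by (simp add: nonzero_eq_divide_eq mult.commute)
  have ph: "\<phi> p = \<phi>0 t + y \<bullet> g t + (- (q / (2 * m * c\<^sup>2)) * (b \<bullet> b) - (1 / c) * K + (1 / c) * (vel t \<bullet> Q (t, y)))"
    unfolding Pair phi_eq[OF t] phi2_eq[OF t] y_def[symmetric] b_def K_def power2_norm_eq_inner ..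
  have pt: "phase_t (shear p) = m / chi * (acc t \<bullet> y) + q / (chi * c) * (y \<bullet> time_deriv A0 t)
     + 1 / chi * (1/2 * m * (vel t \<bullet> vel t) + q / c * (vel t \<bullet> A0 t) - q * \<phi>0 t) + q / (chi * c) * K"
    unfolding phase_t_def Pair shear_def K_def y_def power2_norm_eq_inner by simp
  have py: "phase_y (shear p) \<bullet> vel (fst p) = m / chi * (vel t \<bullet> vel t) + q / (chi * c) *
     (vel t \<bullet> A0 t + (vel t \<bullet> (A1 t *v y) + vel t \<bullet> (transpose (A1 t) *v y)) / 2 + vel t \<bullet> Q (t, y))"
    unfolding inner_commute[of "phase_y (shear p)"] unfolding phase_y_def Pair shear_def y_def
    by (simp add: inner_add_right)
  \<comment> \<open>What remains is an identity of rational functions. With names for the reciprocals of \<open>m\<close>, \<open>chi\<close>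
    and \<open>c\<close> it becomes a polynomial identity.\<close>
  define im ich ic where "im = 1 / m" "ich = 1 / chi" "ic = 1 / c"
  have inv: "m * im = 1" "chi * ich = 1" "c * ic = 1"
    using pos by (simp_all add: im_ich_ic_def)
  have div: "x / m = x * im" "x / chi = x * ich" "x / c = x * ic" "x / (chi * c) = x * ich * ic"
     "x / (2 * m * c\<^sup>2) = x * im * ic * ic / 2" "x / (2 * m) = x * im / 2" for x
    by (simp_all add: im_ich_ic_def power2_eq_square)
  show ?thesis
    unfolding w pt py ph newton vb div using inv by algebra
qed

lemma \<Theta>_derivative:
  assumes p: "p \<in> strip"
  shows "(\<Theta> has_derivative (\<lambda>k. fst k * (- (q / chi * \<phi> p) - chi / (2 * m) * (norm (wavevec p))\<^sup>2)
    + (wavevec p + (q / (chi * c)) *\<^sub>R A p) \<bullet> snd k)) (at p within strip)"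
proof -
  have "(phase tstar r \<phi>0 A0 A1 P3 has_derivative (\<lambda>k. fst k * phase_t (shear p) + phase_y (shear p) \<bullet> snd k))
      (at (shear p) within shear ` strip)"
    by (rule has_derivative_subset[OF phase_derivative[OF shear_strip[OF p]]]) (auto simp: shear_strip)
  from has_derivative_in_compose[OF shear_derivative[OF p] this]
  have "(\<Theta> has_derivative (\<lambda>k. fst k * phase_t (shear p)
      + phase_y (shear p) \<bullet> (snd k - fst k *\<^sub>R vel (fst p)))) (at p within strip)"
    by (simp add: \<Theta>_def[abs_def])
  then show ?thesis
  proof (rule has_derivative_eq_rhs, intro ext)
    fix k :: spacetime
    show "fst k * phase_t (shear p) + phase_y (shear p) \<bullet> (snd k - fst k *\<^sub>R vel (fst p))
      = fst k * (- (q / chi * \<phi> p) - chi / (2 * m) * (norm (wavevec p))\<^sup>2)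
        + (wavevec p + (q / (chi * c)) *\<^sub>R A p) \<bullet> snd k"
      unfolding hamilton_jacobi[OF p, symmetric] phase_y_shear[OF p, symmetric]
      by (simp add: inner_diff_right algebra_simps)
  qed
qed

lemma C1_time_lift: "C1_on {Tm..Tp} h \<Longrightarrow> C1_on strip (\<lambda>p. h (fst p))"
  by (rule C1_on_compose[OF C1_on_linear_id[OF bounded_linear_fst]]) (auto simp: strip_def)

lemma C1_shear: "C1_on strip (\<lambda>p. snd p - r (fst p))"
  by (intro C1_on_diff C1_on_linear_id bounded_linear_snd C1_time_lift C2_on_imp_C1_on[OF C2_r])

lemma C1_wavevec: "C1_on strip wavevec"
  unfolding wavevec_def[abs_def] A_breve_def shear_def prod.case
  by (intro C1_on_diff C1_on_cmult C1_time_lift C1_vel C1_shear C1_A1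
      C1_on_bounded_bilinear[OF bounded_bilinear_matrix_vector] C1_on_bounded_linear[OF bounded_linear_transpose])

text \<open>The wave vector is divergence free, since the matrix in \<open>A_breve\<close> is antisymmetric and so has a
  vanishing diagonal.\<close>

lemma wavevec_divergence:
  assumes p: "p \<in> strip" and K: "(wavevec has_derivative K) (at p within strip)"
  shows "K (0, axis j 1) $ j = 0"
proof (cases p)
  case (Pair t x)
  then have t: "t \<in> {Tm..Tp}" using p by (simp add: strip_iff)
  have "((\<lambda>z. A_breve A1 (t, z - r t)) has_derivative (\<lambda>h. A_breve A1 (t, h))) (at x)"
    by (rule has_derivative_compose[where f="\<lambda>z. z - r t" and g="\<lambda>y. A_breve A1 (t, y)" and f'="\<lambda>h. h",
          OF _ has_derivative_A_breve]) (auto intro!: derivative_eq_intros)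
  then have "((\<lambda>z. wavevec (t, z)) has_derivative (\<lambda>h. - ((q / (chi * c)) *\<^sub>R A_breve A1 (t, h)))) (at x)"
    unfolding wavevec_def shear_def by (auto intro!: derivative_eq_intros)
  from has_derivative_unique[OF strip_slice_x[OF t K[unfolded Pair]] this]
  have "K (0, axis j 1) = - ((q / (chi * c)) *\<^sub>R A_breve A1 (t, axis j 1))" by (simp add: fun_eq_iff)
  then show ?thesis
    by (simp add: A_breve_def matrix_vector_mult_basis column_def transpose_def)
qed

text \<open>The gradient of the amplitude is parallel to \<open>y\<close>, to which \<open>A_breve\<close> is orthogonal.\<close>

lemma grad_profile_wavevec:
  assumes a: "a > 0"
  shows "grad (profile \<psi>1 a) (snd (shear p)) \<bullet> wavevec p
    = m / chi * (grad (profile \<psi>1 a) (snd (shear p)) \<bullet> vel (fst p))"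
proof -
  let ?y = "snd (shear p)"
  have "?y \<bullet> A_breve A1 (shear p) = 0"
    using inner_transpose[of ?y "A1 (fst p)" ?y]
    by (simp add: A_breve_def shear_def matrix_vector_mult_diff_rdistrib inner_diff_right inner_commute)
  then show ?thesis
    using grad_profile_orthogonal[OF form_factor a] by (simp add: wavevec_def inner_diff_right)
qed

section \<open>The wave-corpuscle is an exact solution\<close>

text \<open>The wave-corpuscle of size \<open>a\<close>, its amplitude, and the spatial gradient of the amplitude.\<close>

abbreviation "wave a \<equiv> wave_corpuscle \<psi>1 tstar r \<phi>0 A0 A1 P3 a"
abbreviation "amp a p \<equiv> profile \<psi>1 a (snd (shear p))"
abbreviation "gamp a p \<equiv> grad (profile \<psi>1 a) (snd (shear p))"

lemma wave_eq: "wave a p = cis (\<Theta> p) * of_real (amp a p)"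
  by (cases p) (simp add: wave_corpuscle_def \<Theta>_def shear_def profile_def cis_conv_exp)

lemma cis_derivative:
  assumes "(f has_derivative F) (at p within S)"
  shows "((\<lambda>p. cis (f p)) has_derivative (\<lambda>k. cis (f p) * (\<i> * of_real (F k)))) (at p within S)"
proof -
  have "((\<lambda>p. exp (\<i> * of_real (f p))) has_derivative (\<lambda>k. exp (\<i> * of_real (f p)) * (\<i> * of_real (F k)))) (at p within S)"
    by (rule has_derivative_compose[where g=exp and g'="\<lambda>h. exp (\<i> * of_real (f p)) * h"])
      (auto intro!: has_derivative_mult_right has_derivative_of_real assms
        has_field_derivative_imp_has_derivative[OF DERIV_exp])
  then show ?thesis by (simp add: cis_conv_exp)
qed

lemma amp_derivative:
  assumes a: "a > 0" and p: "p \<in> strip"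
  shows "((\<lambda>p. amp a p) has_derivative (\<lambda>k. gamp a p \<bullet> (snd k - fst k *\<^sub>R vel (fst p)))) (at p within strip)"
proof -
  have "((\<lambda>p. snd (shear p)) has_derivative (\<lambda>k. snd (fst k, snd k - fst k *\<^sub>R vel (fst p)))) (at p within strip)"
    by (rule has_derivative_snd[OF shear_derivative[OF p]])
  from has_derivative_compose[OF this has_derivative_grad[OF profile_differentiable[OF form_factor a]]]
  show ?thesis by simp
qed

text \<open>The derivative of \<open>\<Theta>\<close> at \<open>p\<close> in direction \<open>k\<close>, in the form given by the Hamilton-Jacobi
  equation. It is continuously differentiable in \<open>p\<close>, hence \<open>\<Theta>\<close> is \<open>C\<^sup>2\<close>.\<close>

definition d\<Theta> :: "spacetime \<Rightarrow> spacetime \<Rightarrow> real" where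
  "d\<Theta> p k = fst k * (- (q / chi * \<phi> p) - chi / (2 * m) * (norm (wavevec p))\<^sup>2)
    + (wavevec p + (q / (chi * c)) *\<^sub>R A p) \<bullet> snd k"

lemma cis_\<Theta>_derivative:
  "p \<in> strip \<Longrightarrow> ((\<lambda>p. cis (\<Theta> p)) has_derivative (\<lambda>k. cis (\<Theta> p) * (\<i> * of_real (d\<Theta> p k)))) (at p within strip)"
  unfolding d\<Theta>_def by (rule cis_derivative[OF \<Theta>_derivative])

lemma wave_derivative:
  assumes a: "a > 0" and p: "p \<in> strip"
  shows "(wave a has_derivative (\<lambda>k. cis (\<Theta> p) * of_real (gamp a p \<bullet> (snd k - fst k *\<^sub>R vel (fst p)))
      + cis (\<Theta> p) * (\<i> * of_real (d\<Theta> p k)) * of_real (amp a p))) (at p within strip)"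
  unfolding wave_eq[abs_def]
  by (intro has_derivative_mult cis_\<Theta>_derivative[OF p] has_derivative_of_real amp_derivative[OF a p])

lemma C1_d\<Theta>: "C1_on strip (\<lambda>p. d\<Theta> p k)"
  unfolding d\<Theta>_def power2_norm_eq_inner
  by (intro C1_on_add C1_on_mult C1_on_const C1_on_diff C1_on_minus C1_on_inner C1_on_cmult C1_wavevec
      C2_on_imp_C1_on[OF C2_phi] C2_on_imp_C1_on[OF C2_A])

lemma C1_gamp: "a > 0 \<Longrightarrow> C1_on strip (\<lambda>p. gamp a p)"
  unfolding shear_def snd_conv
  by (rule C1_on_compose[OF C1_shear C1_on_grad_profile[OF form_factor]]) auto

lemma C1_amp:
  assumes a: "a > 0" shows "C1_on strip (\<lambda>p. amp a p)"
proof (rule C1_onI[OF amp_derivative[OF a]])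
  fix h :: spacetime
  show "continuous_on strip (\<lambda>p. gamp a p \<bullet> (snd h - fst h *\<^sub>R vel (fst p)))"
    by (intro continuous_intros C1_on_continuous_on[OF C1_gamp[OF a]] C1_on_continuous_on[OF C1_time_lift[OF C1_vel]])
qed

lemma C1_cis_\<Theta>: "C1_on strip (\<lambda>p. cis (\<Theta> p))"
proof (rule C1_onI[OF cis_\<Theta>_derivative])
  fix h
  have "continuous_on strip (\<lambda>p. cis (\<Theta> p))"
    using cis_\<Theta>_derivative by (rule has_derivative_continuous_on)
  then show "continuous_on strip (\<lambda>p. cis (\<Theta> p) * (\<i> * of_real (d\<Theta> p h)))"
    by (rule continuous_on_mult)
      (intro continuous_on_mult continuous_on_const continuous_on_of_real C1_on_continuous_on[OF C1_d\<Theta>])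
qed

lemma C1_of_real: "C1_on S f \<Longrightarrow> C1_on S (\<lambda>p. complex_of_real (f p))" for f :: "spacetime \<Rightarrow> real"
  by (rule C1_on_bounded_linear[OF bounded_linear_of_real])

lemma C2_wave:
  assumes a: "a > 0"
  shows "C2_on strip (wave a)"
proof (rule C2_onI[OF wave_derivative[OF a]])
  fix h
  show "C1_on strip (\<lambda>p. cis (\<Theta> p) * of_real (gamp a p \<bullet> (snd h - fst h *\<^sub>R vel (fst p)))
      + cis (\<Theta> p) * (\<i> * of_real (d\<Theta> p h)) * of_real (amp a p))"
    by (intro C1_on_add C1_on_mult C1_cis_\<Theta> C1_of_real C1_on_const C1_d\<Theta> C1_on_inner C1_on_diff
        C1_on_cmult C1_gamp[OF a] C1_amp[OF a] C1_time_lift C1_vel)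
qed

lemma tube_iff: "p \<in> tube r R \<longleftrightarrow> fst p \<in> {Tm..Tp} \<and> norm (snd (shear p)) \<le> R"
  by (cases p) (simp add: tube_def shear_def)

lemma tube_strip: "tube r R \<subseteq> strip"
  by (auto simp: tube_def strip_def)

lemma tube_dir_deriv:
  assumes R: "R > 0" and p: "p \<in> tube r R" and F: "(f has_derivative F) (at p within tube r R)"
  shows "dir_deriv (tube r R) b f p = F b"
  using p by (intro dir_derivI_tube[OF time(1) R p r_deriv F]) (simp add: tube_iff)

lemma cov_x_wave:
  assumes a: "a > 0" and R: "R > 0" and p: "p \<in> tube r R"
  shows "cov_x (tube r R) A j (wave a) p
    = cis (\<Theta> p) * (of_real (gamp a p $ j) + \<i> * of_real (amp a p * wavevec p $ j))"
proof -
  have ps: "p \<in> strip" using p tube_strip by blast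
  note D = has_derivative_subset[OF wave_derivative[OF a ps] tube_strip]
  show ?thesis
    unfolding cov_x_def dx_def tube_dir_deriv[OF R p D] wave_eq d\<Theta>_def
    by (simp add: inner_axis algebra_simps)
qed

lemma cov_t_wave:
  assumes a: "a > 0" and R: "R > 0" and p: "p \<in> tube r R"
  shows "cov_t (tube r R) \<phi> (wave a) p = cis (\<Theta> p) * (of_real (- (gamp a p \<bullet> vel (fst p)))
    - \<i> * of_real (chi / (2 * m) * (norm (wavevec p))\<^sup>2 * amp a p))"
proof -
  have ps: "p \<in> strip" using p tube_strip by blast
  note D = has_derivative_subset[OF wave_derivative[OF a ps] tube_strip]
  show ?thesis
    unfolding cov_t_def dt_def tube_dir_deriv[OF R p D] wave_eq d\<Theta>_def
    by (simp add: algebra_simps)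
qed

lemma cov_conj_wave:
  assumes a: "a > 0" and R: "R > 0" and p: "p \<in> tube r R"
  shows "cov_x_conj (tube r R) A j (\<lambda>z. cnj (wave a z)) p = cnj (cov_x (tube r R) A j (wave a) p)"
    and "cov_t_conj (tube r R) \<phi> (\<lambda>z. cnj (wave a z)) p = cnj (cov_t (tube r R) \<phi> (wave a) p)"
proof -
  have ps: "p \<in> strip" using p tube_strip by blast
  note D = has_derivative_subset[OF wave_derivative[OF a ps] tube_strip]
  note D' = bounded_linear.has_derivative[OF bounded_linear_cnj D]
  show "cov_x_conj (tube r R) A j (\<lambda>z. cnj (wave a z)) p = cnj (cov_x (tube r R) A j (wave a) p)"
    unfolding cov_x_conj_def cov_x_def dx_def tube_dir_deriv[OF R p D] tube_dir_deriv[OF R p D']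
    by simp
  show "cov_t_conj (tube r R) \<phi> (\<lambda>z. cnj (wave a z)) p = cnj (cov_t (tube r R) \<phi> (wave a) p)"
    unfolding cov_t_conj_def cov_t_def dt_def tube_dir_deriv[OF R p D] tube_dir_deriv[OF R p D']
    by simp
qed

lemma cov_x_cov_x_wave:
  assumes a: "a > 0" and R: "R > 0" and p: "p \<in> tube r R"
    and H: "(grad (profile \<psi>1 a) has_derivative H) (at (snd (shear p)))"
  shows "cov_x (tube r R) A j (cov_x (tube r R) A j (wave a)) p
    = cis (\<Theta> p) * (of_real (H (axis j 1) $ j) + 2 * \<i> * of_real (gamp a p $ j * wavevec p $ j)
        - of_real (amp a p * (wavevec p $ j)\<^sup>2))"
proof -
  let ?D = "tube r R"
  let ?z = "\<lambda>p. of_real (gamp a p $ j) + \<i> * of_real (amp a p * wavevec p $ j)"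
  have ps: "p \<in> strip" using p tube_strip by blast
  obtain K where K: "(wavevec has_derivative K) (at p within strip)"
    using C1_onE[OF C1_wavevec] ps by metis
  have "((\<lambda>p. snd (shear p)) has_derivative (\<lambda>k. snd (fst k, snd k - fst k *\<^sub>R vel (fst p)))) (at p within strip)"
    by (rule has_derivative_snd[OF shear_derivative[OF ps]])
  from has_derivative_compose[OF this H]
  have g: "((\<lambda>p. gamp a p) has_derivative (\<lambda>k. H (snd k - fst k *\<^sub>R vel (fst p)))) (at p within strip)" by simp
  have "((\<lambda>p. cis (\<Theta> p) * ?z p) has_derivative (\<lambda>k.
      cis (\<Theta> p) * (of_real (H (snd k - fst k *\<^sub>R vel (fst p)) $ j)
        + \<i> * of_real (amp a p * K k $ j + gamp a p \<bullet> (snd k - fst k *\<^sub>R vel (fst p)) * wavevec p $ j))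
      + cis (\<Theta> p) * (\<i> * of_real (d\<Theta> p k)) * ?z p)) (at p within strip)"
    by (intro has_derivative_mult has_derivative_mult_right has_derivative_add cis_\<Theta>_derivative[OF ps]
        has_derivative_of_real amp_derivative[OF a ps] bounded_linear.has_derivative[OF bounded_linear_vec_nth] g K)
  from has_derivative_subset[OF this tube_strip[of R]]
  have F: "(cov_x ?D A j (wave a) has_derivative (\<lambda>k.
      cis (\<Theta> p) * (of_real (H (snd k - fst k *\<^sub>R vel (fst p)) $ j)
        + \<i> * of_real (amp a p * K k $ j + gamp a p \<bullet> (snd k - fst k *\<^sub>R vel (fst p)) * wavevec p $ j))
      + cis (\<Theta> p) * (\<i> * of_real (d\<Theta> p k)) * ?z p)) (at p within ?D)"
    by (rule has_derivative_transform[OF p, rotated]) (rule cov_x_wave[OF a R])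
  show ?thesis
    unfolding cov_x_def[of ?D A j "cov_x ?D A j (wave a)"] dx_def tube_dir_deriv[OF R p F]
      cov_x_wave[OF a R p] d\<Theta>_def
    by (simp add: inner_axis wavevec_divergence[OF ps K] algebra_simps power2_eq_square)
qed

lemma wave_solves_NLS:
  assumes a: "a > 0" and R: "R > 0"
  shows "solves_NLS (tube r R) \<phi> A a (wave a)"
  unfolding solves_NLS_def
proof
  fix p assume p: "p \<in> tube r R"
  let ?W = "wavevec p" and ?g = "gamp a p"
  obtain H where H: "(grad (profile \<psi>1 a) has_derivative H) (at (snd (shear p)))"
    using C1_onE[OF C1_on_grad_profile[OF form_factor a]] by (metis UNIV_I)
  have amp: "cmod (wave a p) = amp a p"
    using profile_pos[OF form_factor a] by (simp add: wave_eq norm_mult less_imp_le)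
  have "(\<Sum>j\<in>UNIV. cov_x (tube r R) A j (cov_x (tube r R) A j (wave a)) p)
      = cis (\<Theta> p) * (of_real (\<Sum>j\<in>UNIV. H (axis j 1) $ j) + 2 * \<i> * of_real (?g \<bullet> ?W)
        - of_real (amp a p * (norm ?W)\<^sup>2))"
    unfolding cov_x_cov_x_wave[OF a R p H] power2_norm_eq_inner
    by (simp add: inner_vec_def sum_distrib_left sum.distrib sum_subtractf power2_eq_square
        flip: sum_distrib_left)
  also have "\<dots> = cis (\<Theta> p) * (of_real (Ga' a ((amp a p)\<^sup>2) * amp a p)
      + 2 * \<i> * of_real (m / chi * (?g \<bullet> vel (fst p))) - of_real (amp a p * (norm ?W)\<^sup>2))"
    by (simp only: profile_equation[OF form_factor a H] grad_profile_wavevec[OF a])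
  finally show "\<i> * cov_t (tube r R) \<phi> (wave a) p = of_real (chi / (2 * m)) *
      (- (\<Sum>j\<in>UNIV. cov_x (tube r R) A j (cov_x (tube r R) A j (wave a)) p)
       + of_real (Ga' a ((cmod (wave a p))\<^sup>2)) * wave a p)"
    unfolding cov_t_wave[OF a R p] amp using pos
    by (simp add: wave_eq field_simps)
qed

section \<open>Densities of the wave-corpuscle\<close>

lemma rho_wave: "rho (wave a) p = q * (amp a p)\<^sup>2"
  by (simp add: rho_def wave_eq norm_mult)

lemma mom_wave:
  assumes a: "a > 0" and R: "R > 0" and p: "p \<in> tube r R"
  shows "mom (tube r R) A (wave a) p = (chi * (amp a p)\<^sup>2) *\<^sub>R wavevec p"
proof -
  have e: "cnj (wave a p) * cov_x (tube r R) A j (wave a) p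
      = of_real (amp a p) * (of_real (gamp a p $ j) + \<i> * of_real (amp a p * wavevec p $ j))" for j
    unfolding cov_x_wave[OF a R p] wave_eq using cis_mult[of "- \<Theta> p" "\<Theta> p"]
    by (simp add: cis_cnj algebra_simps)
  have Re: "Re (\<i> * of_real k * (w * cnj z - cnj w * z)) = 2 * k * Im (cnj w * z)" for k w z
    by (simp add: algebra_simps)
  show ?thesis
    unfolding mom_def cov_conj_wave[OF a R p] Re unfolding e
    by (simp add: vec_eq_iff power2_eq_square)
qed

lemma cur_wave:
  assumes a: "a > 0" and R: "R > 0" and p: "p \<in> tube r R"
  shows "cur (tube r R) A (wave a) p = (q * chi / m * (amp a p)\<^sup>2) *\<^sub>R wavevec p"
proof -
  have "Re (- (\<i> * of_real (q * k / (2 * m))) * (z - z')) = q / m * Re (\<i> * of_real (k / 2) * (z' - z))" for k z z'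
    using pos by (simp add: field_simps)
  then have "cur (tube r R) A (wave a) p = (q / m) *\<^sub>R mom (tube r R) A (wave a) p"
    unfolding cur_def mom_def
    by (simp only: vec_eq_iff vec_lambda_beta vector_scaleR_component real_scaleR_def simp_thms)
  then show ?thesis unfolding mom_wave[OF assms] by (simp add: mult.assoc)
qed

text \<open>By the Hamilton-Jacobi equation the term of the stress tensor with the covariant time derivative
  is \<open>\<chi>\<^sup>2/(2m) u\<^sup>2 |W|\<^sup>2\<close>, so all its entries are controlled by the three quantities below.\<close>

lemma abs_stress_wave_le:
  assumes a: "a > 0" and R: "R > 0" and p: "p \<in> tube r R"
  shows "\<bar>stress (tube r R) \<phi> A a (wave a) i j p\<bar> \<le> 2 * chi\<^sup>2 / m *
    ((norm (gamp a p))\<^sup>2 + (amp a p)\<^sup>2 * (norm (wavevec p))\<^sup>2 + \<bar>Ga a ((amp a p)\<^sup>2)\<bar>)"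
proof -
  let ?D = "tube r R" let ?g = "gamp a p" and ?u = "amp a p" and ?W = "wavevec p"
  let ?k = "chi\<^sup>2 / m" let ?X = "(norm ?g)\<^sup>2 + ?u\<^sup>2 * (norm ?W)\<^sup>2" let ?G = "Ga a (?u\<^sup>2)"
  have k: "?k \<ge> 0" using pos by simp
  have cc: "cis (\<Theta> p) * cnj (cis (\<Theta> p)) = 1" by (simp add: cis_cnj cis_mult)
  have cov2: "cov_x ?D A i (wave a) p * cnj (cov_x ?D A j (wave a) p)
    = (of_real (?g $ i) + \<i> * of_real (?u * ?W $ i)) * (of_real (?g $ j) - \<i> * of_real (?u * ?W $ j))" for i j
  proof -
    have e: "cis (\<Theta> p) * z * cnj (cis (\<Theta> p) * w) = z * cnj w" for z w
    proof -
      have "cis (\<Theta> p) * z * cnj (cis (\<Theta> p) * w) = (cis (\<Theta> p) * cnj (cis (\<Theta> p))) * (z * cnj w)"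
        by (simp only: complex_cnj_mult mult_ac)
      then show ?thesis unfolding cc by simp
    qed
    show ?thesis unfolding cov_x_wave[OF a R p] e by simp
  qed
  have Re2: "Re (cov_x ?D A i (wave a) p * cnj (cov_x ?D A j (wave a) p)) = ?g $ i * ?g $ j + ?u\<^sup>2 * (?W $ i * ?W $ j)" for i j
    unfolding cov2 by (simp add: power2_eq_square)
  have prod: "\<bar>?g $ i * ?g $ j + ?u\<^sup>2 * (?W $ i * ?W $ j)\<bar> \<le> ?X" for i j
  proof -
    have "\<bar>z $ i * z $ j\<bar> \<le> (norm z)\<^sup>2" for i j and z :: "real^3"
      unfolding abs_mult power2_eq_square by (intro mult_mono component_le_norm_cart) auto
    from this[of ?g i j] mult_left_mono[OF this[of ?W i j], of "?u\<^sup>2"]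
      abs_triangle_ineq[of "?g $ i * ?g $ j" "?u\<^sup>2 * (?W $ i * ?W $ j)"]
    show ?thesis by (simp add: abs_mult)
  qed
  have kprod: "\<bar>?k * (?g $ i * ?g $ j + ?u\<^sup>2 * (?W $ i * ?W $ j))\<bar> \<le> ?k * ?X" for i j
    unfolding abs_mult[of ?k] abs_of_nonneg[OF k] by (rule mult_left_mono[OF prod k])
  show ?thesis
  proof (cases "i = j")
    case False
    have "stress ?D \<phi> A a (wave a) i j p = ?k * (?g $ i * ?g $ j + ?u\<^sup>2 * (?W $ i * ?W $ j))"
    proof -
      have Re_add: "Re (of_real k * (z + w)) = k * (Re z + Re w)" for k z w by simp
      show ?thesis
        using False pos unfolding stress_def Let_def cov_conj_wave[OF a R p] Re_add Re2
        by (simp add: field_simps)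
    qed
    then have "\<bar>stress ?D \<phi> A a (wave a) i j p\<bar> \<le> ?k * ?X"
      using kprod by simp
    also have "\<dots> \<le> 2 * ?k * (?X + \<bar>?G\<bar>)"
      using k mult_nonneg_nonneg[OF k, of ?X] mult_nonneg_nonneg[OF k, of "\<bar>?G\<bar>"]
      by (simp add: distrib_left)
    finally show ?thesis by simp
  next
    case True
    have energy: "energy ?D A a (wave a) p = ?k / 2 * (?X + ?G)"
    proof -
      have "(cmod (cov_x ?D A j (wave a) p))\<^sup>2 = (?g $ j)\<^sup>2 + ?u\<^sup>2 * (?W $ j)\<^sup>2" for j
        unfolding cov_x_wave[OF a R p]
        by (simp add: norm_mult cmod_power2 power_mult_distrib)
      moreover have "(norm z)\<^sup>2 = (\<Sum>j\<in>UNIV. (z $ j)\<^sup>2)" for z :: "real^3"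
        by (simp add: norm_vec_def L2_set_def sum_nonneg)
      moreover have "(cmod (wave a p))\<^sup>2 = ?u\<^sup>2" by (simp add: wave_eq norm_mult)
      ultimately show ?thesis
        unfolding energy_def by (simp add: sum.distrib sum_distrib_left)
    qed
    have e: "cnj (wave a p) * cov_t ?D \<phi> (wave a) p
        = of_real ?u * (of_real (- (?g \<bullet> vel (fst p))) - \<i> * of_real (chi / (2 * m) * (norm ?W)\<^sup>2 * ?u))"
    proof -
      have "cnj (cis (\<Theta> p) * of_real ?u) * (cis (\<Theta> p) * z)
          = (cis (\<Theta> p) * cnj (cis (\<Theta> p))) * (of_real ?u * z)" for z
        by (simp only: complex_cnj_mult complex_cnj_complex_of_real mult_ac)
      note this[unfolded cc mult_1]
      then show ?thesis unfolding cov_t_wave[OF a R p] wave_eq .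
    qed
    have Re: "Re (\<i> * of_real k * (cnj w * z - w * cnj z)) = - 2 * k * Im (cnj w * z)" for k w z
      by (simp add: algebra_simps)
    have time: "Re (\<i> * of_real (chi / 2) * (cnj (wave a p) * cov_t ?D \<phi> (wave a) p
        - wave a p * cnj (cov_t ?D \<phi> (wave a) p))) = ?k / 2 * (?u\<^sup>2 * (norm ?W)\<^sup>2)"
      unfolding Re unfolding e by (simp add: power2_eq_square mult_ac)
    have stress: "stress ?D \<phi> A a (wave a) i j p = - (?k / 2 * (?X + ?G))
        + ?k * (?g $ i * ?g $ i + ?u\<^sup>2 * (?W $ i * ?W $ i)) + ?k / 2 * (?u\<^sup>2 * (norm ?W)\<^sup>2)"
    proof -
      have Re_add: "Re (of_real k * z + w) = k * Re z + Re w" for k z w by simp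
      show ?thesis
        unfolding stress_def Let_def cov_conj_wave[OF a R p] Re_add Re2 time energy using True by simp
    qed
    have k2: "?k / 2 \<ge> 0" using k by simp
    have G: "\<bar>?k / 2 * (?X + ?G)\<bar> \<le> ?k / 2 * (?X + \<bar>?G\<bar>)"
      unfolding abs_mult[of "?k / 2"] abs_of_nonneg[OF k2]
      by (rule mult_left_mono[OF _ k2]) (use abs_triangle_ineq[of ?X ?G] in simp)
    have W: "\<bar>?k / 2 * (?u\<^sup>2 * (norm ?W)\<^sup>2)\<bar> \<le> ?k / 2 * ?X"
      unfolding abs_mult[of "?k / 2"] abs_of_nonneg[OF k2] by (rule mult_left_mono[OF _ k2]) simp
    have tri: "\<bar>- x + y + z\<bar> \<le> \<bar>x\<bar> + \<bar>y\<bar> + \<bar>z\<bar>" for x y z :: real by linarith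
    have "\<bar>stress ?D \<phi> A a (wave a) i j p\<bar> \<le> ?k / 2 * (?X + \<bar>?G\<bar>) + ?k * ?X + ?k / 2 * ?X"
      unfolding stress by (rule order_trans[OF tri add_mono[OF add_mono]], rule G, rule kprod, rule W)
    also have "\<dots> = ?k * (2 * ?X + \<bar>?G\<bar> / 2)"
    proof -
      have "k / 2 * (x + g) + k * x + k / 2 * x = k * (2 * x + g / 2)" for k x g :: real
        by (simp add: field_simps)
      then show ?thesis .
    qed
    also have "\<dots> \<le> ?k * (2 * (?X + \<bar>?G\<bar>))"
      by (rule mult_left_mono[OF _ k]) simp
    finally show ?thesis by (simp only: times_divide_eq_left times_divide_eq_right mult_ac)
  qed
qed

end

section \<open>Estimates uniform along the sequence\<close>

text \<open>A sequence of sizes and radii as in the statement of the theorem.\<close>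

locale corpuscle_sequence = corpuscle +
  fixes a R :: "nat \<Rightarrow> real"
  assumes decay: "\<exists>C. \<forall>\<^sub>F \<theta> in at_top. \<theta>\<^sup>2 * \<bar>\<psi>1 \<theta>\<bar> \<le> C"
      "\<exists>C. \<forall>\<^sub>F \<theta> in at_top. \<theta>^3 * \<bar>deriv \<psi>1 \<theta>\<bar> \<le> C"
    and a_pos: "\<And>n. a n > 0" and R_pos: "\<And>n. R n > 0"
    and a_lim: "a \<longlonglongrightarrow> 0" and R_lim: "R \<longlonglongrightarrow> 0"
    and ratio: "(\<lambda>n. a n / R n ^ 4) \<longlonglongrightarrow> 0"
begin

lemma R_over_a: "filterlim (\<lambda>n. R n / a n) at_top sequentially"
proof -
  have "(\<lambda>n. a n / R n ^ 4 * R n ^ 3) \<longlonglongrightarrow> 0 * 0 ^ 3"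
    by (intro tendsto_mult tendsto_power ratio R_lim)
  moreover have "a n / R n ^ 4 * R n ^ 3 = a n / R n" for n
    using R_pos[of n] by (simp add: field_simps eval_nat_numeral)
  ultimately have "(\<lambda>n. a n / R n) \<longlonglongrightarrow> 0" by simp
  then have "filterlim (\<lambda>n. inverse (a n / R n)) at_top sequentially"
    by (rule filterlim_inverse_at_top) (use a_pos R_pos in simp)
  then show ?thesis by simp
qed

text \<open>A bound of all radii, so that all tubes lie in one compact tube.\<close>

definition Rmax :: real where "Rmax = (SUP n. R n)"

lemma R_le_Rmax: "R n \<le> Rmax"
  unfolding Rmax_def
  using convergent_imp_Bseq[OF convergentI[OF R_lim]]
  by (intro cSUP_upper) (auto dest: Bseq_bdd_above)

lemma tube_subset_Rmax: "tube r (R n) \<subseteq> tube r Rmax"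
  using R_le_Rmax[of n] by (auto simp: tube_def intro: order_trans)

lemma compact_tube: "compact (tube r s)"
proof -
  have "tube r s = (\<lambda>p. (fst p, snd p + r (fst p))) ` ({Tm..Tp} \<times> cball 0 s)"
  proof
    show "tube r s \<subseteq> (\<lambda>p. (fst p, snd p + r (fst p))) ` ({Tm..Tp} \<times> cball 0 s)"
    proof
      fix p assume "p \<in> tube r s"
      then show "p \<in> (\<lambda>p. (fst p, snd p + r (fst p))) ` ({Tm..Tp} \<times> cball 0 s)"
        by (intro image_eqI[of _ _ "shear p"]) (auto simp: tube_iff shear_def)
    qed
  qed (auto simp: tube_def)
  moreover have "continuous_on ({Tm..Tp} \<times> cball 0 s) (\<lambda>p. (fst p, snd p + r (fst p)))"
    by (intro continuous_intros continuous_on_compose2[OF C1_on_continuous_on[OF C2_on_imp_C1_on[OF C2_r]]])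
      auto
  ultimately show ?thesis by (simp add: compact_continuous_image compact_Times)
qed

lemma wavevec_bound: obtains W where "W \<ge> 0" "\<And>n p. p \<in> tube r (R n) \<Longrightarrow> norm (wavevec p) \<le> W"
proof -
  have "continuous_on (tube r Rmax) wavevec"
    by (rule continuous_on_subset[OF C1_on_continuous_on[OF C1_wavevec] tube_strip])
  from compact_imp_bounded[OF compact_continuous_image[OF this compact_tube]]
  obtain W where W: "\<And>p. p \<in> tube r Rmax \<Longrightarrow> norm (wavevec p) \<le> W"
    unfolding bounded_iff by blast
  have "norm (wavevec p) \<le> \<bar>W\<bar>" if "p \<in> tube r (R n)" for n p
    using W[OF subsetD[OF tube_subset_Rmax that]] by linarith
  then show ?thesis by (intro that[of "\<bar>W\<bar>"]) auto
qed

lemma vel_bound: obtains V where "V \<ge> 0" "\<And>t. t \<in> {Tm..Tp} \<Longrightarrow> norm (vel t) \<le> V"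
proof -
  have "bounded (vel ` {Tm..Tp})" using trajectory_r by (simp add: trajectory_def)
  then obtain V where V: "\<And>t. t \<in> {Tm..Tp} \<Longrightarrow> norm (vel t) \<le> V"
    unfolding bounded_iff by blast
  show ?thesis by (rule that[of "\<bar>V\<bar>"]) (use V in \<open>force intro: order_trans[OF _ abs_ge_self]\<close>)+
qed

lemma uniformly_close:
  fixes F :: "spacetime \<Rightarrow> 'b::real_normed_vector"
  assumes F: "continuous_on strip F" and "\<epsilon> > 0"
  shows "\<forall>\<^sub>F n in sequentially. \<forall>s\<in>{Tm..Tp}. \<forall>x\<in>cball (r s) (R n). norm (F (s, x) - F (s, r s)) \<le> \<epsilon>"
proof -
  have "uniformly_continuous_on (tube r Rmax) F"
    by (intro compact_uniformly_continuous compact_tube continuous_on_subset[OF F tube_strip])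
  then obtain d where d: "d > 0"
      "\<And>p p'. p \<in> tube r Rmax \<Longrightarrow> p' \<in> tube r Rmax \<Longrightarrow> dist p' p < d \<Longrightarrow> dist (F p') (F p) < \<epsilon>"
    using \<open>\<epsilon> > 0\<close> unfolding uniformly_continuous_on_def by metis
  have "\<forall>\<^sub>F n in sequentially. R n < d" using order_tendstoD(2)[OF R_lim d(1)] .
  then show ?thesis
  proof eventually_elim
    case (elim n)
    have "norm (F (s, x) - F (s, r s)) \<le> \<epsilon>" if s: "s \<in> {Tm..Tp}" and x: "x \<in> cball (r s) (R n)" for s x
    proof -
      have n: "norm (x - r s) \<le> R n" using x by (simp add: dist_norm norm_minus_commute)
      have "(s, x) \<in> tube r Rmax" "(s, r s) \<in> tube r Rmax"
        using s n R_le_Rmax[of n] R_pos[of n] by (auto simp: tube_def)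
      moreover have "dist (s, x) (s, r s) < d" using n elim by (simp add: dist_Pair_Pair dist_norm)
      ultimately show ?thesis using d(2)[of "(s, r s)" "(s, x)"] by (simp add: dist_norm)
    qed
    then show ?case by blast
  qed
qed

lemma E_field_continuous: "continuous_on strip (E_field \<phi> A)"
  unfolding E_field_def[abs_def] dx_def dt_def
  by (intro continuous_intros continuous_on_vec_lambda strip_continuous C2_on_imp_C1_on C2_phi C2_A)

lemma B_field_continuous: "continuous_on strip (B_field A)"
proof -
  have v: "vector [x, y, z] = x *\<^sub>R axis 1 1 + y *\<^sub>R axis 2 1 + z *\<^sub>R (axis 3 1 :: real^3)" for x y z :: real
    by (simp add: vec_eq_iff forall_3 axis_def)
  show ?thesis
    unfolding B_field_def[abs_def] dx_def v
    by (intro continuous_intros strip_continuous C2_on_imp_C1_on C2_A)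
qed

subsection \<open>Charge\<close>

text \<open>The integral of the squared form factor, which is the limit of the charge up to the factor \<open>q\<close>.\<close>

abbreviation "\<nu> \<equiv> (LINT x|lborel. (\<psi>1 (norm (x::real^3)))\<^sup>2)"

lemma amp_at: "amp s (t, x) = profile \<psi>1 s (x - r t)"
  by (simp add: shear_def)

lemma amp_square_integrable:
  assumes "s > 0"
  shows "set_integrable lborel (cball z \<rho>) (\<lambda>x. (amp s (t, x))\<^sup>2)"
  unfolding amp_at
  by (intro set_integrable_continuous_cball continuous_intros
      continuous_on_compose2[OF profile_continuous[OF form_factor assms, of UNIV]]) auto

lemma amp_square_integral_le:
  assumes "s > 0"
  shows "(LINT x:cball (r t) \<rho>|lborel. (amp s (t, x))\<^sup>2) \<le> \<nu>"
  unfolding amp_at profile_charge[OF form_factor assms] by (rule form_factor_charge_le[OF form_factor])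

lemma total_charge_wave:
  assumes "s > 0"
  shows "total_charge r \<rho> (wave s) t = q * (LINT x:cball (0::real^3) (\<rho> / s)|lborel. (\<psi>1 (norm x))\<^sup>2)"
  unfolding total_charge_def rho_wave amp_at
  by (simp add: profile_charge[OF form_factor assms])

lemma total_charge_tendsto: "(\<lambda>n. total_charge r (R n) (wave (a n)) t) \<longlonglongrightarrow> q * \<nu>"
  unfolding total_charge_wave[OF a_pos]
  by (intro tendsto_intros form_factor_charge_tendsto[OF form_factor] R_over_a)

lemma total_charge_bounds:
  shows "total_charge r (R n) (wave (a n)) t \<le> q * \<nu>"
    and "\<forall>\<^sub>F n in sequentially. \<forall>t. q * \<nu> / 2 \<le> total_charge r (R n) (wave (a n)) t"
proof -
  show "total_charge r (R n) (wave (a n)) t \<le> q * \<nu>"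
    unfolding total_charge_wave[OF a_pos]
    using pos by (intro mult_left_mono form_factor_charge_le[OF form_factor]) auto
  have "q * \<nu> / 2 < q * \<nu>" using pos form_factor_charge_pos[OF form_factor] by simp
  from order_tendstoD(1)[OF total_charge_tendsto[of Tm] this]
  show "\<forall>\<^sub>F n in sequentially. \<forall>t. q * \<nu> / 2 \<le> total_charge r (R n) (wave (a n)) t"
    unfolding total_charge_wave[OF a_pos] by eventually_elim simp
qed

text \<open>The centre of charge is an average of points of the ball.\<close>

lemma charge_center_close:
  assumes s: "s > 0" and \<rho>: "\<rho> > 0" and tc: "total_charge r \<rho> (wave s) t > 0"
  shows "norm (charge_center r \<rho> (wave s) t - r t) \<le> \<rho>"
proof -
  let ?B = "cball (r t) \<rho>" let ?T = "total_charge r \<rho> (wave s) t"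
  let ?rho = "\<lambda>x. rho (wave s) (t, x)"
  have rho_nonneg: "?rho x \<ge> 0" for x using pos by (simp add: rho_wave)
  have cont: "continuous_on ?B ?rho"
    unfolding rho_wave amp_at
    by (intro continuous_intros continuous_on_compose2[OF profile_continuous[OF form_factor s, of UNIV]]) auto
  have i1: "set_integrable lborel ?B (\<lambda>x. ?rho x *\<^sub>R x)"
    and i2: "set_integrable lborel ?B (\<lambda>x. ?rho x *\<^sub>R r t)" and i0: "set_integrable lborel ?B ?rho"
    by (intro set_integrable_continuous_cball continuous_intros cont)+
  have "(LINT x:?B|lborel. ?rho x *\<^sub>R (x - r t)) = (LINT x:?B|lborel. ?rho x *\<^sub>R x) - (LINT x:?B|lborel. ?rho x *\<^sub>R r t)"
    unfolding scaleR_diff_right by (rule set_integral_diff(2)[OF i1 i2])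
  also have "(LINT x:?B|lborel. ?rho x *\<^sub>R r t) = ?T *\<^sub>R r t"
    using i0 unfolding set_lebesgue_integral_def total_charge_def set_integrable_def
    unfolding scaleR_scaleR[symmetric] real_scaleR_def[symmetric]
    by (subst integral_scaleR_left[symmetric]) simp_all
  finally have "charge_center r \<rho> (wave s) t - r t = (1 / ?T) *\<^sub>R (LINT x:?B|lborel. ?rho x *\<^sub>R (x - r t))"
    using tc by (simp add: charge_center_def scaleR_diff_right)
  moreover have "norm (LINT x:?B|lborel. ?rho x *\<^sub>R (x - r t)) \<le> \<rho> * ?T"
    unfolding total_charge_def
  proof (rule norm_set_integral_le_weight[OF i0])
    fix x assume "x \<in> ?B"
    then have "norm (x - r t) \<le> \<rho>" by (simp add: dist_norm norm_minus_commute)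
    then show "norm (?rho x *\<^sub>R (x - r t)) \<le> \<rho> * ?rho x"
      using rho_nonneg[of x] by (simp add: mult.commute mult_right_mono)
  qed (use \<rho> rho_nonneg in auto)
  ultimately show ?thesis using tc by (simp add: field_simps)
qed

subsection \<open>Boundary terms\<close>

text \<open>The small parameter that governs all surface integrals.\<close>

abbreviation "small n \<equiv> a n / R n ^ 4"

text \<open>A factor \<open>(R n)\<^sup>-\<^sup>2\<close> is split off the pointwise bounds, to be compensated by the area of the
  sphere. For \<open>u\<^sup>2\<close>, which is of order \<open>small n\<close>, this uses that the radii are bounded.\<close>

lemma boundary_bounds:
  obtains K where "K \<ge> 0" "\<forall>\<^sub>F n in sequentially. \<forall>t\<in>{Tm..Tp}. \<forall>x. norm (x - r t) = R n \<longrightarrow>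
     (amp (a n) (t, x))\<^sup>2 \<le> K * small n / (R n)\<^sup>2 \<and>
     (norm (gamp (a n) (t, x)))\<^sup>2 \<le> K * small n / (R n)\<^sup>2 \<and>
     \<bar>Ga (a n) ((amp (a n) (t, x))\<^sup>2)\<bar> \<le> K * small n / (R n)\<^sup>2"
proof -
  obtain K \<theta>0 where K: "K \<ge> 0" "\<theta>0 > 0"
    and b: "\<And>a y. a > 0 \<Longrightarrow> norm y / a \<ge> \<theta>0 \<Longrightarrow> (profile \<psi>1 a y)\<^sup>2 \<le> K * a / norm y ^ 4"
     "\<And>a y. a > 0 \<Longrightarrow> norm y / a \<ge> \<theta>0 \<Longrightarrow> (norm (grad (profile \<psi>1 a) y))\<^sup>2 \<le> K * a / norm y ^ 6"
     "\<And>a y. a > 0 \<Longrightarrow> norm y / a \<ge> \<theta>0 \<Longrightarrow> \<bar>nls.Ga G1' a ((profile \<psi>1 a y)\<^sup>2)\<bar> \<le> K * a / norm y ^ 6"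
    using profile_boundary_bounds[OF nonlinearity form_factor decay] by metis
  define K' where "K' = K * (1 + Rmax\<^sup>2)"
  have K': "K' \<ge> K" "K' \<ge> K * Rmax\<^sup>2" "K' \<ge> 0" using K by (simp_all add: K'_def distrib_left)
  have "\<forall>\<^sub>F n in sequentially. R n / a n \<ge> \<theta>0" using R_over_a by (simp add: filterlim_at_top)
  then have "\<forall>\<^sub>F n in sequentially. \<forall>t\<in>{Tm..Tp}. \<forall>x. norm (x - r t) = R n \<longrightarrow>
     (amp (a n) (t, x))\<^sup>2 \<le> K' * small n / (R n)\<^sup>2 \<and>
     (norm (gamp (a n) (t, x)))\<^sup>2 \<le> K' * small n / (R n)\<^sup>2 \<and>
     \<bar>Ga (a n) ((amp (a n) (t, x))\<^sup>2)\<bar> \<le> K' * small n / (R n)\<^sup>2"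
  proof eventually_elim
    case (elim n)
    have s: "small n \<ge> 0" using a_pos[of n] R_pos[of n] by simp
    have R2: "(R n)\<^sup>2 \<le> Rmax\<^sup>2" using R_le_Rmax R_pos by (intro power_mono) (auto simp: less_imp_le)
    have "K * a n / R n ^ 6 = K * small n / (R n)\<^sup>2"
      using R_pos[of n] by (simp add: divide_simps eval_nat_numeral)
    also have "\<dots> \<le> K' * small n / (R n)\<^sup>2"
      using K' s by (intro divide_right_mono mult_right_mono) auto
    finally have 6: "K * a n / R n ^ 6 \<le> K' * small n / (R n)\<^sup>2" .
    have "K * a n / R n ^ 4 = K * (R n)\<^sup>2 * small n / (R n)\<^sup>2"
      using R_pos[of n] by (simp add: divide_simps eval_nat_numeral)
    also have "\<dots> \<le> K * Rmax\<^sup>2 * small n / (R n)\<^sup>2"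
      using K s R2 by (intro divide_right_mono mult_right_mono mult_left_mono) auto
    also have "\<dots> \<le> K' * small n / (R n)\<^sup>2"
      using K' s by (intro divide_right_mono mult_right_mono) auto
    finally have 4: "K * a n / R n ^ 4 \<le> K' * small n / (R n)\<^sup>2" .
    show ?case
    proof (intro ballI allI impI)
      fix t x assume x: "norm (x - r t) = R n"
      then have th: "norm (x - r t) / a n \<ge> \<theta>0" using elim by simp
      note b = b[OF a_pos th, unfolded x]
      show "(amp (a n) (t, x))\<^sup>2 \<le> K' * small n / (R n)\<^sup>2 \<and>
        (norm (gamp (a n) (t, x)))\<^sup>2 \<le> K' * small n / (R n)\<^sup>2 \<and>
        \<bar>Ga (a n) ((amp (a n) (t, x))\<^sup>2)\<bar> \<le> K' * small n / (R n)\<^sup>2"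
        unfolding shear_def fst_conv snd_conv
        using order_trans[OF b(1) 4] order_trans[OF b(2) 6] order_trans[OF b(3) 6] by blast
    qed
  qed
  with K'(3) show ?thesis by (rule that)
qed

lemma sphere_integral_small:
  fixes F :: "nat \<Rightarrow> real \<Rightarrow> real^3 \<Rightarrow> 'b::{banach, second_countable_topology}"
  assumes "\<forall>\<^sub>F n in sequentially. \<forall>t\<in>{Tm..Tp}. \<forall>x. norm (x - r t) = R n \<longrightarrow> norm (F n t x) \<le> B * small n / (R n)\<^sup>2"
  shows "\<forall>\<^sub>F n in sequentially. \<forall>t\<in>{Tm..Tp}. norm (sphere_integral (r t) (R n) (F n t)) \<le> 2 * pi\<^sup>2 * B * small n"
  using assms
proof eventually_elim
  case (elim n)
  show ?case
  proof
    fix t assume t: "t \<in> {Tm..Tp}"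
    have "norm (sphere_integral (r t) (R n) (F n t)) \<le> 2 * pi\<^sup>2 * (R n)\<^sup>2 * (B * small n / (R n)\<^sup>2)"
      using elim t by (intro norm_sphere_integral_le R_pos) blast
    also have "\<dots> = 2 * pi\<^sup>2 * B * small n"
      using R_pos[of n] by (simp add: divide_simps eval_nat_numeral)
    finally show "norm (sphere_integral (r t) (R n) (F n t)) \<le> 2 * pi\<^sup>2 * B * small n" .
  qed
qed

lemma small_times: "(\<lambda>n. k * small n) \<longlonglongrightarrow> 0"
  using tendsto_mult_right_zero[OF ratio] .

lemma sphere_integral_uniform_limit:
  fixes F :: "nat \<Rightarrow> real \<Rightarrow> real^3 \<Rightarrow> 'b::{banach, second_countable_topology}"
  assumes "\<forall>\<^sub>F n in sequentially. \<forall>t\<in>{Tm..Tp}. \<forall>x. norm (x - r t) = R n \<longrightarrow> norm (F n t x) \<le> B * small n / (R n)\<^sup>2"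
  shows "uniform_limit {Tm..Tp} (\<lambda>n t. sphere_integral (r t) (R n) (F n t)) (\<lambda>t. 0) sequentially"
  by (rule uniform_limit_zeroI[OF sphere_integral_small[OF assms] small_times])

lemma time_sphere_integral_uniform_limit:
  fixes F :: "nat \<Rightarrow> real \<Rightarrow> real^3 \<Rightarrow> 'b::{banach, second_countable_topology}"
  assumes "\<forall>\<^sub>F n in sequentially. \<forall>t\<in>{Tm..Tp}. \<forall>x. norm (x - r t) = R n \<longrightarrow> norm (F n t x) \<le> B * small n / (R n)\<^sup>2"
  shows "uniform_limit {Tm..Tp} (\<lambda>n t. LBINT s=Tm..t. sphere_integral (r s) (R n) (F n s)) (\<lambda>t. 0) sequentially"
proof (rule uniform_limit_zeroI)
  show "\<forall>\<^sub>F n in sequentially. \<forall>t\<in>{Tm..Tp}. norm (LBINT s=Tm..t. sphere_integral (r s) (R n) (F n s))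
      \<le> (2 * pi\<^sup>2 * B * (Tp - Tm)) * small n"
    using sphere_integral_small[OF assms]
  proof eventually_elim
    case (elim n)
    show ?case
    proof
      fix t assume t: "t \<in> {Tm..Tp}"
      have "norm (LBINT s=Tm..t. sphere_integral (r s) (R n) (F n s)) \<le> 2 * pi\<^sup>2 * B * small n * (Tp - Tm)"
        by (rule norm_interval_integral_le) (use time t elim in auto)
      then show "norm (LBINT s=Tm..t. sphere_integral (r s) (R n) (F n s))
          \<le> (2 * pi\<^sup>2 * B * (Tp - Tm)) * small n" by (simp add: mult_ac)
    qed
  qed
qed (rule small_times)


lemma normal_norm: "norm (x - r t) = R n \<Longrightarrow> norm ((1 / R n) *\<^sub>R (x - r t)) = 1"
  using R_pos[of n] by simp

lemma sphere_in_tube: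
  assumes "t \<in> {Tm..Tp}" "norm (x - r t) = R n"
  shows "(t, x) \<in> tube r (R n)"
  using assms by (simp add: tube_def)

lemma stress_boundary:
  obtains B where "\<forall>\<^sub>F n in sequentially. \<forall>t\<in>{Tm..Tp}. \<forall>x. norm (x - r t) = R n \<longrightarrow>
    norm (\<chi> j. \<Sum>i\<in>UNIV. ((1 / R n) *\<^sub>R (x - r t)) $ i
      * stress (tube r (R n)) \<phi> A (a n) (wave (a n)) i j (t, x)) \<le> B * small n / (R n)\<^sup>2"
proof -
  obtain K where K: "K \<ge> 0" "\<forall>\<^sub>F n in sequentially. \<forall>t\<in>{Tm..Tp}. \<forall>x. norm (x - r t) = R n \<longrightarrow>
     (amp (a n) (t, x))\<^sup>2 \<le> K * small n / (R n)\<^sup>2 \<and>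
     (norm (gamp (a n) (t, x)))\<^sup>2 \<le> K * small n / (R n)\<^sup>2 \<and>
     \<bar>Ga (a n) ((amp (a n) (t, x))\<^sup>2)\<bar> \<le> K * small n / (R n)\<^sup>2"
    by (rule boundary_bounds)
  obtain W where W: "W \<ge> 0" "\<And>n p. p \<in> tube r (R n) \<Longrightarrow> norm (wavevec p) \<le> W"
    using wavevec_bound by metis
  define S where "S = 2 * chi\<^sup>2 / m * (K + K * W\<^sup>2 + K)"
  show ?thesis
  proof (rule that[of "9 * S"], use K(2) in eventually_elim)
    case (elim n)
    show ?case
    proof (intro ballI allI impI)
      fix t x assume t: "t \<in> {Tm..Tp}" and x: "norm (x - r t) = R n"
      let ?e = "small n / (R n)\<^sup>2" and ?n = "(1 / R n) *\<^sub>R (x - r t)"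
      let ?T = "\<lambda>i j. stress (tube r (R n)) \<phi> A (a n) (wave (a n)) i j (t, x)"
      note p = sphere_in_tube[OF t x]
      have e: "?e \<ge> 0" using a_pos[of n] R_pos[of n] by simp
      have bd: "(amp (a n) (t, x))\<^sup>2 \<le> K * ?e" "(norm (gamp (a n) (t, x)))\<^sup>2 \<le> K * ?e"
          "\<bar>Ga (a n) ((amp (a n) (t, x))\<^sup>2)\<bar> \<le> K * ?e"
        using elim t x by simp_all
      have W2: "(norm (wavevec (t, x)))\<^sup>2 \<le> W\<^sup>2" using W(2)[OF p] by (intro power_mono) auto
      have T: "\<bar>?T i j\<bar> \<le> S * ?e" for i j
      proof -
        have "\<bar>?T i j\<bar> \<le> 2 * chi\<^sup>2 / m * ((norm (gamp (a n) (t, x)))\<^sup>2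
            + (amp (a n) (t, x))\<^sup>2 * (norm (wavevec (t, x)))\<^sup>2 + \<bar>Ga (a n) ((amp (a n) (t, x))\<^sup>2)\<bar>)"
          by (rule abs_stress_wave_le[OF a_pos R_pos p])
        also have "\<dots> \<le> 2 * chi\<^sup>2 / m * (K * ?e + (K * ?e) * W\<^sup>2 + K * ?e)"
          using pos bd W2 K(1) e by (intro mult_left_mono add_mono mult_mono) auto
        also have "\<dots> = S * ?e" unfolding S_def by (simp only: distrib_left distrib_right mult_ac)
        finally show ?thesis .
      qed
      have "norm (\<chi> j. \<Sum>i\<in>UNIV. ?n $ i * ?T i j) \<le> (\<Sum>j\<in>UNIV. \<bar>\<Sum>i\<in>UNIV. ?n $ i * ?T i j\<bar>)"
        using norm_le_l1_cart[of "\<chi> j. \<Sum>i\<in>UNIV. ?n $ i * ?T i j"] by simp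
      also have "\<dots> \<le> (\<Sum>j\<in>(UNIV::3 set). \<Sum>i\<in>(UNIV::3 set). S * ?e)"
      proof (intro sum_mono order_trans[OF sum_abs])
        fix i j :: 3
        have "\<bar>?n $ i\<bar> \<le> 1" using component_le_norm_cart[of ?n i] unfolding normal_norm[OF x] .
        then have "\<bar>?n $ i\<bar> * \<bar>?T i j\<bar> \<le> 1 * (S * ?e)" using T by (intro mult_mono) auto
        then show "\<bar>?n $ i * ?T i j\<bar> \<le> S * ?e" by (simp only: abs_mult mult_1)
      qed
      also have "\<dots> = 9 * S * small n / (R n)\<^sup>2" by simp
      finally show "norm (\<chi> j. \<Sum>i\<in>UNIV. ?n $ i * ?T i j) \<le> 9 * S * small n / (R n)\<^sup>2" .
    qed
  qed
qed

text \<open>Transfer of the bound on \<open>u\<^sup>2\<close> to the densities that it dominates: charge, current and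
  momentum.\<close>

lemma density_boundary:
  fixes F :: "nat \<Rightarrow> real \<Rightarrow> real^3 \<Rightarrow> 'b::real_normed_vector"
  assumes F: "\<forall>\<^sub>F n in sequentially. \<forall>t\<in>{Tm..Tp}. \<forall>x. norm (x - r t) = R n \<longrightarrow>
      norm (F n t x) \<le> M * (amp (a n) (t, x))\<^sup>2" and M: "M \<ge> 0"
  obtains B where "\<forall>\<^sub>F n in sequentially. \<forall>t\<in>{Tm..Tp}. \<forall>x. norm (x - r t) = R n \<longrightarrow>
      norm (F n t x) \<le> B * small n / (R n)\<^sup>2"
proof -
  obtain K where "K \<ge> 0" and K: "\<forall>\<^sub>F n in sequentially. \<forall>t\<in>{Tm..Tp}. \<forall>x. norm (x - r t) = R n \<longrightarrow>
     (amp (a n) (t, x))\<^sup>2 \<le> K * small n / (R n)\<^sup>2 \<and>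
     (norm (gamp (a n) (t, x)))\<^sup>2 \<le> K * small n / (R n)\<^sup>2 \<and>
     \<bar>Ga (a n) ((amp (a n) (t, x))\<^sup>2)\<bar> \<le> K * small n / (R n)\<^sup>2"
    by (rule boundary_bounds)
  show ?thesis
  proof (rule that[of "M * K"], use F K in eventually_elim)
    case (elim n)
    show ?case
    proof (intro ballI allI impI)
      fix t x assume t: "t \<in> {Tm..Tp}" and x: "norm (x - r t) = R n"
      have "norm (F n t x) \<le> M * (amp (a n) (t, x))\<^sup>2" using elim(1) t x by blast
      also have "\<dots> \<le> M * (K * small n / (R n)\<^sup>2)" using elim(2) t x M by (intro mult_left_mono) auto
      finally show "norm (F n t x) \<le> M * K * small n / (R n)\<^sup>2" by (simp add: mult.assoc)
    qed
  qed
qed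

lemma abs_inner_normal:
  assumes "norm (x - r t) = R n" "norm z \<le> V"
  shows "\<bar>z \<bullet> ((1 / R n) *\<^sub>R (x - r t))\<bar> \<le> V"
  using Cauchy_Schwarz_ineq2[of z "(1 / R n) *\<^sub>R (x - r t)"] assms(2)
  unfolding normal_norm[OF assms(1)] by linarith

lemma norm_mom_le:
  assumes "p \<in> tube r (R n)" "norm (wavevec p) \<le> W"
  shows "norm (mom (tube r (R n)) A (wave (a n)) p) \<le> chi * W * (amp (a n) p)\<^sup>2"
  unfolding mom_wave[OF a_pos R_pos assms(1)]
  using mult_left_mono[OF assms(2), of "chi * (amp (a n) p)\<^sup>2"] pos by (simp add: abs_mult mult_ac)

lemma norm_cur_le:
  assumes "p \<in> tube r (R n)" "norm (wavevec p) \<le> W"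
  shows "norm (cur (tube r (R n)) A (wave (a n)) p) \<le> q * chi / m * W * (amp (a n) p)\<^sup>2"
proof -
  have "q * chi / m * (amp (a n) p)\<^sup>2 \<ge> 0" using pos by simp
  from mult_left_mono[OF assms(2) this] show ?thesis
    unfolding cur_wave[OF a_pos R_pos assms(1)] norm_scaleR real_norm_def abs_of_nonneg[OF \<open>0 \<le> _\<close>]
    by (simp only: mult_ac)
qed

lemma center_distance:
  "\<forall>\<^sub>F n in sequentially. \<forall>t x. norm (x - r t) = R n \<longrightarrow>
     norm (x - charge_center r (R n) (wave (a n)) t) \<le> 2 * Rmax"
  using total_charge_bounds(2)
proof eventually_elim
  case (elim n)
  show ?case
  proof (intro allI impI)
    fix t x assume x: "norm (x - r t) = R n"
    have "q * \<nu> / 2 > 0" using pos form_factor_charge_pos[OF form_factor] by simp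
    also have "q * \<nu> / 2 \<le> total_charge r (R n) (wave (a n)) t" using elim by blast
    finally have "norm (charge_center r (R n) (wave (a n)) t - r t) \<le> R n"
      by (rule charge_center_close[OF a_pos R_pos])
    then show "norm (x - charge_center r (R n) (wave (a n)) t) \<le> 2 * Rmax"
      using norm_triangle_ineq4[of "x - r t" "charge_center r (R n) (wave (a n)) t - r t"] x R_le_Rmax[of n]
      by simp
  qed
qed

lemma Rmax_pos: "Rmax > 0"
  using R_le_Rmax[of 0] R_pos[of 0] by linarith

lemma momentum_bounded:
  "\<exists>C. \<forall>n. \<forall>t\<in>{Tm..Tp}. norm (LINT x:cball (r t) (R n)|lborel. mom (tube r (R n)) A (wave (a n)) (t, x)) \<le> C"
proof -
  obtain W where W: "W \<ge> 0" "\<And>n p. p \<in> tube r (R n) \<Longrightarrow> norm (wavevec p) \<le> W"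
    using wavevec_bound by metis
  have "norm (LINT x:cball (r t) (R n)|lborel. mom (tube r (R n)) A (wave (a n)) (t, x)) \<le> chi * W * \<nu>"
    if t: "t \<in> {Tm..Tp}" for n t
  proof -
    have "norm (LINT x:cball (r t) (R n)|lborel. mom (tube r (R n)) A (wave (a n)) (t, x))
        \<le> chi * W * (LINT x:cball (r t) (R n)|lborel. (amp (a n) (t, x))\<^sup>2)"
    proof (rule norm_set_integral_le_weight[OF amp_square_integrable[OF a_pos]])
      fix x assume "x \<in> cball (r t) (R n)"
      then have "(t, x) \<in> tube r (R n)" using t by (simp add: tube_def dist_norm norm_minus_commute)
      then show "norm (mom (tube r (R n)) A (wave (a n)) (t, x)) \<le> chi * W * (amp (a n) (t, x))\<^sup>2"
        by (intro norm_mom_le W(2))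
    qed (use pos W(1) in auto)
    also have "\<dots> \<le> chi * W * \<nu>"
      using pos W(1) by (intro mult_left_mono amp_square_integral_le a_pos) auto
    finally show ?thesis .
  qed
  then show ?thesis by blast
qed

lemma momentum_flux_limit:
  "uniform_limit {Tm..Tp} (\<lambda>n t. LBINT s=Tm..t. sphere_integral (r s) (R n)
     (\<lambda>x. (vel s \<bullet> ((1 / R n) *\<^sub>R (x - r s))) *\<^sub>R mom (tube r (R n)) A (wave (a n)) (s, x))) (\<lambda>t. 0) sequentially"
proof -
  obtain W where W: "W \<ge> 0" "\<And>n p. p \<in> tube r (R n) \<Longrightarrow> norm (wavevec p) \<le> W"
    using wavevec_bound by metis
  obtain V where V: "V \<ge> 0" "\<And>t. t \<in> {Tm..Tp} \<Longrightarrow> norm (vel t) \<le> V" using vel_bound by metis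
  have "norm ((vel t \<bullet> ((1 / R n) *\<^sub>R (x - r t))) *\<^sub>R mom (tube r (R n)) A (wave (a n)) (t, x))
      \<le> V * (chi * W) * (amp (a n) (t, x))\<^sup>2" if t: "t \<in> {Tm..Tp}" and x: "norm (x - r t) = R n" for n t x
    unfolding norm_scaleR mult.assoc[of V] real_norm_def
    using V(1) norm_mom_le[OF sphere_in_tube[OF t x] W(2)[OF sphere_in_tube[OF t x]]]
    by (intro mult_mono abs_inner_normal[OF x V(2)[OF t]]) auto
  then have "\<forall>\<^sub>F n in sequentially. \<forall>t\<in>{Tm..Tp}. \<forall>x. norm (x - r t) = R n \<longrightarrow>
      norm ((vel t \<bullet> ((1 / R n) *\<^sub>R (x - r t))) *\<^sub>R mom (tube r (R n)) A (wave (a n)) (t, x))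
        \<le> V * (chi * W) * (amp (a n) (t, x))\<^sup>2"
    by (intro always_eventually) blast
  then show ?thesis
  proof (rule density_boundary)
    show "V * (chi * W) \<ge> 0" using V W pos by simp
  qed (rule time_sphere_integral_uniform_limit)
qed


lemma rho_boundary:
  assumes "V \<ge> 0" "norm z \<le> V" "norm (x - r t) = R n"
  shows "\<bar>(z \<bullet> ((1 / R n) *\<^sub>R (x - r t))) * rho (wave (a n)) (t, x)\<bar> \<le> V * q * (amp (a n) (t, x))\<^sup>2"
  unfolding abs_mult mult.assoc[of V]
  using assms pos by (intro mult_mono abs_inner_normal) (auto simp: rho_wave)

lemma cur_boundary:
  assumes t: "t \<in> {Tm..Tp}" and x: "norm (x - r t) = R n"
    and W: "\<And>p. p \<in> tube r (R n) \<Longrightarrow> norm (wavevec p) \<le> W"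
  shows "\<bar>((1 / R n) *\<^sub>R (x - r t)) \<bullet> cur (tube r (R n)) A (wave (a n)) (t, x)\<bar>
    \<le> q * chi / m * W * (amp (a n) (t, x))\<^sup>2"
  unfolding inner_commute[of "(1 / R n) *\<^sub>R (x - r t)"]
  by (rule abs_inner_normal[OF x norm_cur_le[OF sphere_in_tube[OF t x] W[OF sphere_in_tube[OF t x]]]])

lemma charge_moment_limit:
  "uniform_limit {Tm..Tp} (\<lambda>n t. sphere_integral (r t) (R n)
     (\<lambda>x. ((vel t \<bullet> ((1 / R n) *\<^sub>R (x - r t))) * rho (wave (a n)) (t, x)) *\<^sub>R
        (x - charge_center r (R n) (wave (a n)) t))) (\<lambda>t. 0) sequentially"
proof -
  obtain V where V: "V \<ge> 0" "\<And>t. t \<in> {Tm..Tp} \<Longrightarrow> norm (vel t) \<le> V" using vel_bound by metis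
  have "\<forall>\<^sub>F n in sequentially. \<forall>t\<in>{Tm..Tp}. \<forall>x. norm (x - r t) = R n \<longrightarrow>
      norm (((vel t \<bullet> ((1 / R n) *\<^sub>R (x - r t))) * rho (wave (a n)) (t, x)) *\<^sub>R
        (x - charge_center r (R n) (wave (a n)) t)) \<le> (V * q * (2 * Rmax)) * (amp (a n) (t, x))\<^sup>2"
    using center_distance
  proof eventually_elim
    case (elim n)
    show ?case
    proof (intro ballI allI impI)
      fix t x assume t: "t \<in> {Tm..Tp}" and x: "norm (x - r t) = R n"
      have "norm (((vel t \<bullet> ((1 / R n) *\<^sub>R (x - r t))) * rho (wave (a n)) (t, x)) *\<^sub>R
        (x - charge_center r (R n) (wave (a n)) t)) \<le> (V * q * (amp (a n) (t, x))\<^sup>2) * (2 * Rmax)"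
        unfolding norm_scaleR real_norm_def
        using elim x V(1) pos by (intro mult_mono rho_boundary V(2) t) auto
      then show "norm (((vel t \<bullet> ((1 / R n) *\<^sub>R (x - r t))) * rho (wave (a n)) (t, x)) *\<^sub>R
        (x - charge_center r (R n) (wave (a n)) t)) \<le> (V * q * (2 * Rmax)) * (amp (a n) (t, x))\<^sup>2"
        by (simp only: mult_ac)
    qed
  qed
  then show ?thesis
  proof (rule density_boundary)
    show "V * q * (2 * Rmax) \<ge> 0" using V pos Rmax_pos by simp
  qed (rule sphere_integral_uniform_limit)
qed

lemma current_moment_limit:
  "uniform_limit {Tm..Tp} (\<lambda>n t. sphere_integral (r t) (R n)
     (\<lambda>x. (((1 / R n) *\<^sub>R (x - r t)) \<bullet> cur (tube r (R n)) A (wave (a n)) (t, x)) *\<^sub>R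
        (x - charge_center r (R n) (wave (a n)) t))) (\<lambda>t. 0) sequentially"
proof -
  obtain W where W: "W \<ge> 0" "\<And>n p. p \<in> tube r (R n) \<Longrightarrow> norm (wavevec p) \<le> W"
    using wavevec_bound by metis
  have "\<forall>\<^sub>F n in sequentially. \<forall>t\<in>{Tm..Tp}. \<forall>x. norm (x - r t) = R n \<longrightarrow>
      norm ((((1 / R n) *\<^sub>R (x - r t)) \<bullet> cur (tube r (R n)) A (wave (a n)) (t, x)) *\<^sub>R
        (x - charge_center r (R n) (wave (a n)) t)) \<le> (q * chi / m * W * (2 * Rmax)) * (amp (a n) (t, x))\<^sup>2"
    using center_distance
  proof eventually_elim
    case (elim n)
    show ?case
    proof (intro ballI allI impI)
      fix t x assume t: "t \<in> {Tm..Tp}" and x: "norm (x - r t) = R n"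
      have "norm ((((1 / R n) *\<^sub>R (x - r t)) \<bullet> cur (tube r (R n)) A (wave (a n)) (t, x)) *\<^sub>R
        (x - charge_center r (R n) (wave (a n)) t)) \<le> (q * chi / m * W * (amp (a n) (t, x))\<^sup>2) * (2 * Rmax)"
        unfolding norm_scaleR real_norm_def
        using elim x W(1) pos by (intro mult_mono cur_boundary[OF t x W(2)]) auto
      then show "norm ((((1 / R n) *\<^sub>R (x - r t)) \<bullet> cur (tube r (R n)) A (wave (a n)) (t, x)) *\<^sub>R
        (x - charge_center r (R n) (wave (a n)) t)) \<le> (q * chi / m * W * (2 * Rmax)) * (amp (a n) (t, x))\<^sup>2"
        by (simp only: mult_ac)
    qed
  qed
  then show ?thesis
  proof (rule density_boundary)
    show "q * chi / m * W * (2 * Rmax) \<ge> 0" using W(1) pos Rmax_pos by simp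
  qed (rule sphere_integral_uniform_limit)
qed

lemma charge_flux_limit:
  "uniform_limit {Tm..Tp} (\<lambda>n t.
      (LBINT s=Tm..t. sphere_integral (r s) (R n)
         (\<lambda>x. (vel s \<bullet> ((1 / R n) *\<^sub>R (x - r s))) * rho (wave (a n)) (s, x)))
    - (LBINT s=Tm..t. sphere_integral (r s) (R n)
         (\<lambda>x. ((1 / R n) *\<^sub>R (x - r s)) \<bullet> cur (tube r (R n)) A (wave (a n)) (s, x))))
    (\<lambda>t. 0) sequentially"
proof -
  obtain W where W: "W \<ge> 0" "\<And>n p. p \<in> tube r (R n) \<Longrightarrow> norm (wavevec p) \<le> W"
    using wavevec_bound by metis
  obtain V where V: "V \<ge> 0" "\<And>t. t \<in> {Tm..Tp} \<Longrightarrow> norm (vel t) \<le> V" using vel_bound by metis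
  have "\<forall>\<^sub>F n in sequentially. \<forall>t\<in>{Tm..Tp}. \<forall>x. norm (x - r t) = R n \<longrightarrow>
      norm ((vel t \<bullet> ((1 / R n) *\<^sub>R (x - r t))) * rho (wave (a n)) (t, x)) \<le> V * q * (amp (a n) (t, x))\<^sup>2"
    unfolding real_norm_def using rho_boundary[OF V(1) V(2)] by (intro always_eventually) blast
  then have 1: "uniform_limit {Tm..Tp} (\<lambda>n t. LBINT s=Tm..t. sphere_integral (r s) (R n)
         (\<lambda>x. (vel s \<bullet> ((1 / R n) *\<^sub>R (x - r s))) * rho (wave (a n)) (s, x))) (\<lambda>t. 0) sequentially"
  proof (rule density_boundary)
    show "V * q \<ge> 0" using V pos by simp
  qed (rule time_sphere_integral_uniform_limit)
  have "\<forall>\<^sub>F n in sequentially. \<forall>t\<in>{Tm..Tp}. \<forall>x. norm (x - r t) = R n \<longrightarrow>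
      norm (((1 / R n) *\<^sub>R (x - r t)) \<bullet> cur (tube r (R n)) A (wave (a n)) (t, x))
        \<le> q * chi / m * W * (amp (a n) (t, x))\<^sup>2"
    unfolding real_norm_def by (intro always_eventually allI ballI impI cur_boundary W(2))
  then have 2: "uniform_limit {Tm..Tp} (\<lambda>n t. LBINT s=Tm..t. sphere_integral (r s) (R n)
         (\<lambda>x. ((1 / R n) *\<^sub>R (x - r s)) \<bullet> cur (tube r (R n)) A (wave (a n)) (s, x))) (\<lambda>t. 0) sequentially"
  proof (rule density_boundary)
    show "q * chi / m * W \<ge> 0" using W(1) pos by simp
  qed (rule time_sphere_integral_uniform_limit)
  from uniform_limit_minus[OF 1 2] show ?thesis by simp
qed

lemma stress_limit:
  "uniform_limit {Tm..Tp} (\<lambda>n t. LBINT s=Tm..t. sphere_integral (r s) (R n)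
     (\<lambda>x. \<chi> j. \<Sum>i\<in>UNIV. ((1 / R n) *\<^sub>R (x - r s)) $ i *
        stress (tube r (R n)) \<phi> A (a n) (wave (a n)) i j (s, x))) (\<lambda>t. 0) sequentially"
  by (rule stress_boundary) (rule time_sphere_integral_uniform_limit)

subsection \<open>The Lorentz force\<close>

lemma force_limit:
  "uniform_limit {Tm..Tp} (\<lambda>n t. LBINT s=Tm..t.
       (LINT x:cball (r s) (R n)|lborel.
          rho (wave (a n)) (s, x) *\<^sub>R (E_field \<phi> A (s, x) - E_field \<phi> A (s, r s)))
     + (LINT x:cball (r s) (R n)|lborel. (1 / c) *\<^sub>R
          cross3 (cur (tube r (R n)) A (wave (a n)) (s, x)) (B_field A (s, x) - B_field A (s, r s))))
   (\<lambda>t. 0) sequentially"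
proof -
  let ?e = "\<lambda>n s. LINT x:cball (r s) (R n)|lborel.
      rho (wave (a n)) (s, x) *\<^sub>R (E_field \<phi> A (s, x) - E_field \<phi> A (s, r s))"
  let ?b = "\<lambda>n s. LINT x:cball (r s) (R n)|lborel. (1 / c) *\<^sub>R
      cross3 (cur (tube r (R n)) A (wave (a n)) (s, x)) (B_field A (s, x) - B_field A (s, r s))"
  obtain W where W: "W \<ge> 0" "\<And>n p. p \<in> tube r (R n) \<Longrightarrow> norm (wavevec p) \<le> W"
    using wavevec_bound by metis
  define M where "M = q + 1 / c * (q * chi / m * W)"
  have M: "M > 0" unfolding M_def using pos W(1) by (intro add_pos_nonneg) auto
  have force: "norm (?e n s + ?b n s) \<le> \<epsilon> * M * \<nu>"
    if s: "s \<in> {Tm..Tp}" and "\<epsilon> > 0"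
      and E: "\<And>x. x \<in> cball (r s) (R n) \<Longrightarrow> norm (E_field \<phi> A (s, x) - E_field \<phi> A (s, r s)) \<le> \<epsilon>"
      and B: "\<And>x. x \<in> cball (r s) (R n) \<Longrightarrow> norm (B_field A (s, x) - B_field A (s, r s)) \<le> \<epsilon>" for n s \<epsilon>
  proof -
    let ?N = "LINT x:cball (r s) (R n)|lborel. (amp (a n) (s, x))\<^sup>2"
    have 1: "norm (?e n s) \<le> q * \<epsilon> * ?N"
    proof (rule norm_set_integral_le_weight[OF amp_square_integrable[OF a_pos]])
      fix x assume x: "x \<in> cball (r s) (R n)"
      have "norm (rho (wave (a n)) (s, x) *\<^sub>R (E_field \<phi> A (s, x) - E_field \<phi> A (s, r s)))
          \<le> q * (amp (a n) (s, x))\<^sup>2 * \<epsilon>"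
        unfolding norm_scaleR rho_wave using pos E[OF x] by (intro mult_mono) auto
      then show "norm (rho (wave (a n)) (s, x) *\<^sub>R (E_field \<phi> A (s, x) - E_field \<phi> A (s, r s)))
          \<le> q * \<epsilon> * (amp (a n) (s, x))\<^sup>2" by (simp only: mult_ac)
    qed (use pos \<open>\<epsilon> > 0\<close> in auto)
    have 2: "norm (?b n s) \<le> 1 / c * (q * chi / m * W) * \<epsilon> * ?N"
    proof (rule norm_set_integral_le_weight[OF amp_square_integrable[OF a_pos]])
      fix x assume x: "x \<in> cball (r s) (R n)"
      then have p: "(s, x) \<in> tube r (R n)" using s by (simp add: tube_def dist_norm norm_minus_commute)
      let ?J = "cur (tube r (R n)) A (wave (a n)) (s, x)" and ?dB = "B_field A (s, x) - B_field A (s, r s)"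
      have "norm (cross3 ?J ?dB) \<le> norm ?J * norm ?dB" by (rule norm_cross3_le)
      also have "\<dots> \<le> (q * chi / m * W * (amp (a n) (s, x))\<^sup>2) * \<epsilon>"
        using pos W(1) B[OF x] by (intro mult_mono norm_cur_le[OF p W(2)[OF p]]) auto
      finally have "norm (cross3 ?J ?dB) \<le> (q * chi / m * W * (amp (a n) (s, x))\<^sup>2) * \<epsilon>" .
      then have "1 / c * norm (cross3 ?J ?dB) \<le> 1 / c * ((q * chi / m * W * (amp (a n) (s, x))\<^sup>2) * \<epsilon>)"
        using pos by (intro mult_left_mono) auto
      moreover have "norm ((1 / c) *\<^sub>R cross3 ?J ?dB) = 1 / c * norm (cross3 ?J ?dB)" using pos by simp
      ultimately show "norm ((1 / c) *\<^sub>R cross3 ?J ?dB) \<le> 1 / c * (q * chi / m * W) * \<epsilon> * (amp (a n) (s, x))\<^sup>2"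
        by (simp only: mult_ac)
    qed (use pos W(1) \<open>\<epsilon> > 0\<close> in auto)
    have "norm (?e n s + ?b n s) \<le> q * \<epsilon> * ?N + 1 / c * (q * chi / m * W) * \<epsilon> * ?N"
      by (rule order_trans[OF norm_triangle_ineq add_mono[OF 1 2]])
    also have "\<dots> = \<epsilon> * M * ?N" unfolding M_def by (simp only: distrib_left distrib_right mult_ac)
    also have "\<dots> \<le> \<epsilon> * M * \<nu>"
      using M \<open>\<epsilon> > 0\<close> by (intro mult_left_mono amp_square_integral_le a_pos) auto
    finally show ?thesis .
  qed
  show ?thesis
  proof (rule uniform_limitI)
    fix e :: real assume e: "e > 0"
    define L where "L = M * \<nu> * (Tp - Tm)"
    have L: "L > 0"
      unfolding L_def using M form_factor_charge_pos[OF form_factor] time by simp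
    define \<epsilon> where "\<epsilon> = e / (2 * L)"
    have \<epsilon>: "\<epsilon> > 0" "\<epsilon> * L < e" using e L unfolding \<epsilon>_def by simp_all
    show "\<forall>\<^sub>F n in sequentially. \<forall>t\<in>{Tm..Tp}. dist (LBINT s=Tm..t. ?e n s + ?b n s) 0 < e"
      using uniformly_close[OF E_field_continuous \<epsilon>(1)] uniformly_close[OF B_field_continuous \<epsilon>(1)]
    proof eventually_elim
      case (elim n)
      show ?case
      proof
        fix t assume t: "t \<in> {Tm..Tp}"
        have "norm (LBINT s=Tm..t. ?e n s + ?b n s) \<le> \<epsilon> * M * \<nu> * (Tp - Tm)"
        proof (rule norm_interval_integral_le)
          fix u assume "u \<in> {Tm..Tp}"
          with elim show "norm (?e n u + ?b n u) \<le> \<epsilon> * M * \<nu>" by (intro force \<epsilon>(1)) blast+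
        qed (use time t in auto)
        with \<epsilon>(2) show "dist (LBINT s=Tm..t. ?e n s + ?b n s) 0 < e"
          by (simp only: dist_norm diff_0_right mult.assoc L_def)
      qed
    qed
  qed
qed

lemma concentrates_wave: "concentrates r \<phi> A a R (\<lambda>n. wave (a n))"
  unfolding concentrates_def Let_def
proof (intro conjI allI)
  show "\<exists>C c0 n0. c0 > 0 \<and> (\<forall>n\<ge>n0. \<forall>t\<in>{Tm..Tp}. c0 \<le> total_charge r (R n) (wave (a n)) t
      \<and> total_charge r (R n) (wave (a n)) t \<le> C)"
  proof -
    obtain n0 where "\<And>n t. n \<ge> n0 \<Longrightarrow> q * \<nu> / 2 \<le> total_charge r (R n) (wave (a n)) t"
      using total_charge_bounds(2) unfolding eventually_sequentially by blast
    moreover have "q * \<nu> / 2 > 0" using pos form_factor_charge_pos[OF form_factor] by simp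
    ultimately show ?thesis using total_charge_bounds(1) by blast
  qed
  show "\<exists>C. \<forall>n. \<forall>t\<in>{Tm..Tp}. norm (LINT x:cball (r t) (R n)|lborel.
      mom (tube r (R n)) A (wave (a n)) (t, x)) \<le> C"
    by (rule momentum_bounded)
  \<comment> \<open>The charge converges at every time, so any base time will do.\<close>
  have "Tm \<in> {Tm..Tp}" using time by simp
  moreover have "convergent (\<lambda>n. total_charge r (R n) (wave (a n)) Tm)"
    using total_charge_tendsto by (rule convergentI)
  ultimately show "\<exists>t0\<in>{Tm..Tp}. convergent (\<lambda>n. total_charge r (R n) (wave (a n)) t0) \<and>
     uniform_limit {Tm..Tp} (\<lambda>n t. LBINT s=t0..t. sphere_integral (r s) (R n)
       (\<lambda>x. \<chi> j. \<Sum>i\<in>UNIV. ((1 / R n) *\<^sub>R (x - r s)) $ i *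
          stress (tube r (R n)) \<phi> A (a n) (wave (a n)) i j (s, x))) (\<lambda>t. 0) sequentially \<and>
     uniform_limit {Tm..Tp} (\<lambda>n t. LBINT s=t0..t. sphere_integral (r s) (R n)
       (\<lambda>x. (vel s \<bullet> (1 / R n) *\<^sub>R (x - r s)) *\<^sub>R mom (tube r (R n)) A (wave (a n)) (s, x))) (\<lambda>t. 0) sequentially \<and>
     uniform_limit {Tm..Tp} (\<lambda>n t. sphere_integral (r t) (R n)
       (\<lambda>x. ((vel t \<bullet> (1 / R n) *\<^sub>R (x - r t)) * rho (wave (a n)) (t, x)) *\<^sub>R
          (x - charge_center r (R n) (wave (a n)) t))) (\<lambda>t. 0) sequentially \<and>
     uniform_limit {Tm..Tp} (\<lambda>n t. sphere_integral (r t) (R n)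
       (\<lambda>x. ((1 / R n) *\<^sub>R (x - r t) \<bullet> cur (tube r (R n)) A (wave (a n)) (t, x)) *\<^sub>R
          (x - charge_center r (R n) (wave (a n)) t))) (\<lambda>t. 0) sequentially \<and>
     uniform_limit {Tm..Tp} (\<lambda>n t.
        (LBINT s=t0..t. sphere_integral (r s) (R n)
           (\<lambda>x. (vel s \<bullet> (1 / R n) *\<^sub>R (x - r s)) * rho (wave (a n)) (s, x)))
      - (LBINT s=t0..t. sphere_integral (r s) (R n)
           (\<lambda>x. (1 / R n) *\<^sub>R (x - r s) \<bullet> cur (tube r (R n)) A (wave (a n)) (s, x))))
       (\<lambda>t. 0) sequentially \<and>
     uniform_limit {Tm..Tp} (\<lambda>n t. LBINT s=t0..t.
         (LINT x:cball (r s) (R n)|lborel.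
            rho (wave (a n)) (s, x) *\<^sub>R (E_field \<phi> A (s, x) - E_field \<phi> A (s, r s)))
       + (LINT x:cball (r s) (R n)|lborel. (1 / c) *\<^sub>R
            cross3 (cur (tube r (R n)) A (wave (a n)) (s, x)) (B_field A (s, x) - B_field A (s, r s))))
       (\<lambda>t. 0) sequentially"
    by (intro bexI[of _ Tm] conjI stress_limit momentum_flux_limit charge_moment_limit
        current_moment_limit charge_flux_limit force_limit)
qed (rule trajectory_r C2_phi C2_A nonlinearity a_pos R_pos a_lim R_lim R_over_a
    C2_on_subset[OF C2_wave[OF a_pos] tube_strip] wave_solves_NLS[OF a_pos R_pos])+

end

theorem theorem5:
  fixes m q chi c Tm Tp tstar :: real
    and G1 G1' \<psi>1 :: "real \<Rightarrow> real"
    and a R :: "nat \<Rightarrow> real"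
    and r :: "real \<Rightarrow> real^3"
    and \<phi> :: "spacetime \<Rightarrow> real" and A :: "spacetime \<Rightarrow> real^3"
    and \<phi>0 :: "real \<Rightarrow> real" and g A0 :: "real \<Rightarrow> real^3" and A1 :: "real \<Rightarrow> real^3^3"
    and P3 :: "spacetime \<Rightarrow> real"
  assumes "m > 0" "q > 0" "chi > 0" "c > 0"
    and "Tm < Tp" "tstar \<in> {Tm..Tp}"
    and "nonlinearity_condition G1 G1'"
    and "form_factor G1' \<psi>1"
    and "\<exists>C. \<forall>\<^sub>F \<theta> in at_top. \<theta>\<^sup>2 * \<bar>\<psi>1 \<theta>\<bar> \<le> C"
    and "\<exists>C. \<forall>\<^sub>F \<theta> in at_top. \<theta>^3 * \<bar>deriv \<psi>1 \<theta>\<bar> \<le> C"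
    and "\<And>n. a n > 0" "\<And>n. R n > 0"
    and "a \<longlonglongrightarrow> 0" "R \<longlonglongrightarrow> 0" "(\<lambda>n. a n / R n ^ 4) \<longlonglongrightarrow> 0"
    and "C2_on {Tm..Tp} r"
    and "nls.admissible_potentials m q c Tm Tp r \<phi> A \<phi>0 g A0 A1 P3"
    and "nls.newton m q c Tm Tp \<phi> A r"
  shows "nls.concentrates m q chi c G1 G1' Tm Tp r \<phi> A a R
    (\<lambda>n. nls.wave_corpuscle m q chi c Tm Tp \<psi>1 tstar r \<phi>0 A0 A1 P3 (a n))"
proof -
  interpret corpuscle_sequence m q chi c G1 G1' Tm Tp \<psi>1 tstar r \<phi> A \<phi>0 g A0 A1 P3 a R
    by unfold_locales (fact assms)+
  show ?thesis by (rule concentrates_wave)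
qed

end
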